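(* Let $\varepsilon\in\{+1,-1\}$, let $m\ge1$ and $k$ be integers, and let $\mathcal{M}=(M,g)$ be a harmonic space whose density function satisfies $\Theta_{\mathcal{M}}=\Theta_\varepsilon(m,k)$, where $\Theta_{+}(m,k)(r)=\sin(r)^{m-1}\cos(r)^k$ and $\Theta_{-}(m,k)(r)=\sinh(r)^{m-1}\cosh(r)^k$. Then: (1) $m=\dim(M)$ and $0\le k\le m-1$. (2) If $k=0$, then $\mathcal{M}$ has constant sectional curvature $\varepsilon$. (3) If $k=m-1$, then $\mathcal{M}$ has constant sectional curvature $4\varepsilon$.
   Context: Let $\mathcal{M}=(M,g)$ be a (smooth) Riemannian manifold with Riemannian measure $\operatorname{dvol}_{\mathcal{M}}$. For $P\in M$ write $\xi\in T_PM$ in polar coordinates $\xi=r\theta$, $r=\|\xi\|>0$, $\|\theta\|=1$. The density $\Theta_{\mathcal{M}}(P;\xi)$ is defined for small $\xi\neq0$ by $\exp_P^*\operatorname{dvol}_{\mathcal{M}}=\Theta_{\mathcal{M}}(P;\xi)\,dr\,d\theta$, where $d\theta$ is the standard measure on the unit sphere of $T_PM$; equivalently $\Theta_{\mathcal{M}}(P;\xi)=r^{\dim(M)-1}\sqrt{\det(g_{ij}(\xi))}$ in geodesic normal coordinates at $P$. $\mathcal{M}$ is a harmonic space if $\Theta_{\mathcal{M}}(P;\xi)$ depends only on $\|\xi\|$, in which case one writes $\Theta_{\mathcal{M}}(r)$, $r=\|\xi\|$. The equality $\Theta_{\mathcal{M}}=\Theta_\varepsilon(m,k)$ is as functions of $r$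 for small $r>0$. No completeness is assumed. Subscripts $\varepsilon=\pm$ are identified with the signs $\pm1$. Curvature signs are normalized so that the round unit sphere has sectional curvature $+1$. *)

theory Defs
  imports "HOL-Analysis.Analysis"
begin

text \<open>C-infinity maps on an open set \<open>S\<close>: all iterated directional derivatives exist and are continuous.\<close>

primrec Ck_on :: "nat \<Rightarrow> 'a::real_normed_vector set \<Rightarrow> ('a \<Rightarrow> 'b::real_normed_vector) \<Rightarrow> bool" where
  "Ck_on 0 S f \<longleftrightarrow> continuous_on S f"
| "Ck_on (Suc n) S f \<longleftrightarrow>
     (\<forall>x\<in>S. f differentiable (at x)) \<and>
     (\<forall>v. Ck_on n S (\<lambda>x. frechet_derivative f (at x) v))"

definition smooth_on :: "'a::real_normed_vector set \<Rightarrow> ('a \<Rightarrow> 'b::real_normed_vector) \<Rightarrow> bool" where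
  "smooth_on S f \<longleftrightarrow> (\<forall>n. Ck_on n S f)"


text \<open>
  A chart is a pair of a domain and a coordinate map.  The dimension of the manifold is
  \<open>CARD('n)\<close>.  The metric tensor is given by its local representations:
  \<open>metric M c x u v\<close> is the inner product of the tangent vectors with coordinates \<open>u\<close>, \<open>v\<close> in the
  chart \<open>c\<close>, at the point whose coordinates in \<open>c\<close> are \<open>x\<close>.
\<close>

type_synonym ('a, 'n) chart = "'a set \<times> ('a \<Rightarrow> real ^ 'n)"

abbreviation dom_of :: "('a, 'n::finite) chart \<Rightarrow> 'a set" where "dom_of c \<equiv> fst c"
abbreviation coord :: "('a, 'n::finite) chart \<Rightarrow> 'a \<Rightarrow> real ^ 'n" where "coord c \<equiv> snd c"

record ('a, 'n::finite) rspace =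
  top_of :: "'a topology"
  atlas :: "('a, 'n) chart set"
  metric :: "('a, 'n) chart \<Rightarrow> real ^ 'n \<Rightarrow> real ^ 'n \<Rightarrow> real ^ 'n \<Rightarrow> real"

abbreviation points :: "('a, 'n::finite) rspace \<Rightarrow> 'a set" where
  "points M \<equiv> topspace (top_of M)"

definition is_chart :: "'a topology \<Rightarrow> ('a, 'n::finite) chart \<Rightarrow> bool" where
  "is_chart X c \<longleftrightarrow>
     openin X (dom_of c) \<and> open (coord c ` dom_of c) \<and>
     homeomorphic_map (subtopology X (dom_of c)) (top_of_set (coord c ` dom_of c)) (coord c)"

definition transition :: "('a, 'n::finite) chart \<Rightarrow> ('a, 'n) chart \<Rightarrow> real ^ 'n \<Rightarrow> real ^ 'n" where
  "transition c c' = coord c' \<circ> inv_into (dom_of c) (coord c)"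

definition smooth_manifold :: "('a, 'n::finite) rspace \<Rightarrow> bool" where
  "smooth_manifold M \<longleftrightarrow>
     points M \<noteq> {} \<and> Hausdorff_space (top_of M) \<and> second_countable (top_of M) \<and>
     (\<forall>c\<in>atlas M. is_chart (top_of M) c) \<and>
     (\<Union>c\<in>atlas M. dom_of c) = points M \<and>
     (\<forall>c\<in>atlas M. \<forall>c'\<in>atlas M.
        smooth_on (coord c ` (dom_of c \<inter> dom_of c')) (transition c c'))"

definition riemannian_manifold :: "('a, 'n::finite) rspace \<Rightarrow> bool" where
  "riemannian_manifold M \<longleftrightarrow>
     smooth_manifold M \<and>
     (\<forall>c\<in>atlas M. \<forall>x\<in>coord c ` dom_of c.
        bilinear (metric M c x) \<and>
        (\<forall>u v. metric M c x u v = metric M c x v u) \<and>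
        (\<forall>u. u \<noteq> 0 \<longrightarrow> metric M c x u u > 0)) \<and>
     (\<forall>c\<in>atlas M. \<forall>u v. smooth_on (coord c ` dom_of c) (\<lambda>x. metric M c x u v)) \<and>
     (\<forall>c\<in>atlas M. \<forall>c'\<in>atlas M. \<forall>p\<in>dom_of c \<inter> dom_of c'. \<forall>u v.
        metric M c (coord c p) u v =
        metric M c' (coord c' p)
          (frechet_derivative (transition c c') (at (coord c p)) u)
          (frechet_derivative (transition c c') (at (coord c p)) v))"


text \<open>
  The Levi-Civita connection in the chart \<open>c\<close> is \<open>\<nabla>\<^sub>u v = D\<^sub>u v + christoffel M c x u v\<close>;
  the defining equation is the Koszul formula for coordinate (constant) vector fields.
\<close>

definition christoffel ::
  "('a, 'n::finite) rspace \<Rightarrow> ('a, 'n) chart \<Rightarrow> real ^ 'n \<Rightarrow> real ^ 'n \<Rightarrow> real ^ 'n \<Rightarrow> real ^ 'n" where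
  "christoffel M c x u v =
     (THE w. \<forall>z. 2 * metric M c x w z =
        frechet_derivative (\<lambda>y. metric M c y v z) (at x) u
      + frechet_derivative (\<lambda>y. metric M c y u z) (at x) v
      - frechet_derivative (\<lambda>y. metric M c y u v) (at x) z)"

definition curvature ::
  "('a, 'n::finite) rspace \<Rightarrow> ('a, 'n) chart \<Rightarrow> real ^ 'n \<Rightarrow> real ^ 'n \<Rightarrow> real ^ 'n \<Rightarrow> real ^ 'n \<Rightarrow> real ^ 'n"
  where
  "curvature M c x u v w =
       frechet_derivative (\<lambda>y. christoffel M c y v w) (at x) u
     - frechet_derivative (\<lambda>y. christoffel M c y u w) (at x) v
     + christoffel M c x u (christoffel M c x v w)
     - christoffel M c x v (christoffel M c x u w)"

definition sectional_curvature ::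
  "('a, 'n::finite) rspace \<Rightarrow> ('a, 'n) chart \<Rightarrow> real ^ 'n \<Rightarrow> real ^ 'n \<Rightarrow> real ^ 'n \<Rightarrow> real" where
  "sectional_curvature M c x u v =
     metric M c x (curvature M c x u v v) u /
     (metric M c x u u * metric M c x v v - (metric M c x u v)\<^sup>2)"

definition constant_sectional_curvature :: "('a, 'n::finite) rspace \<Rightarrow> real \<Rightarrow> bool" where
  "constant_sectional_curvature M \<kappa> \<longleftrightarrow>
     (\<forall>c\<in>atlas M. \<forall>P\<in>dom_of c. \<forall>u v. u \<noteq> v \<and> independent {u, v} \<longrightarrow>
        sectional_curvature M c (coord c P) u v = \<kappa>)"


definition geodesic_on :: "('a, 'n::finite) rspace \<Rightarrow> real set \<Rightarrow> (real \<Rightarrow> 'a) \<Rightarrow> bool" where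
  "geodesic_on M I \<gamma> \<longleftrightarrow>
     open I \<and> is_interval I \<and> continuous_map (top_of_set I) (top_of M) \<gamma> \<and>
     (\<forall>c\<in>atlas M. \<exists>v. \<forall>s\<in>I. \<gamma> s \<in> dom_of c \<longrightarrow>
        ((\<lambda>t. coord c (\<gamma> t)) has_vector_derivative v s) (at s) \<and>
        (v has_vector_derivative - christoffel M c (coord c (\<gamma> s)) (v s) (v s)) (at s))"

text \<open>
  The tangent space at \<open>P\<close> is identified with \<open>real ^ 'n\<close> by means of one fixed chart
  \<open>chart_at M P\<close> around \<open>P\<close>.
\<close>

definition chart_at :: "('a, 'n::finite) rspace \<Rightarrow> 'a \<Rightarrow> ('a, 'n) chart" where
  "chart_at M P = (SOME c. c \<in> atlas M \<and> P \<in> dom_of c)"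

definition tangent_inner :: "('a, 'n::finite) rspace \<Rightarrow> 'a \<Rightarrow> real ^ 'n \<Rightarrow> real ^ 'n \<Rightarrow> real" where
  "tangent_inner M P = metric M (chart_at M P) (coord (chart_at M P) P)"

definition tangent_norm :: "('a, 'n::finite) rspace \<Rightarrow> 'a \<Rightarrow> real ^ 'n \<Rightarrow> real" where
  "tangent_norm M P \<xi> = sqrt (tangent_inner M P \<xi> \<xi>)"

definition riem_exp :: "('a, 'n::finite) rspace \<Rightarrow> 'a \<Rightarrow> real ^ 'n \<Rightarrow> 'a" where
  "riem_exp M P \<xi> =
     (THE q. \<exists>I \<gamma>. {0..1} \<subseteq> I \<and> geodesic_on M I \<gamma> \<and> \<gamma> 0 = P \<and>
        ((\<lambda>t. coord (chart_at M P) (\<gamma> t)) has_vector_derivative \<xi>) (at 0) \<and> \<gamma> 1 = q)"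

text \<open>
  A linear isometry \<open>E\<close> from \<open>real ^ 'n\<close> onto the tangent space at \<open>P\<close> amounts to an orthonormal
  basis of it; geodesic normal coordinates \<open>x\<close> at \<open>P\<close> are then given by \<open>riem_exp M P (E x)\<close>, and
  \<open>normal_metric M P E x\<close> is the matrix of the metric in these coordinates.
\<close>

definition orthonormal_frame :: "('a, 'n::finite) rspace \<Rightarrow> 'a \<Rightarrow> (real ^ 'n \<Rightarrow> real ^ 'n) \<Rightarrow> bool" where
  "orthonormal_frame M P E \<longleftrightarrow>
     linear E \<and> (\<forall>u v. tangent_inner M P (E u) (E v) = u \<bullet> v)"

definition normal_metric ::
  "('a, 'n::finite) rspace \<Rightarrow> 'a \<Rightarrow> (real ^ 'n \<Rightarrow> real ^ 'n) \<Rightarrow> real ^ 'n \<Rightarrow> real ^ 'n ^ 'n" where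
  "normal_metric M P E x =
     (let q = riem_exp M P (E x);
          D = frechet_derivative (\<lambda>y. coord (chart_at M q) (riem_exp M P (E y))) (at x)
      in \<chi> i j. tangent_inner M q (D (axis i 1)) (D (axis j 1)))"

text \<open>The value does not depend on the choice of the frame.\<close>

definition density :: "('a, 'n::finite) rspace \<Rightarrow> 'a \<Rightarrow> real ^ 'n \<Rightarrow> real" where
  "density M P \<xi> =
     (let E = (SOME E. orthonormal_frame M P E)
      in tangent_norm M P \<xi> ^ (CARD('n) - 1) * sqrt (det (normal_metric M P E (inv E \<xi>))))"

text \<open>
  Only the germ of \<open>\<Theta>\<close> at \<open>0\<close> is meaningful: no completeness is assumed, and how small \<open>\<xi>\<close> has to be
  may depend on \<open>P\<close>.
\<close>

definition density_function :: "('a, 'n::finite) rspace \<Rightarrow> (real \<Rightarrow> real) \<Rightarrow> bool" where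
  "density_function M \<Theta> \<longleftrightarrow>
     (\<forall>P\<in>points M. \<exists>\<delta>>0. \<forall>\<xi>. 0 < tangent_norm M P \<xi> \<and> tangent_norm M P \<xi> < \<delta> \<longrightarrow>
        density M P \<xi> = \<Theta> (tangent_norm M P \<xi>))"

definition harmonic_space :: "('a, 'n::finite) rspace \<Rightarrow> bool" where
  "harmonic_space M \<longleftrightarrow> riemannian_manifold M \<and> (\<exists>\<Theta>. density_function M \<Theta>)"

definition model_density :: "int \<Rightarrow> int \<Rightarrow> int \<Rightarrow> real \<Rightarrow> real" where
  "model_density \<epsilon> m k r =
     (if \<epsilon> = 1 then sin r powi (m - 1) * cos r powi k
      else sinh r powi (m - 1) * cosh r powi k)"

end

theory Submission
  imports Defs "HOL-Real_Asymp.Real_Asymp"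
begin

text \<open>
  Along a unit speed geodesic from \<open>P\<close> in direction \<open>\<theta>\<close> let \<open>J\<^sub>i\<close> be the Jacobi fields vanishing at \<open>P\<close>
  whose covariant derivatives \<open>K\<^sub>i\<close> start as an orthonormal basis.  With the Gram matrices
  \<open>G = \<langle>J\<^sub>i, J\<^sub>j\<rangle>\<close>, \<open>H = \<langle>K\<^sub>i, J\<^sub>j\<rangle>\<close> the density satisfies \<open>det G = t\<^sup>2 \<Theta>(t)\<^sup>2\<close>, and
  \<open>G = t\<^sup>2 - R\<^sub>\<theta> t\<^sup>4 / 3 + o(t\<^sup>4)\<close>, where \<open>R\<^sub>\<theta>\<close> is the Jacobi operator at \<open>P\<close>.  The leading terms of the
  determinant give \<open>m = dim M\<close> and that all Ricci curvatures are equal to \<open>\<epsilon> (m - 1 + 3k)\<close>.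

  The shape operator \<open>Y\<close> of the geodesic spheres, which is conjugate to \<open>G\<inverse> H\<close>, satisfies a Riccati
  equation whose trace expresses \<open>tr Y\<^sup>2\<close> by \<open>tr Y = \<Theta>'/\<Theta>\<close> and the constant Ricci curvature.  As \<open>Y\<close> is
  self-adjoint, \<open>tr (Y - \<phi>)\<^sup>2 \<ge> 0\<close> on the orthogonal complement of the radial direction for every number \<open>\<phi>\<close>.
  For \<open>\<phi> = cot t - \<xi> tan t\<close> (and its hyperbolic analogue) this trace equals
  \<open>tan\<^sup>2 t (k + (m - 1) \<xi>\<^sup>2 - 2 \<xi> k)\<close>; \<open>\<xi> = 0\<close> gives \<open>k \<ge> 0\<close> and \<open>\<xi> = 1\<close> gives \<open>k \<le> m - 1\<close>.  In the
  extreme cases \<open>Y = \<phi>\<close> there, hence \<open>G\<close> is explicit, and its \<open>t\<^sup>4\<close> term yields \<open>R\<^sub>\<theta>\<close>.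
\<close>

text \<open>The choice of \<open>\<phi>\<close> has a geometric origin: cot t - \<xi> tan t is the
  logarithmic derivative of sin t (cos t)^\<xi>. For \<xi> = 0 and \<xi> = 1 this function is sin t
  and sin(2t)/2, the warping functions of constant curvature 1 and 4, which is why these two values
  give the bounds as well as the rigidity. Gram matrices are used instead of a parallel frame
  because their entries are scalar functions along the geodesic. An orthonormal basis enters only at
  single times, where the sign of a trace has to be seen. Without completeness, and with a radius of
  validity that depends on the point, the density carries information about germs only. The Ricci
  identity is therefore a statement at one centre, and it is applied anew at every point of the
  geodesic before the Riccati equation can use it as a constant. Geodesics and the exponential map
  are defined on the manifold through all charts and by \<open>THE\<close>. The main obstacle
  outside of the matrix argument is to show that for small vectors they are what one chart computes;
  the Hausdorff property enters there.\<close>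

section \<open>Calculus of \<open>C\<^sup>k\<close> maps\<close>

lemma frechet_derivative_cong_open:
  assumes "open S" "x \<in> S" "\<And>y. y \<in> S \<Longrightarrow> f y = g y"
  shows "frechet_derivative f (at x) = frechet_derivative g (at x)"
proof -
  have "(f has_derivative D) (at x) \<longleftrightarrow> (g has_derivative D) (at x)" for D
    using has_derivative_transform_within_open[of f D x UNIV S g]
      has_derivative_transform_within_open[of g D x UNIV S f] assms by auto
  then show ?thesis unfolding frechet_derivative_def by simp
qed

lemma Ck_on_cong:
  assumes "open S" "\<And>y. y \<in> S \<Longrightarrow> f y = g y"
  shows "Ck_on n S f \<longleftrightarrow> Ck_on n S g"
  using assms(2)
proof (induction n arbitrary: f g)
  case 0
  then show ?case by (auto intro: continuous_on_cong)
next
  case (Suc n)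
  have fd: "frechet_derivative f (at x) = frechet_derivative g (at x)" if "x \<in> S" for x
    using frechet_derivative_cong_open[OF assms(1) that] Suc.prems by blast
  have "f differentiable (at x) \<longleftrightarrow> g differentiable (at x)" if "x \<in> S" for x
    unfolding differentiable_def
    using has_derivative_transform_within_open[of f _ x UNIV S g]
      has_derivative_transform_within_open[of g _ x UNIV S f] assms(1) Suc.prems that by metis
  moreover have "Ck_on n S (\<lambda>x. frechet_derivative f (at x) v)
      \<longleftrightarrow> Ck_on n S (\<lambda>x. frechet_derivative g (at x) v)" for v
    by (rule Suc.IH) (simp add: fd)
  ultimately show ?case by simp
qed

text \<open>\<open>Ck_on\<close> recurses through \<open>frechet_derivative\<close>; this rule lets
  an explicitly computed derivative stand in for it, so that the inductions below can use the
  ordinary differentiation rules.\<close>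

lemma Ck_on_SucI:
  assumes "open S" "\<And>x. x \<in> S \<Longrightarrow> (f has_derivative f' x) (at x)"
    and "\<And>v. Ck_on n S (\<lambda>x. f' x v)"
  shows "Ck_on (Suc n) S f"
proof -
  have fd: "frechet_derivative f (at x) = f' x" if "x \<in> S" for x
    using frechet_derivative_at[OF assms(2)[OF that]] by simp
  have "Ck_on n S (\<lambda>x. frechet_derivative f (at x) v)" for v
    using Ck_on_cong[OF assms(1), of "\<lambda>x. frechet_derivative f (at x) v" "\<lambda>x. f' x v" n] fd assms(3)
    by auto
  then show ?thesis using assms(2) by (auto simp: differentiable_def)
qed

lemma Ck_on_has_derivative:
  "Ck_on (Suc n) S f \<Longrightarrow> x \<in> S \<Longrightarrow> (f has_derivative frechet_derivative f (at x)) (at x)"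
  by (auto simp: frechet_derivative_works)

lemma Ck_on_Suc_imp: "Ck_on (Suc n) S f \<Longrightarrow> Ck_on n S f"
proof (induction n arbitrary: f)
  case 0
  then show ?case
    by (auto intro!: differentiable_imp_continuous_on differentiable_at_imp_differentiable_on)
next
  case (Suc n)
  then show ?case by simp
qed

lemma Ck_on_continuous_on: "Ck_on n S f \<Longrightarrow> continuous_on S f"
  by (induction n) (auto dest: Ck_on_Suc_imp simp del: Ck_on.simps(2))

lemma Ck_on_const: "open S \<Longrightarrow> Ck_on n S (\<lambda>x. c)"
proof (induction n arbitrary: c)
  case (Suc n)
  then show ?case by (intro Ck_on_SucI[where f'="\<lambda>x v. 0"]) auto
qed simp

lemma Ck_on_add:
  assumes "open S"
  shows "Ck_on n S f \<Longrightarrow> Ck_on n S g \<Longrightarrow> Ck_on n S (\<lambda>x. f x + g x)"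
proof (induction n arbitrary: f g)
  case 0
  then show ?case by (simp add: continuous_on_add)
next
  case (Suc n)
  show ?case
    by (rule Ck_on_SucI[OF assms has_derivative_add[OF Ck_on_has_derivative Ck_on_has_derivative]])
      (use Suc in auto)
qed

lemma (in bounded_bilinear) Ck_on_prod:
  assumes "open S"
  shows "Ck_on n S f \<Longrightarrow> Ck_on n S g \<Longrightarrow> Ck_on n S (\<lambda>x. prod (f x) (g x))"
proof (induction n arbitrary: f g)
  case 0
  then show ?case by (simp add: continuous_on)
next
  case (Suc n)
  show ?case
    by (rule Ck_on_SucI[OF assms FDERIV[OF Ck_on_has_derivative Ck_on_has_derivative]])
      (use Suc Ck_on_Suc_imp[OF Suc.prems(1)] Ck_on_Suc_imp[OF Suc.prems(2)] in
        \<open>auto intro!: Ck_on_add[OF assms]\<close>)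
qed

lemmas Ck_on_mult = bounded_bilinear.Ck_on_prod[OF bounded_bilinear_mult]
lemmas Ck_on_scaleR = bounded_bilinear.Ck_on_prod[OF bounded_bilinear_scaleR]

lemma Ck_on_uminus: "open S \<Longrightarrow> Ck_on n S f \<Longrightarrow> Ck_on n S (\<lambda>x. - f x)"
  using Ck_on_scaleR[of S n "\<lambda>_. -1" f] Ck_on_const[of S n "-1::real"] by simp

lemma Ck_on_diff:
  "open S \<Longrightarrow> Ck_on n S f \<Longrightarrow> Ck_on n S g \<Longrightarrow> Ck_on n S (\<lambda>x. f x - g x)"
  using Ck_on_add[of S n f "\<lambda>x. - g x"] Ck_on_uminus[of S n g] by simp

lemma Ck_on_sum:
  "open S \<Longrightarrow> (\<And>i. i \<in> I \<Longrightarrow> Ck_on n S (f i)) \<Longrightarrow> Ck_on n S (\<lambda>x. \<Sum>i\<in>I. f i x)"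
  by (induction I rule: infinite_finite_induct) (auto intro!: Ck_on_const Ck_on_add)

lemma Ck_on_setprod:
  fixes f :: "'i \<Rightarrow> 'a::real_normed_vector \<Rightarrow> real"
  shows "open S \<Longrightarrow> (\<And>i. i \<in> I \<Longrightarrow> Ck_on n S (f i)) \<Longrightarrow> Ck_on n S (\<lambda>x. \<Prod>i\<in>I. f i x)"
  by (induction I rule: infinite_finite_induct) (auto intro!: Ck_on_const Ck_on_mult)

lemma Ck_on_inverse:
  fixes f :: "'a::real_normed_vector \<Rightarrow> real"
  assumes "open S" "\<And>x. x \<in> S \<Longrightarrow> f x \<noteq> 0"
  shows "Ck_on n S f \<Longrightarrow> Ck_on n S (\<lambda>x. inverse (f x))"
proof (induction n)
  case 0
  then show ?case using assms by (auto intro: continuous_on_inverse)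
next
  case (Suc n)
  note f = Ck_on_Suc_imp[OF Suc.prems]
  show ?case
    by (rule Ck_on_SucI[OF assms(1) Deriv.has_derivative_inverse[OF _ Ck_on_has_derivative[OF Suc.prems]]])
      (use assms Suc Suc.IH[OF f] in \<open>auto intro!: Ck_on_mult Ck_on_uminus\<close>)
qed

lemma Ck_on_bounded_linear_comp:
  assumes "bounded_linear h" "open S"
  shows "Ck_on n S f \<Longrightarrow> Ck_on n S (\<lambda>x. h (f x))"
proof (induction n arbitrary: f)
  case 0
  then show ?case using assms by (simp add: bounded_linear.continuous_on)
next
  case (Suc n)
  show ?case
    by (rule Ck_on_SucI[OF assms(2) bounded_linear.has_derivative[OF assms(1) Ck_on_has_derivative]])
      (use Suc in auto)
qed

lemma Ck_on_comp_bounded_linear: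
  assumes h: "bounded_linear h" and "open S" "open T" "h ` T \<subseteq> S"
  shows "Ck_on n S f \<Longrightarrow> Ck_on n T (\<lambda>x. f (h x))"
proof (induction n arbitrary: f)
  case 0
  then show ?case
    using continuous_on_compose2[OF _ linear_continuous_on[OF h] assms(4), of f] by simp
next
  case (Suc n)
  have "((\<lambda>x. f (h x)) has_derivative (\<lambda>v. frechet_derivative f (at (h x)) (h v))) (at x)"
    if "x \<in> T" for x
    by (rule has_derivative_compose[where f=h, OF bounded_linear_imp_has_derivative[OF h]])
      (use Ck_on_has_derivative[OF Suc.prems, of "h x"] that assms(4) in auto)
  then show ?case
    by (rule Ck_on_SucI[OF assms(3)]) (use Suc in auto)
qed

lemma Ck_on_bounded_linear: "bounded_linear h \<Longrightarrow> open S \<Longrightarrow> Ck_on n S h"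
proof (induction n)
  case (Suc n)
  show ?case
    by (rule Ck_on_SucI[OF Suc(3) bounded_linear_imp_has_derivative[OF Suc(2)]])
      (simp add: Ck_on_const Suc)
qed (simp add: linear_continuous_on)

lemma Ck_on_componentwise:
  fixes f :: "'a::real_normed_vector \<Rightarrow> real ^ 'n"
  assumes "open S" "\<And>i. Ck_on n S (\<lambda>x. f x $ i)"
  shows "Ck_on n S f"
proof -
  have "Ck_on n S (\<lambda>x. \<Sum>i\<in>UNIV. f x $ i *\<^sub>R axis i (1::real))"
    using assms by (intro Ck_on_sum Ck_on_scaleR Ck_on_const)
  moreover have "(\<Sum>i\<in>UNIV. f x $ i *\<^sub>R axis i (1::real)) = f x" for x
    by (simp add: scalar_mult_eq_scaleR[symmetric] basis_expansion)
  ultimately show ?thesis by simp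
qed

lemma Ck_on_det:
  fixes A :: "'a::real_normed_vector \<Rightarrow> real ^ 'n ^ 'n"
  assumes "open S" "\<And>i j. Ck_on n S (\<lambda>x. A x $ i $ j)"
  shows "Ck_on n S (\<lambda>x. det (A x))"
  unfolding det_def using assms
  by (intro Ck_on_sum Ck_on_mult Ck_on_const Ck_on_setprod)

text \<open>By Cramer's rule each component of \<open>w\<close> is a quotient of determinants. This
  gives regularity to objects known only through equations: the Christoffel symbols and the inverse
  of a Gram matrix.\<close>

lemma Ck_on_linear_system:
  fixes A :: "'a::real_normed_vector \<Rightarrow> real ^ 'n ^ 'n" and b w :: "'a \<Rightarrow> real ^ 'n"
  assumes S: "open S" and A: "\<And>i j. Ck_on n S (\<lambda>x. A x $ i $ j)"
    and b: "\<And>i. Ck_on n S (\<lambda>x. b x $ i)"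
    and "\<And>x. x \<in> S \<Longrightarrow> det (A x) \<noteq> 0" and w: "\<And>x. x \<in> S \<Longrightarrow> A x *v w x = b x"
  shows "Ck_on n S w"
proof (rule Ck_on_componentwise[OF S])
  fix k
  let ?B = "\<lambda>x. \<chi> i j. if j = k then b x $ i else A x $ i $ j"
  have 1: "w x $ k = det (?B x) * inverse (det (A x))" if "x \<in> S" for x
    using iffD1[OF cramer w] assms(4) that by (simp add: divide_inverse)
  have "Ck_on n S (\<lambda>x. det (?B x) * inverse (det (A x)))"
  proof (intro Ck_on_mult[OF S] Ck_on_inverse[OF S] Ck_on_det[OF S] A)
    fix i j show "Ck_on n S (\<lambda>x. ?B x $ i $ j)" by (cases "j = k") (simp_all add: A b)
  qed (use assms in auto)
  then show "Ck_on n S (\<lambda>x. w x $ k)"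
    using Ck_on_cong[OF S, of "\<lambda>x. w x $ k" "\<lambda>x. det (?B x) * inverse (det (A x))"] 1
    by simp
qed

section \<open>Symmetry of second derivatives\<close>

lemma mean_value_second_difference:
  fixes f :: "'a::real_normed_vector \<Rightarrow> real"
  assumes S: "open S" and f: "Ck_on 2 S f" and t: "t > 0"
    and inS: "\<And>a b. 0 \<le> a \<Longrightarrow> a \<le> t \<Longrightarrow> 0 \<le> b \<Longrightarrow> b \<le> t \<Longrightarrow> x + a *\<^sub>R u + b *\<^sub>R v \<in> S"
  obtains a b where "0 < a" "a < t" "0 < b" "b < t"
    "f (x + t *\<^sub>R u + t *\<^sub>R v) - f (x + t *\<^sub>R u) - f (x + t *\<^sub>R v) + f x =
     t * t * frechet_derivative (\<lambda>y. frechet_derivative f (at y) u) (at (x + a *\<^sub>R u + b *\<^sub>R v)) v"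
proof -
  let ?D = "\<lambda>y. frechet_derivative f (at y) u"
  have f2: "Ck_on (Suc (Suc 0)) S f" using f by (simp add: numeral_2_eq_2)
  have d1: "(f has_derivative frechet_derivative f (at y)) (at y)" if "y \<in> S" for y
    using Ck_on_has_derivative[OF f2 that] .
  have d2: "(?D has_derivative frechet_derivative ?D (at y)) (at y)" if "y \<in> S" for y
    by (rule Ck_on_has_derivative[of 0 S]) (use f2 that in auto)
  have scale: "frechet_derivative h (at y) (s *\<^sub>R w) = s * frechet_derivative h (at y) w"
    if "(h has_derivative frechet_derivative h (at y)) (at y)" for h :: "'a \<Rightarrow> real" and y s w
    using linear_scale[OF has_derivative_linear[OF that]] by simp
  let ?a = "\<lambda>s. f (x + s *\<^sub>R u + t *\<^sub>R v) - f (x + s *\<^sub>R u)"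
  have da: "(?a has_real_derivative (?D (x + s *\<^sub>R u + t *\<^sub>R v) - ?D (x + s *\<^sub>R u))) (at s)"
    if "0 \<le> s" "s \<le> t" for s
  proof -
    have i1: "x + s *\<^sub>R u + t *\<^sub>R v \<in> S" "x + s *\<^sub>R u \<in> S"
      using inS[of s t] inS[of s 0] that t by auto
    have "((\<lambda>s. f (x + s *\<^sub>R u + t *\<^sub>R v)) has_derivative
        (\<lambda>h. frechet_derivative f (at (x + s *\<^sub>R u + t *\<^sub>R v)) (h *\<^sub>R u))) (at s)"
      by (rule has_derivative_compose[where f="\<lambda>s. x + s *\<^sub>R u + t *\<^sub>R v", OF _ d1[OF i1(1)]])
        (auto intro!: derivative_eq_intros)
    moreover have "((\<lambda>s. f (x + s *\<^sub>R u)) has_derivative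
        (\<lambda>h. frechet_derivative f (at (x + s *\<^sub>R u)) (h *\<^sub>R u))) (at s)"
      by (rule has_derivative_compose[where f="\<lambda>s. x + s *\<^sub>R u", OF _ d1[OF i1(2)]])
        (auto intro!: derivative_eq_intros)
    ultimately have "(?a has_derivative (\<lambda>h. h * ?D (x + s *\<^sub>R u + t *\<^sub>R v) - h * ?D (x + s *\<^sub>R u))) (at s)"
      using scale[OF d1] i1 by (auto dest: has_derivative_diff)
    then show ?thesis
      unfolding has_field_derivative_def
      by (rule has_derivative_eq_rhs) (simp add: fun_eq_iff algebra_simps)
  qed
  \<comment> \<open>The mean value theorem is used along \<open>u\<close> for the difference over
    two parallel edges, and below along \<open>v\<close> for the derivative in the direction
    \<open>u\<close>.\<close>
  obtain a where a: "0 < a" "a < t"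
    and ae: "?a t - ?a 0 = (t - 0) * (?D (x + a *\<^sub>R u + t *\<^sub>R v) - ?D (x + a *\<^sub>R u))"
    using MVT2[OF t da] by auto
  let ?b = "\<lambda>s. ?D (x + a *\<^sub>R u + s *\<^sub>R v)"
  have db: "(?b has_real_derivative frechet_derivative ?D (at (x + a *\<^sub>R u + s *\<^sub>R v)) v) (at s)"
    if "0 \<le> s" "s \<le> t" for s
  proof -
    have i1: "x + a *\<^sub>R u + s *\<^sub>R v \<in> S" using inS[of a s] that a by auto
    have "(?b has_derivative
        (\<lambda>h. frechet_derivative ?D (at (x + a *\<^sub>R u + s *\<^sub>R v)) (h *\<^sub>R v))) (at s)"
      by (rule has_derivative_compose[where f="\<lambda>s. x + a *\<^sub>R u + s *\<^sub>R v", OF _ d2[OF i1]])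
        (auto intro!: derivative_eq_intros)
    then show ?thesis
      unfolding has_field_derivative_def
      by (rule has_derivative_eq_rhs) (simp add: fun_eq_iff scale[OF d2] i1)
  qed
  obtain b where b: "0 < b" "b < t"
    and be: "?b t - ?b 0 = (t - 0) * frechet_derivative ?D (at (x + a *\<^sub>R u + b *\<^sub>R v)) v"
    using MVT2[OF t db] by blast
  show ?thesis
    by (rule that[OF a b]) (use ae be in \<open>simp add: algebra_simps\<close>)
qed

text \<open>Schwarz's theorem. The second difference over a parallelogram does not depend on the
  order of its sides, so the two mixed derivatives agree at two points of arbitrarily small
  parallelograms; continuity moves both points to \<open>x\<close>.\<close>

lemma symmetric_second_derivative:
  fixes f :: "'a::real_normed_vector \<Rightarrow> real"
  assumes S: "open S" and f: "Ck_on 2 S f" and x: "x \<in> S"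
  shows "frechet_derivative (\<lambda>y. frechet_derivative f (at y) u) (at x) v =
         frechet_derivative (\<lambda>y. frechet_derivative f (at y) v) (at x) u"
proof -
  let ?D = "\<lambda>u v y. frechet_derivative (\<lambda>y. frechet_derivative f (at y) u) (at y) v"
  have cont: "isCont (?D u v) x" for u v
  proof -
    have "continuous_on S (?D u v)" using f by (simp add: numeral_2_eq_2)
    then show ?thesis using S x by (simp add: continuous_on_eq_continuous_at)
  qed
  obtain r where r: "r > 0" "ball x r \<subseteq> S" using S x openE by blast
  have "dist (?D u v x) (?D v u x) \<le> e" if e: "e > 0" for e
  proof -
    obtain d1 where d1: "d1 > 0" "\<And>y. dist y x < d1 \<Longrightarrow> dist (?D u v y) (?D u v x) < e / 2"
      using cont[of u v] half_gt_zero[OF e] unfolding continuous_at_eps_delta by blast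
    obtain d2 where d2: "d2 > 0" "\<And>y. dist y x < d2 \<Longrightarrow> dist (?D v u y) (?D v u x) < e / 2"
      using cont[of v u] half_gt_zero[OF e] unfolding continuous_at_eps_delta by blast
    define d where "d = min r (min d1 d2)"
    \<comment> \<open>Small enough for the parallelogram with sides \<open>t *\<^sub>R u\<close> and
      \<open>t *\<^sub>R v\<close> to stay within distance \<open>d\<close> of \<open>x\<close>; the
      summand 1 covers the case that both vectors vanish.\<close>
    define t where "t = d / (2 * (norm u + norm v + 1))"
    have d0: "d > 0" using r d1 d2 by (simp add: d_def)
    have t0: "t > 0" unfolding t_def using d0
      by (intro divide_pos_pos) (auto simp: add_nonneg_pos)
    have tn: "t * (norm u + norm v) < d"
    proof -
      have "0 < norm u + norm v + 1" by (simp add: add_nonneg_pos)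
      then have "t * (norm u + norm v + 1) = d / 2" unfolding t_def by (simp add: divide_simps)
      then show ?thesis using t0 d0 by (simp add: algebra_simps)
    qed
    have near: "dist (x + a *\<^sub>R u' + b *\<^sub>R v') x < d"
      if "0 \<le> a" "a \<le> t" "0 \<le> b" "b \<le> t" "(u', v') \<in> {(u, v), (v, u)}" for a b u' v'
    proof -
      have "dist (x + a *\<^sub>R u' + b *\<^sub>R v') x = norm (a *\<^sub>R u' + b *\<^sub>R v')"
        by (simp add: dist_norm algebra_simps)
      also have "\<dots> \<le> a * norm u' + b * norm v'"
        using norm_triangle_ineq[of "a *\<^sub>R u'" "b *\<^sub>R v'"] that by simp
      also have "\<dots> \<le> t * norm u' + t * norm v'"
        using that by (intro add_mono mult_right_mono) auto
      also have "\<dots> = t * (norm u + norm v)" using that by (auto simp: algebra_simps)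
      finally show ?thesis using tn by simp
    qed
    have inS: "x + a *\<^sub>R u' + b *\<^sub>R v' \<in> S"
      if "0 \<le> a" "a \<le> t" "0 \<le> b" "b \<le> t" "(u', v') \<in> {(u, v), (v, u)}" for a b u' v'
      using near[OF that] r(2) by (auto simp: d_def subset_iff dist_commute)
    obtain a b where ab: "0 < a" "a < t" "0 < b" "b < t"
      "f (x + t *\<^sub>R u + t *\<^sub>R v) - f (x + t *\<^sub>R u) - f (x + t *\<^sub>R v) + f x =
       t * t * ?D u v (x + a *\<^sub>R u + b *\<^sub>R v)"
      using mean_value_second_difference[OF S f t0, of x u v] inS by auto
    obtain a' b' where ab': "0 < a'" "a' < t" "0 < b'" "b' < t"
      "f (x + t *\<^sub>R v + t *\<^sub>R u) - f (x + t *\<^sub>R v) - f (x + t *\<^sub>R u) + f x =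
       t * t * ?D v u (x + a' *\<^sub>R v + b' *\<^sub>R u)"
      using mean_value_second_difference[OF S f t0, of x v u] inS by auto
    have "t * t * ?D u v (x + a *\<^sub>R u + b *\<^sub>R v) = t * t * ?D v u (x + a' *\<^sub>R v + b' *\<^sub>R u)"
      unfolding ab(5)[symmetric] ab'(5)[symmetric] by (simp add: algebra_simps)
    then have eq: "?D u v (x + a *\<^sub>R u + b *\<^sub>R v) = ?D v u (x + a' *\<^sub>R v + b' *\<^sub>R u)"
      using t0 by simp
    have "dist (?D u v (x + a *\<^sub>R u + b *\<^sub>R v)) (?D u v x) < e / 2"
      using near[of a b u v] ab by (intro d1) (auto simp: d_def)
    moreover have "dist (?D v u (x + a' *\<^sub>R v + b' *\<^sub>R u)) (?D v u x) < e / 2"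
      using near[of a' b' v u] ab' by (intro d2) (auto simp: d_def)
    ultimately show ?thesis using eq unfolding dist_real_def by arith
  qed
  then have "dist (?D u v x) (?D v u x) \<le> 0" by (rule field_le_epsilon) auto
  then show ?thesis by simp
qed

section \<open>Derivatives of determinants and inverse matrices\<close>

lemma has_vector_derivative_vec_nth:
  "(f has_vector_derivative f') F \<Longrightarrow> ((\<lambda>x. f x $ i) has_vector_derivative f' $ i) F"
  by (rule bounded_linear.has_vector_derivative[OF bounded_linear_vec_nth])

lemma has_vector_derivative_vecI:
  fixes f :: "real \<Rightarrow> 'a::real_normed_vector ^ 'n"
  assumes "\<And>i. ((\<lambda>x. f x $ i) has_vector_derivative f' $ i) (at x within S)"
  shows "(f has_vector_derivative f') (at x within S)"
proof -
  have lin: "bounded_linear (axis i :: 'a \<Rightarrow> 'a ^ 'n)" for i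
  proof (rule bounded_linear_intro[where K=1])
    have "(norm (axis i x $ j))\<^sup>2 = (if j = i then (norm x)\<^sup>2 else 0)" for x :: 'a and j
      by (simp add: axis_def)
    then show "norm (axis i x) \<le> norm x * 1" for x :: 'a
      by (simp add: norm_vec_def L2_set_def)
  qed (auto simp: axis_def vec_eq_iff)
  have "((\<lambda>x. \<Sum>i\<in>UNIV. axis i (f x $ i)) has_vector_derivative (\<Sum>i\<in>UNIV. axis i (f' $ i)))
      (at x within S)"
    by (intro has_vector_derivative_sum bounded_linear.has_vector_derivative[OF lin] assms)
  moreover have "(\<Sum>i\<in>UNIV. axis i (v $ i)) = v" for v :: "'a ^ 'n"
    by (simp add: vec_eq_iff axis_def if_distrib cong: if_cong)
  ultimately show ?thesis by simp
qed

text \<open>Differentiating the Leibniz formula leaves products with one factor removed. A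
  permutation other than the identity moves at least two indices, so a vanishing off-diagonal entry
  survives in its product and only the diagonal term contributes.\<close>

lemma has_derivative_det_one:
  "((det :: real^'n^'n \<Rightarrow> real) has_derivative trace) (at (mat 1))"
proof -
  let ?P = "{p. p permutes (UNIV :: 'n set)}"
  let ?I = "mat 1 :: real^'n^'n"
  have lin: "((\<lambda>A::real^'n^'n. A $ i $ j) has_derivative (\<lambda>H. H $ i $ j)) F" for i j F
    by (intro bounded_linear_imp_has_derivative bounded_linear_compose[OF bounded_linear_vec_nth]
        bounded_linear_vec_nth)
  have 1: "((\<lambda>A::real^'n^'n. \<Sum>p\<in>?P. of_int (sign p) * (\<Prod>i\<in>UNIV. A $ i $ p i)) has_derivative
     (\<lambda>H. \<Sum>p\<in>?P. of_int (sign p) * (\<Sum>i\<in>UNIV. H $ i $ p i * (\<Prod>j\<in>UNIV - {i}. ?I $ j $ p j))))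
     (at ?I)"
    by (intro has_derivative_sum has_derivative_mult_right Deriv.has_derivative_prod lin)
  have zero: "(\<Prod>j\<in>UNIV - {i}. ?I $ j $ p j) = (if p = id then 1 else 0)"
    if p: "p permutes (UNIV :: 'n set)" for p i
  proof (cases "p = id")
    case False
    have "\<exists>j. j \<noteq> i \<and> p j \<noteq> j"
    proof (rule ccontr)
      assume "\<nexists>j. j \<noteq> i \<and> p j \<noteq> j"
      then have *: "p j = j" if "j \<noteq> i" for j using that by blast
      have "p i = i"
      proof (rule ccontr)
        assume "p i \<noteq> i"
        from *[OF this] show False using permutes_inj[OF p] \<open>p i \<noteq> i\<close> by (auto dest: injD)
      qed
      with * have "p = id" by (metis eq_id_iff)
      with False show False by simp
    qed
    then obtain j where "j \<noteq> i" "p j \<noteq> j" by blast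
    then have "(\<Prod>j\<in>UNIV - {i}. ?I $ j $ p j) = 0"
      by (intro prod_zero) (auto simp: mat_def intro!: bexI[of _ j])
    with False show ?thesis by simp
  qed (simp add: mat_def)
  have "(\<Sum>p\<in>?P. of_int (sign p) * (\<Sum>i\<in>UNIV. H $ i $ p i * (\<Prod>j\<in>UNIV - {i}. ?I $ j $ p j)))
      = trace H" for H :: "real^'n^'n"
  proof -
    have "(\<Sum>p\<in>?P. of_int (sign p) * (\<Sum>i\<in>UNIV. H $ i $ p i * (\<Prod>j\<in>UNIV - {i}. ?I $ j $ p j)))
      = (\<Sum>p\<in>?P. if p = id then trace H else 0)"
      by (intro sum.cong) (auto simp: zero trace_def)
    also have "\<dots> = trace H" by (simp add: permutes_id)
    finally show ?thesis .
  qed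
  with 1 show ?thesis unfolding det_def by (simp add: fun_eq_iff)
qed

lemma bounded_bilinear_matrix_mult:
  "bounded_bilinear ((**) :: real^'m^'n \<Rightarrow> real^'k^'m \<Rightarrow> real^'k^'n)"
proof -
  have "bilinear ((**) :: real^'m^'n \<Rightarrow> real^'k^'m \<Rightarrow> real^'k^'n)"
    by (auto simp: bilinear_def linear_iff matrix_matrix_mult_def vec_eq_iff sum.distrib
        sum_distrib_left algebra_simps)
  then show ?thesis by (simp add: bilinear_conv_bounded_bilinear)
qed

text \<open>Jacobi's formula. The constant factor \<open>B\<close> moves the base point to the
  identity, where the derivative of \<open>det\<close> is the trace.\<close>

lemma det_has_real_derivative:
  fixes A :: "real \<Rightarrow> real^'n^'n"
  assumes A: "(A has_vector_derivative A') (at t within S)" and B: "B ** A t = mat 1"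
  shows "((\<lambda>s. det (A s)) has_real_derivative det (A t) * trace (B ** A')) (at t within S)"
proof -
  have det_inv: "det (A t) * det B = 1"
    using B by (metis det_I det_mul mult.commute)
  have "((\<lambda>s. B ** A s) has_vector_derivative B ** A') (at t within S)"
    by (rule bounded_linear.has_vector_derivative[OF bounded_bilinear.bounded_linear_right[OF
        bounded_bilinear_matrix_mult] A])
  then have "((\<lambda>s. B ** A s) has_derivative (\<lambda>h. h *\<^sub>R (B ** A'))) (at t within S)"
    by (simp add: has_vector_derivative_def)
  moreover have "(det has_derivative trace) (at (B ** A t))"
    using has_derivative_det_one B by simp
  ultimately have "((\<lambda>s. det (B ** A s)) has_derivative (\<lambda>h. trace (h *\<^sub>R (B ** A')))) (at t within S)"
    by (rule has_derivative_compose)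
  then have "((\<lambda>s. det (B ** A s)) has_real_derivative trace (B ** A')) (at t within S)"
    unfolding has_field_derivative_def
    by (rule has_derivative_eq_rhs) (simp add: fun_eq_iff trace_def sum_distrib_left mult.commute)
  from DERIV_cmult[OF this, of "det (A t)"]
  show ?thesis using det_inv by (simp add: det_mul mult.assoc[symmetric])
qed

text \<open>In the variable s = t^2 the matrix has the one-sided derivative \<open>B\<close> at 0,
  so Jacobi's formula at the end point of a half-line applies.\<close>

lemma det_perturbation_limit:
  fixes N :: "real \<Rightarrow> real^'n^'n"
  assumes "((\<lambda>t. (1 / t\<^sup>2) *\<^sub>R (N t - mat 1)) \<longlongrightarrow> B) (at_right 0)"
  shows "((\<lambda>t. (det (N t) - 1) / t\<^sup>2) \<longlongrightarrow> trace B) (at_right 0)"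
proof -
  define A where "A s = (if s = 0 then mat 1 else N (sqrt s))" for s
  have sq: "filterlim sqrt (at_right 0) (at_right 0)" "filterlim (\<lambda>t::real. t\<^sup>2) (at_right 0) (at_right 0)"
    by real_asymp+
  have ge: "at_right (0::real) = at 0 within {0..}"
  proof -
    have "{0..} - {0} = {0::real<..} - {0}" by auto
    then show ?thesis unfolding at_within_def by simp
  qed
  have "(A has_vector_derivative B) (at 0 within {0..})"
    unfolding has_vector_derivative_def has_derivative_at_within ge[symmetric]
  proof (intro conjI)
    show "bounded_linear (\<lambda>x. x *\<^sub>R B)" by (rule bounded_linear_scaleR_left)
    have "((\<lambda>s. (1 / (sqrt s)\<^sup>2) *\<^sub>R (N (sqrt s) - mat 1)) \<longlongrightarrow> B) (at_right 0)"
      by (rule filterlim_compose[OF assms sq(1)])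
    then have "((\<lambda>s. (1 / (sqrt s)\<^sup>2) *\<^sub>R (N (sqrt s) - mat 1) - B) \<longlongrightarrow> 0) (at_right 0)"
      using LIM_zero by blast
    then show "((\<lambda>y. (A y - A 0 - (y - 0) *\<^sub>R B) /\<^sub>R norm (y - 0)) \<longlongrightarrow> 0) (at_right 0)"
    proof (rule Lim_transform_eventually)
      show "\<forall>\<^sub>F s in at_right 0. (1 / (sqrt s)\<^sup>2) *\<^sub>R (N (sqrt s) - mat 1) - B
          = (A s - A 0 - (s - 0) *\<^sub>R B) /\<^sub>R norm (s - 0)"
        using eventually_at_right_less[of "0::real"]
        by eventually_elim (simp add: A_def scaleR_diff_right divide_inverse)
    qed
  qed
  from det_has_real_derivative[OF this, of "mat 1"]
  have "((\<lambda>s. det (A s)) has_real_derivative trace B) (at 0 within {0..})"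
    by (simp add: A_def)
  then have "((\<lambda>s. (det (A s) - 1) / s) \<longlongrightarrow> trace B) (at_right 0)"
    by (simp add: has_field_derivative_iff ge A_def)
  from filterlim_compose[OF this sq(2)]
  show ?thesis
  proof (rule Lim_transform_eventually)
    show "\<forall>\<^sub>F t in at_right 0. (det (A (t\<^sup>2)) - 1) / t\<^sup>2 = (det (N t) - 1) / t\<^sup>2"
      using eventually_at_right_less[of "0::real"]
      by eventually_elim (simp add: A_def)
  qed
qed

text \<open>Differentiability of the inverse has to be known before the product with
  \<open>A\<close> can be differentiated; it comes from the columns of \<open>B\<close> solving
  linear systems with matrix \<open>A\<close>.\<close>

lemma matrix_inverse_has_vector_derivative:
  fixes A B :: "real \<Rightarrow> real^'n^'n"
  assumes I: "open I" "t \<in> I" and A: "\<And>s. s \<in> I \<Longrightarrow> (A has_vector_derivative A' s) (at s)"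
    and A': "continuous_on I A'" and B: "\<And>s. s \<in> I \<Longrightarrow> B s ** A s = mat 1"
  shows "(B has_vector_derivative - (B t ** A' t ** B t)) (at t)"
proof -
  have AB: "A s ** B s = mat 1" if "s \<in> I" for s
    by (rule iffD1[OF matrix_left_right_inverse B[OF that]])
  have det: "det (A s) \<noteq> 0" if "s \<in> I" for s
    using arg_cong[OF AB[OF that], of det] by (auto simp: det_mul)
  have Ck: "Ck_on (Suc 0) I (\<lambda>s. A s $ i $ j)" for i j
  proof (rule Ck_on_SucI[OF I(1)])
    fix s assume "s \<in> I"
    from has_vector_derivative_vec_nth[OF has_vector_derivative_vec_nth[OF A[OF this]]]
    show "((\<lambda>s. A s $ i $ j) has_derivative (\<lambda>h. h *\<^sub>R (A' s $ i $ j))) (at s)"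
      by (simp add: has_vector_derivative_def)
  qed (auto intro!: continuous_intros A')
  have col: "Ck_on (Suc 0) I (\<lambda>s. B s *v axis j 1)" for j
  proof (rule Ck_on_linear_system[where A=A and b="\<lambda>s. axis j 1", OF I(1) Ck _ det])
    show "Ck_on (Suc 0) I (\<lambda>s. (axis j 1 :: real^'n) $ i)" for i by (rule Ck_on_const[OF I(1)])
    show "A s *v (B s *v axis j 1) = axis j 1" if "s \<in> I" for s
      by (simp add: matrix_vector_mul_assoc AB[OF that])
  qed
  define B' where "B' = (\<chi> i j. frechet_derivative (\<lambda>s. B s *v axis j 1) (at t) 1 $ i)"
  have "((\<lambda>s. B s *v axis j 1) has_vector_derivative
      frechet_derivative (\<lambda>s. B s *v axis j 1) (at t) 1) (at t)" for j
  proof -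
    have d: "((\<lambda>s. B s *v axis j 1) has_derivative frechet_derivative (\<lambda>s. B s *v axis j 1) (at t)) (at t)"
      by (rule Ck_on_has_derivative[OF col I(2)])
    have "frechet_derivative (\<lambda>s. B s *v axis j 1) (at t) h =
        h *\<^sub>R frechet_derivative (\<lambda>s. B s *v axis j 1) (at t) 1" for h
      using linear_scale[OF has_derivative_linear[OF d], of h 1] by simp
    from ext[OF this] d show ?thesis unfolding has_vector_derivative_def
      by (rule back_subst[of "\<lambda>D. (_ has_derivative D) _", rotated])
  qed
  from has_vector_derivative_vec_nth[OF this]
  have "(B has_vector_derivative B') (at t)"
    by (intro has_vector_derivative_vecI) (simp add: B'_def matrix_vector_mul_component inner_axis)
  note dB = this
  have "((\<lambda>s. B s ** A s) has_vector_derivative B t ** A' t + B' ** A t) (at t)"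
    using bounded_bilinear.has_vector_derivative[OF bounded_bilinear_matrix_mult dB A[OF I(2)]] .
  moreover have "((\<lambda>s. B s ** A s) has_vector_derivative 0) (at t)"
    by (rule has_vector_derivative_transform_within_open[OF has_vector_derivative_const I, of "mat 1"])
      (simp add: B)
  ultimately have "B t ** A' t + B' ** A t = 0"
    by (rule vector_derivative_unique_at)
  then have "(B t ** A' t + B' ** A t) ** B t = 0" by simp
  then have "B t ** A' t ** B t + B' = 0"
    by (simp add: bounded_bilinear.add_left[OF bounded_bilinear_matrix_mult]
        matrix_mul_assoc[symmetric] AB[OF I(2)])
  then have "B' = - (B t ** A' t ** B t)" by (simp add: eq_neg_iff_add_eq_0 add.commute)
  with dB show ?thesis by simp
qed

section \<open>Ordinary differential equations\<close>

lemma vector_mean_value_bound: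
  fixes u :: "real \<Rightarrow> 'a::real_normed_vector"
  assumes "convex S" "\<And>t. t \<in> S \<Longrightarrow> (u has_vector_derivative u' t) (at t within S)"
    and "\<And>t. t \<in> S \<Longrightarrow> norm (u' t) \<le> K" and "s \<in> S" "t \<in> S"
  shows "norm (u t - u s) \<le> K * \<bar>t - s\<bar>"
proof -
  have "norm (u t - u s) \<le> K * norm (t - s)"
    by (rule differentiable_bound[OF assms(1), where f'="\<lambda>t h. h *\<^sub>R u' t"])
      (use assms in \<open>auto simp: has_vector_derivative_def onorm_scaleR_left[OF bounded_linear_ident] onorm_id
        intro!: onorm_le\<close>)
  then show ?thesis by simp
qed

text \<open>On a time interval that is short compared with the Lipschitz constant the mean value
  inequality already gives the Gronwall estimate, without exponentials.\<close>

lemma short_time_gronwall: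
  fixes u :: "real \<Rightarrow> 'a::real_normed_vector"
  assumes d: "\<And>t. t \<in> {-\<tau>..\<tau>} \<Longrightarrow> (u has_vector_derivative u' t) (at t within {-\<tau>..\<tau>})"
    and b: "\<And>t. t \<in> {-\<tau>..\<tau>} \<Longrightarrow> norm (u' t) \<le> L * norm (u t) + e"
    and "\<tau> \<ge> 0" "L \<ge> 0" "e \<ge> 0" "\<tau> * L \<le> 1 / 2" and t: "t \<in> {-\<tau>..\<tau>}"
  shows "norm (u t) \<le> 2 * (norm (u 0) + \<tau> * e)"
proof -
  have "continuous_on {-\<tau>..\<tau>} u"
    by (rule continuous_on_vector_derivative[OF d])
  then obtain s where s: "s \<in> {-\<tau>..\<tau>}" and max: "\<And>t. t \<in> {-\<tau>..\<tau>} \<Longrightarrow> norm (u t) \<le> norm (u s)"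
    using continuous_attains_sup[OF compact_Icc _ continuous_on_norm] t by blast
  have 0: "(0::real) \<in> {-\<tau>..\<tau>}" using assms by simp
  have "norm (u' r) \<le> L * norm (u s) + e" if "r \<in> {-\<tau>..\<tau>}" for r
    using b[OF that] mult_left_mono[OF max[OF that] \<open>L \<ge> 0\<close>] by linarith
  from vector_mean_value_bound[OF _ d this 0 s]
  have "norm (u s - u 0) \<le> (L * norm (u s) + e) * \<bar>s\<bar>" by simp
  also have "\<dots> \<le> (L * norm (u s) + e) * \<tau>"
    using s assms by (intro mult_left_mono) auto
  also have "\<dots> = (\<tau> * L) * norm (u s) + \<tau> * e" by (simp add: algebra_simps)
  also have "\<dots> \<le> 1 / 2 * norm (u s) + \<tau> * e"
    using assms by (intro add_right_mono mult_right_mono) auto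
  finally have "norm (u s) \<le> 2 * (norm (u 0) + \<tau> * e)"
    using norm_triangle_sub[of "u s" "u 0"] by (simp add: algebra_simps)
  with max[OF t] show ?thesis by linarith
qed

text \<open>The bound \<open>\<tau> * L \<le> 1 / 2\<close> makes the integral operator a
  contraction by 1/2 in the supremum norm, and the bound on \<open>F\<close> keeps its values
  bounded.\<close>

lemma picard_lipschitz:
  fixes F :: "'a::euclidean_space \<Rightarrow> 'a"
  assumes lip: "\<And>x y. norm (F x - F y) \<le> L * norm (x - y)" and bd: "\<And>x. norm (F x) \<le> B"
    and \<tau>: "\<tau> > 0" "\<tau> * L \<le> 1 / 2" and L: "L \<ge> 0"
  obtains z where "z 0 = a"
    "\<And>t. t \<in> {-\<tau>..\<tau>} \<Longrightarrow> (z has_vector_derivative F (z t)) (at t within {-\<tau>..\<tau>})"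
proof -
  \<comment> \<open>Clamping the time to the interval extends every candidate to the whole line,
    which places the problem in the complete space of bounded continuous functions.\<close>
  define c where "c t = max (-\<tau>) (min \<tau> t)" for t
  have c: "c t \<in> {-\<tau>..\<tau>}" "t \<in> {-\<tau>..\<tau>} \<Longrightarrow> c t = t" for t using \<tau> by (auto simp: c_def)
  have cc: "continuous_on UNIV c" unfolding c_def by (intro continuous_intros)
  have F: "continuous_on UNIV F"
  proof (rule continuous_onI)
    fix x e assume "e > (0::real)"
    then show "\<exists>d>0. \<forall>x'\<in>UNIV. dist x' x < d \<longrightarrow> dist (F x') (F x) \<le> e"
    proof (intro exI[of _ "e / (L + 1)"] conjI ballI impI)
      fix y assume "dist y x < e / (L + 1)"
      then have "(L + 1) * norm (y - x) < e" using L by (simp add: dist_norm field_simps)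
      moreover have "L * norm (y - x) \<le> (L + 1) * norm (y - x)" by (intro mult_right_mono) auto
      ultimately show "dist (F y) (F x) \<le> e" using lip[of y x] by (simp add: dist_norm)
    qed (use L in auto)
  qed
  have B: "B \<ge> 0" using bd[of 0] norm_ge_zero order_trans by blast
  define I where "I f u = integral {-\<tau>..u} (\<lambda>s. F (apply_bcontfun f s))" for f u
  \<comment> \<open>Integration starts at the left end; subtracting the value at 0 imposes the
    initial condition at the midpoint and serves both directions of time.\<close>
  define W where "W f t = a + I f t - I f 0" for f t
  have dW: "(W f has_vector_derivative F (apply_bcontfun f t)) (at t within {-\<tau>..\<tau>})"
    if "t \<in> {-\<tau>..\<tau>}" for f t
  proof -
    have "continuous_on {-\<tau>..\<tau>} (\<lambda>s. F (apply_bcontfun f s))"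
      by (rule continuous_on_compose2[OF F]) auto
    from integral_has_vector_derivative[OF this that]
    show ?thesis unfolding W_def I_def by (auto intro!: derivative_eq_intros)
  qed
  have W0: "W f 0 = a" for f by (simp add: W_def)
  have bcont: "(\<lambda>t. W f (c t)) \<in> bcontfun" for f
  proof (rule bcontfun_normI)
    have "continuous_on {-\<tau>..\<tau>} (W f)"
      by (rule continuous_on_vector_derivative[OF dW])
    then show "continuous_on UNIV (\<lambda>t. W f (c t))"
      by (rule continuous_on_compose2[OF _ cc]) (use c in auto)
    show "norm (W f (c t)) \<le> norm a + B * \<tau>" for t
    proof -
      have "norm (W f (c t) - W f 0) \<le> B * \<bar>c t - 0\<bar>"
        by (rule vector_mean_value_bound[OF _ dW bd]) (use c(1)[of t] \<tau> in auto)
      also have "\<dots> \<le> B * \<tau>" using B c(1)[of t] by (intro mult_left_mono) auto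
      finally show ?thesis using norm_triangle_sub[of "W f (c t)" a] W0[of f] by simp
    qed
  qed
  define \<Phi> where "\<Phi> f = Bcontfun (\<lambda>t. W f (c t))" for f
  have \<Phi>: "apply_bcontfun (\<Phi> f) t = W f (c t)" for f t
    unfolding \<Phi>_def using bcont by (simp add: Bcontfun_inverse)
  have contr: "dist (\<Phi> f) (\<Phi> g) \<le> 1 / 2 * dist f g" for f g
  proof (rule dist_bound)
    fix t
    have "norm ((W f (c t) - W g (c t)) - (W f 0 - W g 0)) \<le> (L * dist f g) * \<bar>c t - 0\<bar>"
    proof (rule vector_mean_value_bound)
      show "((\<lambda>t. W f t - W g t) has_vector_derivative
          F (apply_bcontfun f t) - F (apply_bcontfun g t)) (at t within {-\<tau>..\<tau>})"
        if "t \<in> {-\<tau>..\<tau>}" for t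
        by (intro has_vector_derivative_diff dW that)
      show "norm (F (apply_bcontfun f t) - F (apply_bcontfun g t)) \<le> L * dist f g" for t
        using lip[of "apply_bcontfun f t" "apply_bcontfun g t"]
          mult_left_mono[OF dist_bounded[of f t g] L] by (simp add: dist_norm)
    qed (use c(1)[of t] \<tau> in auto)
    also have "\<dots> \<le> (L * dist f g) * \<tau>" using c(1)[of t] L by (intro mult_left_mono) auto
    also have "\<dots> = (\<tau> * L) * dist f g" by simp
    also have "\<dots> \<le> 1 / 2 * dist f g" using \<tau> by (intro mult_right_mono) auto
    finally show "dist (apply_bcontfun (\<Phi> f) t) (apply_bcontfun (\<Phi> g) t) \<le> 1 / 2 * dist f g"
      by (simp add: \<Phi> W0 dist_norm)
  qed
  have "\<exists>!f. \<Phi> f = f" by (rule banach_fix_type[of "1/2"]) (use contr in auto)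
  then obtain f where f: "\<Phi> f = f" by blast
  have eq: "apply_bcontfun f t = W f t" if "t \<in> {-\<tau>..\<tau>}" for t
    using \<Phi>[of f t] f c(2)[OF that] by simp
  show ?thesis
  proof (rule that)
    show "apply_bcontfun f 0 = a" using eq[of 0] \<tau> W0 by simp
    show "(apply_bcontfun f has_vector_derivative F (apply_bcontfun f t)) (at t within {-\<tau>..\<tau>})"
      if "t \<in> {-\<tau>..\<tau>}" for t
      by (rule has_vector_derivative_transform[OF that _ dW[OF that]]) (simp add: eq)
  qed
qed

text \<open>Composition with the nearest point projection, which is 1-Lipschitz, makes the field
  global. A solution starting in the half ball moves by at most
  \<open>\<tau> * B \<le> R / 2\<close>, so it stays in the ball, where the projection is the
  identity.\<close>

lemma ode_existence_cball:
  fixes F :: "'a::euclidean_space \<Rightarrow> 'a"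
  assumes lip: "\<And>x y. x \<in> cball p R \<Longrightarrow> y \<in> cball p R \<Longrightarrow> norm (F x - F y) \<le> L * norm (x - y)"
    and bd: "\<And>x. x \<in> cball p R \<Longrightarrow> norm (F x) \<le> B"
    and \<tau>: "\<tau> > 0" "\<tau> * L \<le> 1 / 2" "\<tau> * B \<le> R / 2" and L: "L \<ge> 0" and R: "R > 0"
    and a: "a \<in> cball p (R / 2)"
  obtains z where "z 0 = a"
    "\<And>t. t \<in> {-\<tau>..\<tau>} \<Longrightarrow> z t \<in> cball p R"
    "\<And>t. t \<in> {-\<tau>..\<tau>} \<Longrightarrow> (z has_vector_derivative F (z t)) (at t within {-\<tau>..\<tau>})"
proof -
  let ?c = "closest_point (cball p R)"
  have c: "?c x \<in> cball p R" for x using R by (intro closest_point_in_set) auto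
  have B: "B \<ge> 0" using bd[of p] R norm_ge_zero[of "F p"] by (simp del: norm_ge_zero)
  have lip': "norm (F (?c x) - F (?c y)) \<le> L * norm (x - y)" for x y
  proof -
    have "dist (?c x) (?c y) \<le> dist x y" using R by (intro closest_point_lipschitz) auto
    then show ?thesis
      using lip[OF c c, of x y] mult_left_mono[of "norm (?c x - ?c y)" "norm (x - y)" L] L
      by (simp add: dist_norm)
  qed
  obtain z where z: "z 0 = a"
    "\<And>t. t \<in> {-\<tau>..\<tau>} \<Longrightarrow> (z has_vector_derivative F (?c (z t))) (at t within {-\<tau>..\<tau>})"
    using picard_lipschitz[where F="\<lambda>x. F (?c x)", OF lip' bd[OF c] \<tau>(1,2) L] by metis
  have zin: "z t \<in> cball p R" if t: "t \<in> {-\<tau>..\<tau>}" for t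
  proof -
    have "norm (z t - z 0) \<le> B * \<bar>t - 0\<bar>"
      by (rule vector_mean_value_bound[OF _ z(2) bd[OF c]]) (use t \<tau> in auto)
    also have "\<dots> \<le> B * \<tau>" using B t by (intro mult_left_mono) auto
    also have "\<dots> \<le> R / 2" using \<tau> by (simp add: mult.commute)
    finally have "dist a (z t) \<le> R / 2" by (simp add: z dist_norm norm_minus_commute)
    then show ?thesis using a dist_triangle[of p "z t" a] by simp
  qed
  show ?thesis
  proof (rule that[of z, OF z(1) zin])
    show "(z has_vector_derivative F (z t)) (at t within {-\<tau>..\<tau>})" if "t \<in> {-\<tau>..\<tau>}" for t
      using z(2)[OF that] closest_point_self[OF zin[OF that]] by simp
  qed
qed

section \<open>Uniqueness of solutions\<close>

definition locally_lipschitz_on :: "'a::real_normed_vector set \<Rightarrow> ('a \<Rightarrow> 'b::real_normed_vector) \<Rightarrow> bool" where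
  "locally_lipschitz_on S F \<longleftrightarrow>
    (\<forall>x\<in>S. \<exists>r>0. \<exists>L\<ge>0. \<forall>y\<in>ball x r. \<forall>z\<in>ball x r. norm (F y - F z) \<le> L * norm (y - z))"

text \<open>The difference of the solutions obeys the Gronwall estimate with initial value and error
  0. This local form also serves the comparison of geodesics on the manifold, where a chart is known
  to contain both curves only near a time of agreement.\<close>

lemma ode_unique_near:
  fixes z w :: "real \<Rightarrow> 'a::real_normed_vector"
  assumes F: "locally_lipschitz_on S F" "z T \<in> S" and eq: "z T = w T"
    and J: "open J" "T \<in> J"
    and z: "\<And>t. t \<in> J \<Longrightarrow> (z has_vector_derivative F (z t)) (at t)"
    and w: "\<And>t. t \<in> J \<Longrightarrow> (w has_vector_derivative F (w t)) (at t)"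
  obtains \<eta> where "\<eta> > 0" "\<And>t. \<bar>t - T\<bar> \<le> \<eta> \<Longrightarrow> t \<in> J \<and> z t = w t"
proof -
  obtain r L where r: "r > 0" "L \<ge> 0"
    and lip: "\<And>x y. x \<in> ball (z T) r \<Longrightarrow> y \<in> ball (z T) r \<Longrightarrow> norm (F x - F y) \<le> L * norm (x - y)"
    using F unfolding locally_lipschitz_on_def by blast
  have cont: "isCont z T" "isCont w T" using z w J by (auto intro: has_vector_derivative_continuous)
  obtain d1 where d1: "d1 > 0" "\<And>t. dist t T < d1 \<Longrightarrow> dist (z t) (z T) < r"
    using cont(1) r(1) unfolding continuous_at_eps_delta by blast
  obtain d2 where d2: "d2 > 0" "\<And>t. dist t T < d2 \<Longrightarrow> dist (w t) (w T) < r"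
    using cont(2) r(1) unfolding continuous_at_eps_delta by blast
  obtain d3 where d3: "d3 > 0" "ball T d3 \<subseteq> J" using J openE by blast
  define d where "d = min d1 (min d2 d3)"
  have d: "d > 0" "\<And>t. dist t T < d \<Longrightarrow> z t \<in> ball (z T) r \<and> w t \<in> ball (z T) r \<and> t \<in> J"
    using d1 d2 d3 eq by (auto simp: d_def dist_commute subset_iff)
  define \<eta> where "\<eta> = min (d / 2) (1 / (2 * (L + 1)))"
  have \<eta>: "\<eta> > 0" "\<eta> < d" "\<eta> * L \<le> 1 / 2"
  proof -
    show "\<eta> > 0" "\<eta> < d" using d r by (auto simp: \<eta>_def)
    have "\<eta> * L \<le> 1 / (2 * (L + 1)) * L" using r by (intro mult_right_mono) (auto simp: \<eta>_def)
    also have "\<dots> \<le> 1 / 2" using r by (simp add: divide_simps)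
    finally show "\<eta> * L \<le> 1 / 2" .
  qed
  show ?thesis
  proof (rule that[OF \<eta>(1)])
    fix t assume t: "\<bar>t - T\<bar> \<le> \<eta>"
    let ?u = "\<lambda>s. z (T + s) - w (T + s)"
    have near: "z (T + s) \<in> ball (z T) r" "w (T + s) \<in> ball (z T) r" "T + s \<in> J"
      if "s \<in> {-\<eta>..\<eta>}" for s
      using d(2)[of "T + s"] \<eta> that by (auto simp: dist_norm)
    have shift: "((\<lambda>s. f (T + s)) has_vector_derivative f') (at s within {-\<eta>..\<eta>})"
      if "(f has_vector_derivative f') (at (T + s))" for f :: "real \<Rightarrow> 'a" and f' s
    proof -
      have "((\<lambda>s. T + s) has_vector_derivative 1) (at s)"
        by (auto intro!: derivative_eq_intros)
      from vector_diff_chain_at[OF this that] show ?thesis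
        by (simp add: o_def has_vector_derivative_at_within)
    qed
    have "norm (?u (t - T)) \<le> 2 * (norm (?u 0) + \<eta> * 0)"
    proof (rule short_time_gronwall[where L=L])
      fix s assume s: "s \<in> {-\<eta>..\<eta>}"
      show "(?u has_vector_derivative F (z (T + s)) - F (w (T + s))) (at s within {-\<eta>..\<eta>})"
        by (intro has_vector_derivative_diff shift z w near s)
      show "norm (F (z (T + s)) - F (w (T + s))) \<le> L * norm (?u s) + 0"
        using lip near[OF s] by simp
    qed (use \<eta> r t in auto)
    then have "z t = w t" by (simp add: eq)
    with near(3)[of "t - T"] t show "t \<in> J \<and> z t = w t" by (simp add: abs_le_iff)
  qed
qed

text \<open>The set of times of agreement is open by local uniqueness and closed by continuity, and
  it contains \<open>t0\<close>.\<close>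

lemma ode_unique:
  fixes z w :: "real \<Rightarrow> 'a::real_normed_vector"
  assumes F: "locally_lipschitz_on S F" and J: "open J" "connected J" "t0 \<in> J" and eq: "z t0 = w t0"
    and z: "\<And>t. t \<in> J \<Longrightarrow> z t \<in> S \<and> (z has_vector_derivative F (z t)) (at t)"
    and w: "\<And>t. t \<in> J \<Longrightarrow> (w has_vector_derivative F (w t)) (at t)"
    and t: "t \<in> J"
  shows "z t = w t"
proof -
  let ?E = "{t\<in>J. z t = w t}"
  have "openin (top_of_set J) ?E"
  proof (rule openin_subset_trans[of UNIV])
    show "openin (top_of_set UNIV) ?E"
      unfolding subtopology_UNIV open_openin[symmetric] open_contains_ball
    proof
      fix T assume T: "T \<in> ?E"
      obtain \<eta> where "\<eta> > 0" "\<And>t. \<bar>t - T\<bar> \<le> \<eta> \<Longrightarrow> t \<in> J \<and> z t = w t"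
        by (rule ode_unique_near[OF F, of z T w J]) (use T z[of T] z w J in auto)
      then show "\<exists>e>0. ball T e \<subseteq> ?E"
        by (intro exI[of _ \<eta>]) (auto simp: dist_norm abs_minus_commute)
    qed
  qed auto
  moreover have "closedin (top_of_set J) ?E"
  proof -
    have "continuous_on J z" "continuous_on J w"
      using z w by (auto intro!: continuous_at_imp_continuous_on has_vector_derivative_continuous)
    then have "closedin (top_of_set J) (J \<inter> (\<lambda>t. z t - w t) -` {0})"
      by (intro continuous_closedin_preimage continuous_intros) auto
    moreover have "J \<inter> (\<lambda>t. z t - w t) -` {0} = ?E" by auto
    ultimately show ?thesis by simp
  qed
  ultimately have "?E = {} \<or> ?E = J" using J(2) unfolding connected_clopen by blast
  with J eq t show ?thesis by blast
qed

text \<open>\<open>Ck_on\<close> gives continuity of the derivative only for each fixed direction.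
  Bounds on the compact ball for the finitely many basis vectors combine to one operator bound,
  which convexity turns into a Lipschitz constant.\<close>

lemma C1_lipschitz_cball:
  fixes f :: "'a::euclidean_space \<Rightarrow> 'b::real_normed_vector"
  assumes f: "Ck_on (Suc 0) S f" and S: "cball p R \<subseteq> S"
  obtains K where "K \<ge> 0"
    "\<And>z w. z \<in> cball p R \<Longrightarrow> norm (frechet_derivative f (at z) w) \<le> K * norm w"
    "\<And>x y. x \<in> cball p R \<Longrightarrow> y \<in> cball p R \<Longrightarrow> norm (f x - f y) \<le> K * norm (x - y)"
proof -
  let ?D = "\<lambda>z. frechet_derivative f (at z)"
  have d: "(f has_derivative ?D z) (at z)" if "z \<in> cball p R" for z
    using Ck_on_has_derivative[OF f] that S by blast
  have "\<exists>k. \<forall>z\<in>cball p R. norm (?D z b) \<le> k" for b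
  proof -
    have "continuous_on (cball p R) (\<lambda>z. ?D z b)"
      using f S by (auto intro: continuous_on_subset)
    then have "bounded ((\<lambda>z. ?D z b) ` cball p R)"
      by (intro compact_imp_bounded compact_continuous_image) auto
    then show ?thesis by (auto simp: bounded_iff)
  qed
  then obtain k where k: "\<And>z b. z \<in> cball p R \<Longrightarrow> norm (?D z b) \<le> k b" by metis
  define K where "K = (\<Sum>b\<in>Basis. \<bar>k b\<bar>)"
  have K0: "K \<ge> 0" by (simp add: K_def sum_nonneg)
  have K: "norm (?D z w) \<le> K * norm w" if z: "z \<in> cball p R" for z w
  proof -
    have "?D z w = ?D z (\<Sum>b\<in>Basis. (w \<bullet> b) *\<^sub>R b)" by (simp add: euclidean_representation)
    also have "\<dots> = (\<Sum>b\<in>Basis. (w \<bullet> b) *\<^sub>R ?D z b)"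
      using has_derivative_linear[OF d[OF z]] by (simp add: linear_sum linear_scale)
    also have "norm \<dots> \<le> (\<Sum>b\<in>Basis. norm w * \<bar>k b\<bar>)"
    proof (rule sum_norm_le)
      fix b :: 'a assume "b \<in> Basis"
      then show "norm ((w \<bullet> b) *\<^sub>R ?D z b) \<le> norm w * \<bar>k b\<bar>"
        using Basis_le_norm[of b w] k[OF z, of b] by (auto intro!: mult_mono)
    qed
    also have "\<dots> = K * norm w" by (simp add: K_def sum_distrib_left[symmetric])
    finally show ?thesis .
  qed
  show ?thesis
  proof (rule that[OF K0 K])
    fix x y assume "x \<in> cball p R" "y \<in> cball p R"
    then show "norm (f x - f y) \<le> K * norm (x - y)"
      by (intro differentiable_bound[of "cball p R" f ?D K])
        (auto intro!: has_derivative_at_withinI d onorm_le K)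
  qed
qed

lemma C1_imp_locally_lipschitz_on:
  fixes f :: "'a::euclidean_space \<Rightarrow> 'b::real_normed_vector"
  assumes "open S" "Ck_on (Suc 0) S f"
  shows "locally_lipschitz_on S f"
  unfolding locally_lipschitz_on_def
proof
  fix x assume "x \<in> S"
  then obtain r where r: "r > 0" "cball x r \<subseteq> S" using assms(1) open_contains_cball by blast
  obtain K where "K \<ge> 0" "\<And>y z. y \<in> cball x r \<Longrightarrow> z \<in> cball x r \<Longrightarrow> norm (f y - f z) \<le> K * norm (y - z)"
    by (rule C1_lipschitz_cball[OF assms(2) r(2)]) blast
  with r(1) show "\<exists>r>0. \<exists>L\<ge>0. \<forall>y\<in>ball x r. \<forall>z\<in>ball x r. norm (f y - f z) \<le> L * norm (y - z)"
    by (intro exI[of _ r] exI[of _ K] conjI) auto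
qed

text \<open>The field is integrated jointly with its linearization, so that a candidate
  \<open>D\<close> for the derivative in the initial value exists from the start. That it is the
  derivative follows from the Gronwall estimate for the remainder, whose source term is quadratic by
  Taylor's formula; the second derivative of \<open>F\<close> is spent there.\<close>

lemma C1_flow:
  fixes F :: "'a::euclidean_space \<Rightarrow> 'a"
  assumes S: "open S" and F: "Ck_on 2 S F" and p: "p \<in> S"
  obtains \<rho> \<tau> :: real and Z and D :: "'a \<Rightarrow> real \<Rightarrow> 'a \<Rightarrow> 'a" where "\<rho> > 0" "\<tau> > 0"
    "\<And>a t. a \<in> ball p \<rho> \<Longrightarrow> t \<in> {-\<tau>..\<tau>} \<Longrightarrow> Z a t \<in> S"
    "\<And>a. a \<in> ball p \<rho> \<Longrightarrow> Z a 0 = a"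
    "\<And>a t. a \<in> ball p \<rho> \<Longrightarrow> t \<in> {-\<tau>..\<tau>} \<Longrightarrow>
       (Z a has_vector_derivative F (Z a t)) (at t within {-\<tau>..\<tau>})"
    "\<And>a h. a \<in> ball p \<rho> \<Longrightarrow> D a 0 h = h"
    "\<And>a t h. a \<in> ball p \<rho> \<Longrightarrow> t \<in> {-\<tau>..\<tau>} \<Longrightarrow>
       ((\<lambda>t. D a t h) has_vector_derivative frechet_derivative F (at (Z a t)) (D a t h)) (at t within {-\<tau>..\<tau>})"
    "\<And>a t. a \<in> ball p \<rho> \<Longrightarrow> t \<in> {-\<tau>..\<tau>} \<Longrightarrow> ((\<lambda>a. Z a t) has_derivative D a t) (at a)"
proof -
  let ?F' = "\<lambda>z. frechet_derivative F (at z)"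
  obtain R where R: "R > 0" "cball p R \<subseteq> S" using S p open_contains_cball by blast
  have F2: "Ck_on (Suc (Suc 0)) S F" using F by (simp add: numeral_2_eq_2)
  have dF: "(F has_derivative ?F' z) (at z)" if "z \<in> cball p R" for z
    using Ck_on_has_derivative[OF F2] that R by blast
  have linF': "linear (?F' z)" if "z \<in> cball p R" for z
    using has_derivative_linear[OF dF[OF that]] .
  obtain K1 where K1: "K1 \<ge> 0"
    and F'_bd: "\<And>z w. z \<in> cball p R \<Longrightarrow> norm (?F' z w) \<le> K1 * norm w"
    and F_lip: "\<And>x y. x \<in> cball p R \<Longrightarrow> y \<in> cball p R \<Longrightarrow> norm (F x - F y) \<le> K1 * norm (x - y)"
    using C1_lipschitz_cball[OF Ck_on_Suc_imp[OF F2] R(2)] by metis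
  have "\<exists>k\<ge>0. \<forall>x\<in>cball p R. \<forall>y\<in>cball p R. norm (?F' x b - ?F' y b) \<le> k * norm (x - y)" for b
  proof -
    have "Ck_on (Suc 0) S (\<lambda>z. ?F' z b)" using F2 by (simp del: Ck_on.simps(2) add: Ck_on.simps(2)[of "Suc 0"])
    from C1_lipschitz_cball[OF this R(2)] show ?thesis by metis
  qed
  then obtain k where k: "\<And>b. k b \<ge> (0::real)"
    and k_lip: "\<And>b x y. x \<in> cball p R \<Longrightarrow> y \<in> cball p R \<Longrightarrow> norm (?F' x b - ?F' y b) \<le> k b * norm (x - y)"
    by metis
  define K2 where "K2 = (\<Sum>b\<in>Basis. k b)"
  have K2: "K2 \<ge> 0" using k by (simp add: K2_def sum_nonneg)
  have F'_lip: "norm (?F' x w - ?F' y w) \<le> K2 * norm (x - y) * norm w"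
    if xy: "x \<in> cball p R" "y \<in> cball p R" for x y w
  proof -
    have exp: "?F' z w = (\<Sum>b\<in>Basis. (w \<bullet> b) *\<^sub>R ?F' z b)" if "z \<in> cball p R" for z
    proof -
      have "?F' z (\<Sum>b\<in>Basis. (w \<bullet> b) *\<^sub>R b) = (\<Sum>b\<in>Basis. (w \<bullet> b) *\<^sub>R ?F' z b)"
        using linF'[OF that] by (simp add: linear_sum linear_scale)
      then show ?thesis by (simp add: euclidean_representation)
    qed
    have "?F' x w - ?F' y w = (\<Sum>b\<in>Basis. (w \<bullet> b) *\<^sub>R (?F' x b - ?F' y b))"
      by (simp add: exp[OF xy(1)] exp[OF xy(2)] scaleR_diff_right sum_subtractf)
    also have "norm \<dots> \<le> (\<Sum>b\<in>Basis. norm w * (k b * norm (x - y)))"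
    proof (rule sum_norm_le)
      fix b :: 'a assume "b \<in> Basis"
      then show "norm ((w \<bullet> b) *\<^sub>R (?F' x b - ?F' y b)) \<le> norm w * (k b * norm (x - y))"
        using Basis_le_norm[of b w] k_lip[OF xy, of b] by (auto intro!: mult_mono)
    qed
    also have "\<dots> = K2 * norm (x - y) * norm w"
      by (simp add: K2_def sum_distrib_left[symmetric] sum_distrib_right[symmetric] mult.commute)
    finally show ?thesis .
  qed
  have taylor: "norm (F y - F x - ?F' x (y - x)) \<le> K2 * norm (y - x) * norm (y - x)"
    if xy: "x \<in> cball p R" "y \<in> cball p R" for x y
  proof -
    have "norm (F y - F x - ?F' x (y - x)) \<le> norm (y - x) * (K2 * norm (y - x))"
    proof (rule differentiable_bound_linearization[where f'="?F'" and S="closed_segment x y"])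
      show "x + t *\<^sub>R (y - x) \<in> closed_segment x y" if "t \<in> {0..1}" for t
        using that unfolding closed_segment_def
        by (auto simp: algebra_simps intro!: exI[of _ t])
      have seg: "z \<in> cball p R" if "z \<in> closed_segment x y" for z
        using that xy convex_contains_segment[of "cball p R"] convex_cball[of p R] by blast
      show "(F has_derivative ?F' z) (at z within closed_segment x y)" if "z \<in> closed_segment x y" for z
        by (rule has_derivative_at_withinI[OF dF[OF seg[OF that]]])
      show "onorm (?F' z - ?F' x) \<le> K2 * norm (y - x)" if z: "z \<in> closed_segment x y" for z
      proof (rule onorm_le)
        fix w
        have "norm (?F' z w - ?F' x w) \<le> K2 * norm (z - x) * norm w"
          by (rule F'_lip[OF seg[OF z] xy(1)])
        also have "\<dots> \<le> K2 * norm (y - x) * norm w"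
          using K2 segment_bound1[OF z] by (intro mult_right_mono mult_left_mono) auto
        finally show "norm ((?F' z - ?F' x) w) \<le> K2 * norm (y - x) * norm w" by simp
      qed
    qed simp
    then show ?thesis by (simp add: mult_ac)
  qed

  \<comment> \<open>A point moves along \<open>F\<close> and an attached vector along the
    linearization. The second component is Lipschitz in the point only for bounded vectors, which
    brings \<open>K2 * R\<close> into \<open>L\<close>.\<close>
  define G where "G q = (F (fst q), ?F' (fst q) (snd q))" for q :: "'a \<times> 'a"
  define L where "L = 2 * K1 + K2 * R"
  have L: "L \<ge> 0" "K1 \<le> L" using K1 K2 R by (auto simp: L_def)
  have fs: "fst q \<in> cball p R" "norm (snd q) \<le> R" if "q \<in> cball (p, 0) R" for q :: "'a \<times> 'a"
  proof -
    have "norm (q - (p, 0)) \<le> R" using that by (simp add: dist_norm norm_minus_commute)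
    then show "fst q \<in> cball p R" "norm (snd q) \<le> R"
      using norm_fst_le[of "fst q - p" "snd q"] norm_snd_le[of "snd q" "fst q - p"]
      by (cases q, simp add: dist_norm norm_minus_commute)+
  qed
  have G_lip: "norm (G q - G q') \<le> L * norm (q - q')"
    if q: "q \<in> cball (p, 0) R" "q' \<in> cball (p, 0) R" for q q'
  proof -
    let ?n = "norm (q - q')"
    have n: "norm (fst q - fst q') \<le> ?n" "norm (snd q - snd q') \<le> ?n"
      using norm_fst_le[of "fst q - fst q'" "snd q - snd q'"] norm_snd_le[of "snd q - snd q'" "fst q - fst q'"]
      by (cases q; cases q'; simp)+
    have "norm (G q - G q') \<le> norm (F (fst q) - F (fst q')) + norm (?F' (fst q) (snd q) - ?F' (fst q') (snd q'))"
      unfolding G_def using norm_Pair_le[of "F (fst q) - F (fst q')"] by simp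
    also have "norm (F (fst q) - F (fst q')) \<le> K1 * ?n"
      using F_lip[OF fs(1)[OF q(1)] fs(1)[OF q(2)]] mult_left_mono[OF n(1) K1] by linarith
    also have "norm (?F' (fst q) (snd q) - ?F' (fst q') (snd q')) \<le>
        norm (?F' (fst q) (snd q) - ?F' (fst q') (snd q)) + norm (?F' (fst q') (snd q - snd q'))"
      using norm_triangle_ineq[of "?F' (fst q) (snd q) - ?F' (fst q') (snd q)" "?F' (fst q') (snd q - snd q')"]
        linear_diff[OF linF'[OF fs(1)[OF q(2)]], of "snd q" "snd q'"] by simp
    also have "norm (?F' (fst q) (snd q) - ?F' (fst q') (snd q)) \<le> K2 * ?n * R"
    proof -
      have "norm (?F' (fst q) (snd q) - ?F' (fst q') (snd q)) \<le> K2 * norm (fst q - fst q') * norm (snd q)"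
        by (rule F'_lip[OF fs(1)[OF q(1)] fs(1)[OF q(2)]])
      also have "\<dots> \<le> K2 * ?n * R" using n fs(2)[OF q(1)] K2 by (intro mult_mono) auto
      finally show ?thesis .
    qed
    also have "norm (?F' (fst q') (snd q - snd q')) \<le> K1 * ?n"
      using F'_bd[OF fs(1)[OF q(2)], of "snd q - snd q'"] mult_left_mono[OF n(2) K1] by linarith
    finally show ?thesis by (simp add: L_def algebra_simps)
  qed
  define B where "B = norm (G (p, 0)) + L * R"
  have B: "B \<ge> 0" using L R by (simp add: B_def)
  have G_bd: "norm (G q) \<le> B" if q: "q \<in> cball (p, 0) R" for q
  proof -
    have "norm (G q - G (p, 0)) \<le> L * norm (q - (p, 0))" using q R by (intro G_lip) auto
    also have "\<dots> \<le> L * R" using q L by (intro mult_left_mono) (auto simp: dist_norm norm_minus_commute)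
    finally show ?thesis using norm_triangle_sub[of "G q" "G (p, 0)"] by (simp add: B_def)
  qed
  define \<tau> where "\<tau> = min (1 / (2 * (L + 1))) (R / (2 * (B + 1)))"
  have \<tau>: "\<tau> > 0" "\<tau> * L \<le> 1 / 2" "\<tau> * B \<le> R / 2"
  proof -
    show "\<tau> > 0" using L B R by (auto simp: \<tau>_def)
    have "\<tau> * L \<le> 1 / (2 * (L + 1)) * L" using L by (intro mult_right_mono) (auto simp: \<tau>_def)
    also have "\<dots> \<le> 1 / 2" using L by (simp add: divide_simps)
    finally show "\<tau> * L \<le> 1 / 2" .
    have "\<tau> * B \<le> R / (2 * (B + 1)) * B" using B by (intro mult_right_mono) (auto simp: \<tau>_def)
    also have "\<dots> \<le> R / 2" using B R by (simp add: divide_simps)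
    finally show "\<tau> * B \<le> R / 2" .
  qed
  let ?T = "{-\<tau>..\<tau>}"
  have "\<exists>z. q \<in> cball (p, 0) (R / 2) \<longrightarrow> z 0 = q \<and> (\<forall>t\<in>?T. z t \<in> cball (p, 0) R) \<and>
      (\<forall>t\<in>?T. (z has_vector_derivative G (z t)) (at t within ?T))" for q
  proof (cases "q \<in> cball (p, 0) (R / 2)")
    case True
    show ?thesis
      by (rule ode_existence_cball[where F=G, OF G_lip G_bd \<tau> L(1) R(1) True]) blast+
  qed auto
  then obtain Q where Q: "\<And>q. q \<in> cball (p, 0) (R / 2) \<Longrightarrow> Q q 0 = q"
    "\<And>q t. q \<in> cball (p, 0) (R / 2) \<Longrightarrow> t \<in> ?T \<Longrightarrow> Q q t \<in> cball (p, 0) R"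
    "\<And>q t. q \<in> cball (p, 0) (R / 2) \<Longrightarrow> t \<in> ?T \<Longrightarrow> (Q q has_vector_derivative G (Q q t)) (at t within ?T)"
    by metis
  \<comment> \<open>A point within R/4 of \<open>p\<close> together with a vector of length at most
    R/4 starts in the half ball that the existence lemma requires.\<close>
  define \<rho> where "\<rho> = R / 4"
  have \<rho>: "\<rho> > 0" using R by (simp add: \<rho>_def)
  have start: "(a, w) \<in> cball (p, 0) (R / 2)" if "a \<in> ball p \<rho>" "norm w \<le> \<rho>" for a w :: 'a
  proof -
    have "dist (p, 0) (a, w) \<le> norm (a - p) + norm w"
      using norm_Pair_le[of "p - a" "- w"] by (simp add: dist_norm norm_minus_commute[of a p])
    then show ?thesis using that by (simp add: \<rho>_def dist_norm norm_minus_commute)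
  qed
  define Z where "Z a t = fst (Q (a, 0) t)" for a t
  \<comment> \<open>Only vectors of length at most \<open>\<rho>\<close> may be started, so the
    scaled basis vectors are transported and the result is extended linearly.\<close>
  define D where "D a t h = (\<Sum>b\<in>Basis. ((h \<bullet> b) / \<rho>) *\<^sub>R snd (Q (a, \<rho> *\<^sub>R b) t))" for a t and h :: 'a
  have dfst: "((\<lambda>t. fst (Q q t)) has_vector_derivative F (fst (Q q t))) (at t within ?T)"
    and dsnd: "((\<lambda>t. snd (Q q t)) has_vector_derivative ?F' (fst (Q q t)) (snd (Q q t))) (at t within ?T)"
    if "q \<in> cball (p, 0) (R / 2)" "t \<in> ?T" for q t
    using bounded_linear.has_vector_derivative[OF bounded_linear_fst Q(3)[OF that]]
      bounded_linear.has_vector_derivative[OF bounded_linear_snd Q(3)[OF that]]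
    by (simp_all add: G_def)
  have a0: "(a, 0 :: 'a) \<in> cball (p, 0) (R / 2)" if "a \<in> ball p \<rho>" for a :: 'a
    using start[OF that, of 0] \<rho> by simp
  have Zin: "Z a t \<in> cball p R" if "a \<in> ball p \<rho>" "t \<in> ?T" for a t
    unfolding Z_def by (rule fs(1)[OF Q(2)[OF a0[OF that(1)] that(2)]])
  have Z0: "Z a 0 = a" if "a \<in> ball p \<rho>" for a using Q(1)[OF a0[OF that]] by (simp add: Z_def)
  have dZ: "(Z a has_vector_derivative F (Z a t)) (at t within ?T)" if "a \<in> ball p \<rho>" "t \<in> ?T" for a t
    unfolding Z_def using dfst[OF a0[OF that(1)] that(2)] .
  have \<tau>K: "\<tau> * K1 \<le> 1 / 2" using \<tau> L mult_left_mono[of K1 L \<tau>] by linarith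
  \<comment> \<open>By uniqueness the base curve ignores the attached vector; all linearized
    equations therefore live along the same curve \<open>Z a\<close>.\<close>
  have fstQ: "fst (Q (a, w) t) = Z a t" if a: "a \<in> ball p \<rho>" and w: "norm w \<le> \<rho>" and t: "t \<in> ?T" for a w t
  proof -
    let ?u = "\<lambda>t. fst (Q (a, w) t) - Z a t"
    note st = start[OF a w]
    have "norm (?u t) \<le> 2 * (norm (?u 0) + \<tau> * 0)"
    proof (rule short_time_gronwall[where L=K1])
      fix t assume t: "t \<in> ?T"
      show "(?u has_vector_derivative F (fst (Q (a, w) t)) - F (Z a t)) (at t within ?T)"
        by (intro has_vector_derivative_diff dfst dZ st a t)
      show "norm (F (fst (Q (a, w) t)) - F (Z a t)) \<le> K1 * norm (?u t) + 0"
        using F_lip[OF fs(1)[OF Q(2)[OF st t]] Zin[OF a t]] by simp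
    qed (use \<tau> K1 \<tau>K t in auto)
    then show ?thesis using Q(1)[OF st] Z0[OF a] by simp
  qed
  have bn: "norm (\<rho> *\<^sub>R b) \<le> \<rho>" if "b \<in> Basis" for b :: 'a using that \<rho> by simp
  have dD: "((\<lambda>t. D a t h) has_vector_derivative ?F' (Z a t) (D a t h)) (at t within ?T)"
    if a: "a \<in> ball p \<rho>" and t: "t \<in> ?T" for a t h
  proof -
    have "((\<lambda>t. D a t h) has_vector_derivative
        (\<Sum>b\<in>Basis. ((h \<bullet> b) / \<rho>) *\<^sub>R ?F' (Z a t) (snd (Q (a, \<rho> *\<^sub>R b) t)))) (at t within ?T)"
      unfolding D_def
    proof (intro has_vector_derivative_sum
        bounded_linear.has_vector_derivative[OF bounded_linear_scaleR_right])
      fix b :: 'a assume b: "b \<in> Basis"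
      show "((\<lambda>t. snd (Q (a, \<rho> *\<^sub>R b) t)) has_vector_derivative
          ?F' (Z a t) (snd (Q (a, \<rho> *\<^sub>R b) t))) (at t within ?T)"
        using dsnd[OF start[OF a bn[OF b]] t] fstQ[OF a bn[OF b] t] by simp
    qed
    then show ?thesis
      unfolding D_def using linF'[OF Zin[OF a t]] by (simp add: linear_sum linear_scale)
  qed
  have D0: "D a 0 h = h" if a: "a \<in> ball p \<rho>" for a h
  proof -
    have "D a 0 h = (\<Sum>b\<in>Basis. (h \<bullet> b) *\<^sub>R b)"
      unfolding D_def using Q(1)[OF start[OF a bn]] \<rho> by (intro sum.cong) auto
    then show ?thesis by (simp add: euclidean_representation)
  qed
  have Z_lip: "norm (Z a' t - Z a t) \<le> 2 * norm (a' - a)"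
    if a: "a \<in> ball p \<rho>" "a' \<in> ball p \<rho>" and t: "t \<in> ?T" for a a' t
  proof -
    let ?u = "\<lambda>t. Z a' t - Z a t"
    have "norm (?u t) \<le> 2 * (norm (?u 0) + \<tau> * 0)"
    proof (rule short_time_gronwall[where L=K1])
      fix t assume t: "t \<in> ?T"
      show "(?u has_vector_derivative F (Z a' t) - F (Z a t)) (at t within ?T)"
        by (intro has_vector_derivative_diff dZ a t)
      show "norm (F (Z a' t) - F (Z a t)) \<le> K1 * norm (?u t) + 0"
        using F_lip[OF Zin[OF a(2) t] Zin[OF a(1) t]] by simp
    qed (use \<tau> K1 \<tau>K t in auto)
    then show ?thesis by (simp add: Z0[OF a(1)] Z0[OF a(2)])
  qed
  \<comment> \<open>Gronwall gives 2 (0 + \<tau> e) with e equal to 4 \<open>K2\<close> times the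
    squared distance of the initial values, whence the 8.\<close>
  define C where "C = 8 * K2 * \<tau>"
  have quad: "norm (Z a' t - Z a t - D a t (a' - a)) \<le> C * norm (a' - a) * norm (a' - a)"
    if a: "a \<in> ball p \<rho>" "a' \<in> ball p \<rho>" and t: "t \<in> ?T" for a a' t
  proof -
    let ?u = "\<lambda>t. Z a' t - Z a t - D a t (a' - a)"
    let ?e = "K2 * (2 * norm (a' - a)) * (2 * norm (a' - a))"
    have "norm (?u t) \<le> 2 * (norm (?u 0) + \<tau> * ?e)"
    proof (rule short_time_gronwall[where L=K1])
      fix t assume t: "t \<in> ?T"
      let ?u' = "F (Z a' t) - F (Z a t) - ?F' (Z a t) (D a t (a' - a))"
      show "(?u has_vector_derivative ?u') (at t within ?T)"
        by (intro has_vector_derivative_diff dZ dD a t)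
      have "?u' = (F (Z a' t) - F (Z a t) - ?F' (Z a t) (Z a' t - Z a t)) + ?F' (Z a t) (?u t)"
        using linF'[OF Zin[OF a(1) t]] by (simp add: linear_diff)
      then have "norm ?u' \<le> norm (F (Z a' t) - F (Z a t) - ?F' (Z a t) (Z a' t - Z a t))
          + norm (?F' (Z a t) (?u t))"
        by (metis norm_triangle_ineq)
      also have "norm (?F' (Z a t) (?u t)) \<le> K1 * norm (?u t)" by (rule F'_bd[OF Zin[OF a(1) t]])
      also have "norm (F (Z a' t) - F (Z a t) - ?F' (Z a t) (Z a' t - Z a t)) \<le>
          K2 * norm (Z a' t - Z a t) * norm (Z a' t - Z a t)"
        by (rule taylor[OF Zin[OF a(1) t] Zin[OF a(2) t]])
      also have "\<dots> \<le> ?e"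
        using Z_lip[OF a t] K2 by (intro mult_mono mult_left_mono) auto
      finally show "norm ?u' \<le> K1 * norm (?u t) + ?e" by simp
    qed (use \<tau> K1 K2 \<tau>K t in auto)
    then show ?thesis by (simp add: Z0[OF a(1)] Z0[OF a(2)] D0[OF a(1)] C_def mult_ac)
  qed
  have C: "C \<ge> 0" using K2 \<tau> by (simp add: C_def)
  have linD: "linear (D a t)" for a t
    unfolding D_def
    by (intro linear_compose_sum linearI ballI)
      (auto simp: inner_add_left add_divide_distrib scaleR_add_left)
  have derZ: "((\<lambda>a. Z a t) has_derivative D a t) (at a)" if a: "a \<in> ball p \<rho>" and t: "t \<in> ?T" for a t
    unfolding has_derivative_at_alt
  proof (intro conjI allI impI)
    show "bounded_linear (D a t)" using linD linear_conv_bounded_linear by blast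
    fix e :: real assume e: "e > 0"
    obtain d where d: "d > 0" "ball a d \<subseteq> ball p \<rho>" using a open_ball openE by blast
    show "\<exists>d>0. \<forall>y. norm (y - a) < d \<longrightarrow> norm (Z y t - Z a t - D a t (y - a)) \<le> e * norm (y - a)"
    proof (intro exI[of _ "min d (e / (C + 1))"] conjI allI impI)
      fix y assume y: "norm (y - a) < min d (e / (C + 1))"
      then have "y \<in> ball p \<rho>" using d by (auto simp: dist_norm norm_minus_commute subset_iff)
      from quad[OF a this t]
      have "norm (Z y t - Z a t - D a t (y - a)) \<le> C * norm (y - a) * norm (y - a)" .
      also have "C * norm (y - a) \<le> e"
      proof -
        have "(C + 1) * norm (y - a) \<le> e" using y C by (simp add: field_simps)
        moreover have "C * norm (y - a) \<le> (C + 1) * norm (y - a)" by (intro mult_right_mono) auto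
        ultimately show ?thesis by linarith
      qed
      finally show "norm (Z y t - Z a t - D a t (y - a)) \<le> e * norm (y - a)"
        by (simp add: mult_right_mono)
    qed (use d e C in auto)
  qed
  show ?thesis
    by (rule that[of \<rho> \<tau> Z D]) (use \<rho> \<tau> Zin R Z0 dZ D0 dD derZ in auto)
qed

section \<open>Christoffel symbols and curvature in a chart\<close>

lemma linear_frechet_derivative_param:
  assumes "open U" "x \<in> U" "\<And>y. y \<in> U \<Longrightarrow> linear (\<lambda>u. f u y)"
    and "\<And>u. f u differentiable (at x)"
  shows "linear (\<lambda>u. frechet_derivative (f u) (at x) w)"
proof (rule linearI)
  have d: "(f u has_derivative frechet_derivative (f u) (at x)) (at x)" for u
    using assms(4) frechet_derivative_works by blast
  fix u v
  have "frechet_derivative (f (u + v)) (at x) = frechet_derivative (\<lambda>y. f u y + f v y) (at x)"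
    by (rule frechet_derivative_cong_open[OF assms(1,2)]) (simp add: linear_add[OF assms(3)])
  also have "\<dots> = (\<lambda>w. frechet_derivative (f u) (at x) w + frechet_derivative (f v) (at x) w)"
    by (rule frechet_derivative_at[symmetric]) (intro has_derivative_add d)
  finally show "frechet_derivative (f (u + v)) (at x) w =
      frechet_derivative (f u) (at x) w + frechet_derivative (f v) (at x) w" by simp
  fix r
  have "frechet_derivative (f (r *\<^sub>R u)) (at x) = frechet_derivative (\<lambda>y. r *\<^sub>R f u y) (at x)"
    by (rule frechet_derivative_cong_open[OF assms(1,2)]) (simp add: linear_scale[OF assms(3)])
  also have "\<dots> = (\<lambda>w. r *\<^sub>R frechet_derivative (f u) (at x) w)"
    by (rule frechet_derivative_at[symmetric])
      (intro bounded_linear.has_derivative[OF bounded_linear_scaleR_right] d)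
  finally show "frechet_derivative (f (r *\<^sub>R u)) (at x) w = r *\<^sub>R frechet_derivative (f u) (at x) w"
    by simp
qed

lemma linear_frechet_derivative: "f differentiable (at x) \<Longrightarrow> linear (frechet_derivative f (at x))"
  using frechet_derivative_works has_derivative_linear by blast

lemma linear_expand_axis:
  fixes f :: "real ^ 'n \<Rightarrow> 'b::real_vector"
  assumes "linear f"
  shows "f u = (\<Sum>i\<in>UNIV. u $ i *\<^sub>R f (axis i 1))"
proof -
  have "f (\<Sum>i\<in>UNIV. u $ i *\<^sub>R axis i 1) = (\<Sum>i\<in>UNIV. u $ i *\<^sub>R f (axis i 1))"
    using assms by (simp add: linear_sum linear_scale)
  then show ?thesis by (simp add: scalar_mult_eq_scaleR[symmetric] basis_expansion)
qed

lemma bilinear_expand_axis: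
  fixes B :: "real ^ 'n \<Rightarrow> real ^ 'm \<Rightarrow> 'b::real_vector"
  assumes "bilinear B"
  shows "B u v = (\<Sum>i\<in>UNIV. \<Sum>j\<in>UNIV. (u $ i * v $ j) *\<^sub>R B (axis i 1) (axis j 1))"
proof -
  have 1: "linear (\<lambda>u. B u v)" for v using assms by (simp add: bilinear_def)
  have 2: "linear (B u)" for u using assms by (simp add: bilinear_def)
  show ?thesis
    by (subst linear_expand_axis[OF 1], subst linear_expand_axis[OF 2]) (simp add: scaleR_sum_right)
qed

text \<open>Leibniz rule for a bilinear form that varies with the point. Its differentiability is
  known only for constant arguments, so it is expanded in the coordinate basis, differentiated and
  reassembled.\<close>

lemma bilinear_field_has_derivative:
  fixes B :: "'a::real_normed_vector \<Rightarrow> real ^ 'n \<Rightarrow> real ^ 'm \<Rightarrow> 'b::real_normed_vector"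
    and X :: "'s::real_normed_vector \<Rightarrow> 'a"
  assumes U: "open U" and B: "\<And>y. y \<in> U \<Longrightarrow> bilinear (B y)"
    and dB: "\<And>u v y. y \<in> U \<Longrightarrow> (\<lambda>y. B y u v) differentiable (at y)"
    and X: "(X has_derivative X') (at s)" "X s \<in> U"
    and f: "(f has_derivative f') (at s)" and h: "(h has_derivative h') (at s)"
  shows "((\<lambda>r. B (X r) (f r) (h r)) has_derivative
    (\<lambda>w. frechet_derivative (\<lambda>y. B y (f s) (h s)) (at (X s)) (X' w)
        + B (X s) (f' w) (h s) + B (X s) (f s) (h' w))) (at s)"
proof -
  let ?e = "\<lambda>i. axis i 1 :: real ^ 'n" and ?e' = "\<lambda>i. axis i 1 :: real ^ 'm"
  let ?D = "\<lambda>u v. frechet_derivative (\<lambda>y. B y u v) (at (X s))"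
  have bD: "bilinear (\<lambda>u v. ?D u v w)" for w
    unfolding bilinear_def
    using linear_frechet_derivative_param[OF U X(2), of "\<lambda>u y. B y u _"]
      linear_frechet_derivative_param[OF U X(2), of "\<lambda>v y. B y _ v"] B dB[OF X(2)]
    by (auto simp: bilinear_def)
  have comp: "((\<lambda>r. (\<Sum>i\<in>UNIV. \<Sum>j\<in>UNIV. (f r $ i * h r $ j) *\<^sub>R B (X r) (?e i) (?e' j))) has_derivative
    (\<lambda>w. \<Sum>i\<in>UNIV. \<Sum>j\<in>UNIV. (f s $ i * h s $ j) *\<^sub>R ?D (?e i) (?e' j) (X' w) +
       (f s $ i * h' w $ j + f' w $ i * h s $ j) *\<^sub>R B (X s) (?e i) (?e' j))) (at s)"
  proof (intro has_derivative_sum has_derivative_scaleR has_derivative_mult)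
    show "((\<lambda>r. f r $ i) has_derivative (\<lambda>w. f' w $ i)) (at s)" for i
      by (rule bounded_linear.has_derivative[OF bounded_linear_vec_nth f])
    show "((\<lambda>r. h r $ i) has_derivative (\<lambda>w. h' w $ i)) (at s)" for i
      by (rule bounded_linear.has_derivative[OF bounded_linear_vec_nth h])
    show "((\<lambda>r. B (X r) (?e i) (?e' j)) has_derivative (\<lambda>w. ?D (?e i) (?e' j) (X' w))) (at s)" for i j
      by (rule has_derivative_compose[OF X(1)])
        (use dB[OF X(2)] frechet_derivative_works in blast)
  qed
  have "((\<lambda>r. (\<Sum>i\<in>UNIV. \<Sum>j\<in>UNIV. (f r $ i * h r $ j) *\<^sub>R B (X r) (?e i) (?e' j))) has_derivative
    (\<lambda>w. ?D (f s) (h s) (X' w) + B (X s) (f' w) (h s) + B (X s) (f s) (h' w))) (at s)"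
  proof (rule has_derivative_eq_rhs[OF comp], rule ext)
    fix w
    show "(\<Sum>i\<in>UNIV. \<Sum>j\<in>UNIV. (f s $ i * h s $ j) *\<^sub>R ?D (?e i) (?e' j) (X' w) +
       (f s $ i * h' w $ j + f' w $ i * h s $ j) *\<^sub>R B (X s) (?e i) (?e' j)) =
       ?D (f s) (h s) (X' w) + B (X s) (f' w) (h s) + B (X s) (f s) (h' w)"
      by (subst bilinear_expand_axis[OF bD], subst bilinear_expand_axis[OF B[OF X(2)]],
          subst bilinear_expand_axis[OF B[OF X(2)]])
        (simp add: sum.distrib scaleR_add_left algebra_simps)
  qed
  note d = this
  obtain N where N: "open N" "s \<in> N" "\<And>r. r \<in> N \<Longrightarrow> X r \<in> U"
  proof -
    have "\<forall>\<^sub>F r in nhds s. X r \<in> U"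
      using has_derivative_continuous[OF X(1)] U X(2)
      by (intro topological_tendstoD[of X "X s"]) (auto simp: continuous_at tendsto_at_iff_tendsto_nhds)
    with that show ?thesis unfolding eventually_nhds by blast
  qed
  show ?thesis
    by (rule has_derivative_transform_within_open[OF d N(1,2)])
      (simp add: bilinear_expand_axis[OF B[OF N(3)], symmetric])
qed

lemma bilinear_field_has_vector_derivative:
  fixes B :: "'a::real_normed_vector \<Rightarrow> real ^ 'n \<Rightarrow> real ^ 'm \<Rightarrow> 'b::real_normed_vector"
    and X :: "real \<Rightarrow> 'a"
  assumes U: "open U" and B: "\<And>y. y \<in> U \<Longrightarrow> bilinear (B y)"
    and dB: "\<And>u v y. y \<in> U \<Longrightarrow> (\<lambda>y. B y u v) differentiable (at y)"
    and X: "(X has_vector_derivative X') (at s)" "X s \<in> U"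
    and f: "(f has_vector_derivative f') (at s)" and h: "(h has_vector_derivative h') (at s)"
  shows "((\<lambda>r. B (X r) (f r) (h r)) has_vector_derivative
     frechet_derivative (\<lambda>y. B y (f s) (h s)) (at (X s)) X'
        + B (X s) f' (h s) + B (X s) (f s) h') (at s)"
  unfolding has_vector_derivative_def
proof (rule has_derivative_eq_rhs[OF bilinear_field_has_derivative[OF U B dB
        X(1)[unfolded has_vector_derivative_def] X(2) f[unfolded has_vector_derivative_def]
        h[unfolded has_vector_derivative_def]]], simp_all, rule ext)
  fix w :: real
  have 1: "linear (\<lambda>u. B (X s) u v)" for v using B[OF X(2)] by (simp add: bilinear_def)
  have 2: "linear (B (X s) u)" for u using B[OF X(2)] by (simp add: bilinear_def)
  show "frechet_derivative (\<lambda>y. B y (f s) (h s)) (at (X s)) (w *\<^sub>R X') + B (X s) (w *\<^sub>R f') (h s) +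
      B (X s) (f s) (w *\<^sub>R h') =
    w *\<^sub>R (frechet_derivative (\<lambda>y. B y (f s) (h s)) (at (X s)) X' + B (X s) f' (h s) + B (X s) (f s) h')"
    using linear_scale[OF linear_frechet_derivative[OF dB[OF X(2)]]] linear_scale[OF 1] linear_scale[OF 2]
    by (simp add: scaleR_add_right)
qed

section \<open>Metric, Christoffel symbols and curvature of one chart\<close>

locale riem_chart =
  fixes M :: "('a, 'n::finite) rspace" and c :: "('a, 'n) chart"
  assumes riemannian: "riemannian_manifold M" and chart: "c \<in> atlas M"
begin

definition U where "U = coord c ` dom_of c"

abbreviation "g \<equiv> metric M c"
abbreviation "\<Gamma> \<equiv> christoffel M c"
abbreviation "Rm \<equiv> curvature M c"
abbreviation "dg x u v w \<equiv> frechet_derivative (\<lambda>y. g y u v) (at x) w"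
abbreviation "d\<Gamma> x u v w \<equiv> frechet_derivative (\<lambda>y. \<Gamma> y u v) (at x) w"

lemma open_U: "open U"
  using riemannian chart by (auto simp: riemannian_manifold_def smooth_manifold_def is_chart_def U_def)

lemma g_bilinear: "x \<in> U \<Longrightarrow> bilinear (g x)"
  and g_sym: "x \<in> U \<Longrightarrow> g x u v = g x v u"
  and g_pos: "x \<in> U \<Longrightarrow> u \<noteq> 0 \<Longrightarrow> g x u u > 0"
  using riemannian chart unfolding riemannian_manifold_def U_def by blast+

lemma g_Ck: "Ck_on n U (\<lambda>x. g x u v)"
  using riemannian chart unfolding riemannian_manifold_def smooth_on_def U_def by blast

lemma g_linear: "x \<in> U \<Longrightarrow> linear (\<lambda>u. g x u v)" "x \<in> U \<Longrightarrow> linear (g x u)"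
  using g_bilinear by (auto simp: bilinear_def)

lemmas g_simps = linear_add[OF g_linear(1)] linear_add[OF g_linear(2)]
  linear_scale[OF g_linear(1)] linear_scale[OF g_linear(2)]
  linear_neg[OF g_linear(1)] linear_neg[OF g_linear(2)]
  linear_diff[OF g_linear(1)] linear_diff[OF g_linear(2)]
  linear_0[OF g_linear(1)] linear_0[OF g_linear(2)]

lemma g_eqI: "x \<in> U \<Longrightarrow> (\<And>z. g x a z = g x b z) \<Longrightarrow> a = b"
  using g_pos[of x "a - b"] by (auto simp: g_simps)

lemma g_differentiable: "x \<in> U \<Longrightarrow> (\<lambda>y. g y u v) differentiable (at x)"
  using g_Ck[of "Suc 0" u v] by simp

lemma dg_linear: assumes "x \<in> U"
  shows "linear (\<lambda>u. dg x u v w)" "linear (\<lambda>v. dg x u v w)" "linear (dg x u v)"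
  using linear_frechet_derivative_param[OF open_U assms, of "\<lambda>u y. g y u v" w]
    linear_frechet_derivative_param[OF open_U assms, of "\<lambda>v y. g y u v" w]
    linear_frechet_derivative[OF g_differentiable[OF assms]] g_linear g_differentiable[OF assms]
  by auto

lemmas dg_simps = linear_add[OF dg_linear(1)] linear_add[OF dg_linear(2)] linear_add[OF dg_linear(3)]
  linear_scale[OF dg_linear(1)] linear_scale[OF dg_linear(2)] linear_scale[OF dg_linear(3)]

lemma dg_sym: "x \<in> U \<Longrightarrow> dg x u v w = dg x v u w"
  using frechet_derivative_cong_open[OF open_U, of x "\<lambda>y. g y u v" "\<lambda>y. g y v u"] g_sym by simp

text \<open>Riesz representation: positive definiteness makes the passage to covectors injective,
  hence surjective by dimension. It supplies existence in the definition of the Christoffel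
  symbols.\<close>

lemma g_represents:
  assumes x: "x \<in> U" and k: "linear k"
  shows "\<exists>w. \<forall>z. g x w z = k z"
proof -
  define T where "T w = (\<chi> j. g x w (axis j 1))" for w
  have T: "linear T"
    unfolding T_def by (rule linearI) (simp_all add: vec_eq_iff g_simps[OF x])
  have gexp: "g x w z = (\<Sum>j\<in>UNIV. z $ j *\<^sub>R T w $ j)" for w z
    using linear_expand_axis[OF g_linear(2)[OF x], of w z] by (simp add: T_def)
  have "inj T"
  proof (subst linear_injective_0[OF T], intro allI impI)
    fix w assume "T w = 0"
    then have "g x w w = 0" by (simp add: gexp)
    then show "w = 0" using g_pos[OF x, of w] by auto
  qed
  then have "surj T" using linear_injective_imp_surjective[OF T] by blast
  then obtain w where "T w = (\<chi> j. k (axis j 1))" by (metis surjD)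
  then have "g x w z = k z" for z
    using linear_expand_axis[OF k, of z] by (simp add: gexp)
  then show ?thesis by blast
qed

text \<open>The Koszul expression is linear in \<open>z\<close>, so a representing vector exists,
  and nondegeneracy makes it unique. From here on the definition by \<open>THE\<close> need not be
  unfolded again.\<close>

lemma christoffel_eq:
  assumes x: "x \<in> U"
  shows "2 * g x (\<Gamma> x u v) z = dg x v z u + dg x u z v - dg x u v z"
proof -
  let ?k = "\<lambda>z. dg x v z u + dg x u z v - dg x u v z"
  have "linear (\<lambda>z. ?k z / 2)"
    by (intro linearI) (simp_all add: dg_simps[OF x] field_simps)
  from g_represents[OF x this] obtain w where w: "\<And>z. g x w z = ?k z / 2" by blast
  have "\<exists>!w. \<forall>z. 2 * g x w z = ?k z"
  proof (rule ex1I[of _ w])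
    fix w' assume w': "\<forall>z. 2 * g x w' z = ?k z"
    show "w' = w"
    proof (rule g_eqI[OF x])
      fix z
      have "2 * g x w' z = 2 * (?k z / 2)" unfolding spec[OF w'] by simp
      then show "g x w' z = g x w z" unfolding w[of z, symmetric] by simp
    qed
  qed (simp add: w)
  from theI'[OF this] show ?thesis unfolding christoffel_def by blast
qed

lemma christoffel_sym: "x \<in> U \<Longrightarrow> \<Gamma> x u v = \<Gamma> x v u"
proof (rule g_eqI)
  fix z assume x: "x \<in> U"
  show "g x (\<Gamma> x u v) z = g x (\<Gamma> x v u) z"
    using christoffel_eq[OF x, of u v z] christoffel_eq[OF x, of v u z] dg_sym[OF x, of u v z] by simp
qed

lemma christoffel_bilinear:
  assumes x: "x \<in> U" shows "bilinear (\<Gamma> x)"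
proof -
  have 1: "linear (\<lambda>u. \<Gamma> x u v)" for v
  proof (rule linearI)
    fix a b r
    show "\<Gamma> x (a + b) v = \<Gamma> x a v + \<Gamma> x b v"
    proof (rule g_eqI[OF x])
      fix z show "g x (\<Gamma> x (a + b) v) z = g x (\<Gamma> x a v + \<Gamma> x b v) z"
        using christoffel_eq[OF x, of "a + b" v z] christoffel_eq[OF x, of a v z] christoffel_eq[OF x, of b v z]
        by (simp add: g_simps[OF x] dg_simps[OF x])
    qed
    show "\<Gamma> x (r *\<^sub>R a) v = r *\<^sub>R \<Gamma> x a v"
    proof (rule g_eqI[OF x])
      fix z
      have "2 * g x (\<Gamma> x (r *\<^sub>R a) v) z = r * (2 * g x (\<Gamma> x a v) z)"
        unfolding christoffel_eq[OF x] by (simp add: dg_simps[OF x] algebra_simps)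
      then show "g x (\<Gamma> x (r *\<^sub>R a) v) z = g x (r *\<^sub>R \<Gamma> x a v) z" by (simp add: g_simps[OF x])
    qed
  qed
  have "linear (\<Gamma> x u)" for u
  proof -
    have "\<Gamma> x u = (\<lambda>v. \<Gamma> x v u)" by (rule ext) (rule christoffel_sym[OF x])
    with 1[of u] show ?thesis by simp
  qed
  with 1 show ?thesis by (simp add: bilinear_def)
qed

lemma christoffel_linear: "x \<in> U \<Longrightarrow> linear (\<lambda>u. \<Gamma> x u v)" "x \<in> U \<Longrightarrow> linear (\<Gamma> x u)"
  using christoffel_bilinear by (auto simp: bilinear_def)

lemmas christoffel_simps = linear_add[OF christoffel_linear(1)] linear_add[OF christoffel_linear(2)]
  linear_scale[OF christoffel_linear(1)] linear_scale[OF christoffel_linear(2)]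
  linear_neg[OF christoffel_linear(1)] linear_neg[OF christoffel_linear(2)]
  linear_diff[OF christoffel_linear(1)] linear_diff[OF christoffel_linear(2)]
  linear_0[OF christoffel_linear(1)] linear_0[OF christoffel_linear(2)]

text \<open>Tested on the coordinate vectors, the Koszul formula is a linear system whose matrix is
  twice the Gram matrix of the metric; positive definiteness makes it invertible.\<close>

lemma christoffel_Ck: "Ck_on n U (\<lambda>x. \<Gamma> x u v)"
proof (rule Ck_on_linear_system[OF open_U])
  let ?A = "\<lambda>x. \<chi> i j. 2 * g x (axis j 1) (axis i 1) "
  let ?b = "\<lambda>x. \<chi> i. dg x v (axis i 1) u + dg x u (axis i 1) v - dg x u v (axis i 1)"
  have Aw: "?A x *v w = (\<chi> i. 2 * g x w (axis i 1))" if x: "x \<in> U" for x w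
    by (simp add: vec_eq_iff matrix_vector_mult_def linear_expand_axis[OF g_linear(1)[OF x], of w]
        sum_distrib_left mult_ac)
  show "Ck_on n U (\<lambda>x. ?A x $ i $ j)" for i j
    using Ck_on_mult[OF open_U Ck_on_const[OF open_U] g_Ck] by simp
  have d: "Ck_on n U (\<lambda>x. dg x a b w)" for a b w using g_Ck[of "Suc n" a b] by simp
  show "Ck_on n U (\<lambda>x. ?b x $ i)" for i
    by (simp, intro Ck_on_add Ck_on_diff open_U d)
  fix x assume x: "x \<in> U"
  have "\<forall>w. ?A x *v w = 0 \<longrightarrow> w = 0"
  proof (intro allI impI)
    fix w assume "?A x *v w = 0"
    then have "g x w (axis i 1) = 0" for i using Aw[OF x, of w] by (simp add: vec_eq_iff)
    then have "g x w w = 0" using linear_expand_axis[OF g_linear(2)[OF x], of w w] by simp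
    then show "w = 0" using g_pos[OF x, of w] by auto
  qed
  then have "invertible (?A x)"
    using matrix_left_invertible_ker invertible_left_inverse by blast
  then show "det (?A x) \<noteq> 0" using invertible_det_nz by blast
  show "?A x *v \<Gamma> x u v = ?b x"
    unfolding Aw[OF x] by (simp add: vec_eq_iff christoffel_eq[OF x])
qed

lemma christoffel_differentiable: "x \<in> U \<Longrightarrow> (\<lambda>y. \<Gamma> y u v) differentiable (at x)"
  using christoffel_Ck[of "Suc 0" u v] by simp

lemma dchristoffel_linear: assumes "x \<in> U"
  shows "linear (\<lambda>u. d\<Gamma> x u v w)" "linear (\<lambda>v. d\<Gamma> x u v w)" "linear (d\<Gamma> x u v)"
  using linear_frechet_derivative_param[OF open_U assms, of "\<lambda>u y. \<Gamma> y u v" w]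
    linear_frechet_derivative_param[OF open_U assms, of "\<lambda>v y. \<Gamma> y u v" w]
    linear_frechet_derivative[OF christoffel_differentiable[OF assms]]
    christoffel_linear christoffel_differentiable[OF assms]
  by auto

lemmas dchristoffel_simps =
  linear_add[OF dchristoffel_linear(1)] linear_add[OF dchristoffel_linear(2)] linear_add[OF dchristoffel_linear(3)]
  linear_scale[OF dchristoffel_linear(1)] linear_scale[OF dchristoffel_linear(2)] linear_scale[OF dchristoffel_linear(3)]

lemma dchristoffel_sym: "x \<in> U \<Longrightarrow> d\<Gamma> x u v w = d\<Gamma> x v u w"
  using frechet_derivative_cong_open[OF open_U, of x "\<lambda>y. \<Gamma> y u v" "\<lambda>y. \<Gamma> y v u"] christoffel_sym by simp

text \<open>Adding the Koszul formulas with \<open>u\<close> and \<open>v\<close> exchanged cancels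
  all terms except twice the derivative of the metric.\<close>

lemma metric_compatible: "x \<in> U \<Longrightarrow> dg x u v w = g x (\<Gamma> x w u) v + g x u (\<Gamma> x w v)"
  using christoffel_eq[of x w u v] christoffel_eq[of x w v u] dg_sym[of x v u w]
    g_sym[of x u "\<Gamma> x w v"] by simp

lemmas g_field_derivative =
  bilinear_field_has_derivative[where B=g, OF open_U g_bilinear g_differentiable]
lemmas g_field_vector_derivative =
  bilinear_field_has_vector_derivative[where B=g, OF open_U g_bilinear g_differentiable]
lemmas christoffel_field_vector_derivative =
  bilinear_field_has_vector_derivative[where B=\<Gamma>, OF open_U christoffel_bilinear christoffel_differentiable]

lemma second_derivative_metric:
  assumes x: "x \<in> U"
  shows "frechet_derivative (\<lambda>y. dg y w z v) (at x) u =
     g x (\<Gamma> x u (\<Gamma> x v w)) z + g x (\<Gamma> x v w) (\<Gamma> x u z) + g x (d\<Gamma> x v w u) z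
   + g x (\<Gamma> x u w) (\<Gamma> x v z) + g x w (\<Gamma> x u (\<Gamma> x v z)) + g x w (d\<Gamma> x v z u)"
proof -
  have d\<Gamma>: "((\<lambda>y. \<Gamma> y v w) has_derivative d\<Gamma> x v w) (at x)" for v w
    using christoffel_differentiable[OF x] frechet_derivative_works by blast
  have "frechet_derivative (\<lambda>y. dg y w z v) (at x) =
      frechet_derivative (\<lambda>y. g y (\<Gamma> y v w) z + g y w (\<Gamma> y v z)) (at x)"
    by (rule frechet_derivative_cong_open[OF open_U x]) (rule metric_compatible)
  also have "\<dots> = (\<lambda>u. (dg x (\<Gamma> x v w) z u + g x (d\<Gamma> x v w u) z + g x (\<Gamma> x v w) 0)
      + (dg x w (\<Gamma> x v z) u + g x 0 (\<Gamma> x v z) + g x w (d\<Gamma> x v z u)))"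
    by (rule frechet_derivative_at[symmetric])
      (intro has_derivative_add g_field_derivative has_derivative_ident has_derivative_const d\<Gamma> x)
  finally show ?thesis by (simp add: metric_compatible[OF x] g_simps[OF x])
qed

text \<open>Second derivatives of the metric commute. Expanding both orders by metric compatibility,
  the products of two Christoffel symbols of mixed type cancel and the rest is the claim.\<close>

lemma curvature_skew_adjoint:
  assumes x: "x \<in> U"
  shows "g x (Rm x u v w) z = - g x w (Rm x u v z)"
proof -
  have "frechet_derivative (\<lambda>y. dg y w z v) (at x) u = frechet_derivative (\<lambda>y. dg y w z u) (at x) v"
    by (rule symmetric_second_derivative[OF open_U g_Ck x])
  then show ?thesis
    unfolding second_derivative_metric[OF x] curvature_def by (simp add: g_simps[OF x])
qed

lemma curvature_skew: "Rm x u v w = - Rm x v u w"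
  by (simp add: curvature_def)

lemma curvature_self: "Rm x v v w = 0"
  by (simp add: curvature_def)

lemma curvature_bianchi:
  assumes x: "x \<in> U"
  shows "Rm x u v w + Rm x v w u + Rm x w u v = 0"
  using dchristoffel_sym[OF x, of u v w] dchristoffel_sym[OF x, of v w u] dchristoffel_sym[OF x, of u w v]
    christoffel_sym[OF x, of u v] christoffel_sym[OF x, of v w] christoffel_sym[OF x, of u w]
  by (simp add: curvature_def)

text \<open>The instance of pair symmetry that is needed: in the Bianchi identity for
  \<open>a\<close>, \<open>v\<close>, \<open>b\<close> paired with \<open>v\<close> one term
  vanishes by skew-adjointness.\<close>

lemma jacobi_operator_self_adjoint:
  assumes x: "x \<in> U"
  shows "g x (Rm x a v v) b = g x (Rm x b v v) a"
proof -
  have "g x (Rm x a v b + Rm x v b a + Rm x b a v) v = 0"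
    by (simp add: curvature_bianchi[OF x] g_simps[OF x])
  moreover have "g x (Rm x b a v) v = 0"
    using curvature_skew_adjoint[OF x, of b a v v] g_sym[OF x, of v "Rm x b a v"] by simp
  ultimately have "g x (Rm x a v b) v = g x (Rm x b v a) v"
    using curvature_skew[of x v b a] by (simp add: g_simps[OF x])
  then show ?thesis
    using curvature_skew_adjoint[OF x, of a v v b] curvature_skew_adjoint[OF x, of b v v a]
      g_sym[OF x, of v] by simp
qed

lemma curvature_linear:
  assumes x: "x \<in> U"
  shows "linear (\<lambda>u. Rm x u v w)" "linear (\<lambda>v. Rm x u v w)" "linear (\<lambda>w. Rm x u v w)"
  unfolding curvature_def
  by (intro linearI;
      simp add: dchristoffel_simps[OF x] christoffel_simps[OF x] scaleR_diff_right scaleR_add_right)+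

lemma curvature_tendsto:
  assumes x: "(X \<longlongrightarrow> x) F" "x \<in> U" "\<forall>\<^sub>F t in F. X t \<in> U"
    and "(a \<longlongrightarrow> u) F" "(b \<longlongrightarrow> v) F" "(e \<longlongrightarrow> w) F"
  shows "((\<lambda>t. Rm (X t) (a t) (b t) (e t)) \<longlongrightarrow> Rm x u v w) F"
proof -
  let ?e = "\<lambda>i. axis i 1 :: real ^ 'n"
  have exp: "Rm x u v w = (\<Sum>i\<in>UNIV. \<Sum>j\<in>UNIV. \<Sum>k\<in>UNIV. u $ i *\<^sub>R v $ j *\<^sub>R w $ k *\<^sub>R Rm x (?e i) (?e j) (?e k))"
    if "x \<in> U" for x u v w
    by (subst linear_expand_axis[OF curvature_linear(1)[OF that]],
        subst linear_expand_axis[OF curvature_linear(2)[OF that]],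
        subst linear_expand_axis[OF curvature_linear(3)[OF that]]) (simp add: scaleR_sum_right)
  have cont: "continuous_on U (\<lambda>y. Rm y u v w)" for u v w
  proof (rule Ck_on_continuous_on[of 0])
    have "Ck_on 0 U (\<lambda>y. d\<Gamma> y u v w)" for u v w
      using christoffel_Ck[of "Suc 0" u v] by simp
    moreover have "Ck_on 0 U (\<lambda>y. \<Gamma> y u (\<Gamma> y v w))" for u v w
    proof -
      have "Ck_on 0 U (\<lambda>y. \<Sum>i\<in>UNIV. \<Gamma> y v w $ i *\<^sub>R \<Gamma> y u (?e i))"
        by (intro Ck_on_sum Ck_on_scaleR open_U christoffel_Ck
            Ck_on_bounded_linear_comp[OF bounded_linear_vec_nth])
      then show ?thesis
        by (subst Ck_on_cong[OF open_U linear_expand_axis[OF christoffel_linear(2)]])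
    qed
    ultimately show "Ck_on 0 U (\<lambda>y. Rm y u v w)"
      unfolding curvature_def by (intro Ck_on_add Ck_on_diff open_U)
  qed
  have "((\<lambda>t. Rm (X t) u v w) \<longlongrightarrow> Rm x u v w) F" for u v w
    using isCont_tendsto_compose[OF _ x(1), of "\<lambda>y. Rm y u v w"] cont open_U x(2)
    by (simp add: continuous_on_eq_continuous_at)
  then have "((\<lambda>t. \<Sum>i\<in>UNIV. \<Sum>j\<in>UNIV. \<Sum>k\<in>UNIV.
      a t $ i *\<^sub>R b t $ j *\<^sub>R e t $ k *\<^sub>R Rm (X t) (?e i) (?e j) (?e k)) \<longlongrightarrow>
      (\<Sum>i\<in>UNIV. \<Sum>j\<in>UNIV. \<Sum>k\<in>UNIV. u $ i *\<^sub>R v $ j *\<^sub>R w $ k *\<^sub>R Rm x (?e i) (?e j) (?e k))) F"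
    using assms by (intro tendsto_intros)
  then show ?thesis
    unfolding exp[OF x(2), symmetric]
    by (rule Lim_transform_eventually) (use x(3) in \<open>eventually_elim, simp only: exp[symmetric]\<close>)
qed

end

section \<open>Geodesics and Jacobi fields in a chart\<close>

lemma has_vector_derivative_scale_arg:
  fixes f :: "real \<Rightarrow> 'a::real_normed_vector"
  assumes "(f has_vector_derivative f') (at (k * t))"
  shows "((\<lambda>t. f (k * t)) has_vector_derivative k *\<^sub>R f') (at t)"
proof -
  have "((\<lambda>t. k * t) has_vector_derivative k) (at t)" by (auto intro!: derivative_eq_intros)
  from vector_diff_chain_at[OF this assms] show ?thesis by (simp add: o_def)
qed

lemma Ck_on_Pair:
  assumes "open S" "Ck_on n S f" "Ck_on n S h"
  shows "Ck_on n S (\<lambda>x. (f x, h x))"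
proof -
  have "bounded_linear (\<lambda>u::'b. (u, 0::'c))" "bounded_linear (\<lambda>u::'c. (0::'b, u))"
    by (auto intro!: bounded_linear_Pair bounded_linear_ident bounded_linear_zero)
  then have "Ck_on n S (\<lambda>x. (f x, 0) + (0, h x))"
    using assms by (intro Ck_on_add Ck_on_bounded_linear_comp[of "\<lambda>u. (u, 0)"]
        Ck_on_bounded_linear_comp[of "\<lambda>u. (0, u)"])
  then show ?thesis by simp
qed

context riem_chart begin

definition geodesic_field :: "(real ^ 'n) \<times> (real ^ 'n) \<Rightarrow> (real ^ 'n) \<times> (real ^ 'n)" where
  "geodesic_field p = (snd p, - \<Gamma> (fst p) (snd p) (snd p))"

lemma open_phase: "open (U \<times> (UNIV :: (real ^ 'n) set))"
  by (intro open_Times open_U open_UNIV)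

lemma geodesic_field_Ck: "Ck_on k (U \<times> UNIV) geodesic_field"
proof -
  let ?e = "\<lambda>i. axis i 1 :: real ^ 'n"
  have "Ck_on k (U \<times> UNIV) (\<lambda>p. \<Sum>i\<in>UNIV. \<Sum>j\<in>UNIV. (snd p $ i * snd p $ j) *\<^sub>R \<Gamma> (fst p) (?e i) (?e j))"
    by (intro Ck_on_sum Ck_on_scaleR Ck_on_mult open_phase
        Ck_on_comp_bounded_linear[OF bounded_linear_fst open_U open_phase _ christoffel_Ck]
        Ck_on_bounded_linear bounded_linear_compose[OF bounded_linear_vec_nth bounded_linear_snd]) auto
  then have 1: "Ck_on k (U \<times> UNIV) (\<lambda>p. \<Gamma> (fst p) (snd p) (snd p))"
    by (subst Ck_on_cong[OF open_phase bilinear_expand_axis[OF christoffel_bilinear]]) auto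
  show ?thesis
    unfolding geodesic_field_def
    by (intro Ck_on_Pair Ck_on_uminus open_phase 1 Ck_on_bounded_linear bounded_linear_snd)
qed

text \<open>This is the variational equation that the flow lemma produces for the attached vectors,
  and hence the raw form of the Jacobi equation.\<close>

lemma geodesic_field_derivative:
  assumes "x \<in> U"
  shows "frechet_derivative geodesic_field (at (x, v)) (j, w) =
    (w, - (d\<Gamma> x v v j + \<Gamma> x w v + \<Gamma> x v w))"
proof -
  have "((\<lambda>p. \<Gamma> (fst p) (snd p) (snd p)) has_derivative
     (\<lambda>h. d\<Gamma> (fst (x, v)) (snd (x, v)) (snd (x, v)) (fst h) + \<Gamma> (fst (x, v)) (snd h) (snd (x, v))
        + \<Gamma> (fst (x, v)) (snd (x, v)) (snd h))) (at (x, v))"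
    by (intro bilinear_field_has_derivative[where B=\<Gamma>, OF open_U christoffel_bilinear
          christoffel_differentiable] bounded_linear_imp_has_derivative bounded_linear_fst
        bounded_linear_snd) (use assms in auto)
  from has_derivative_Pair[OF bounded_linear_imp_has_derivative[OF bounded_linear_snd]
      has_derivative_minus[OF this]]
  have "(geodesic_field has_derivative
      (\<lambda>h. (snd h, - (d\<Gamma> x v v (fst h) + \<Gamma> x (snd h) v + \<Gamma> x v (snd h))))) (at (x, v))"
    by (simp add: geodesic_field_def[abs_def])
  from frechet_derivative_at[OF this, symmetric] show ?thesis by simp
qed

definition geodesic_in_chart :: "real set \<Rightarrow> (real \<Rightarrow> real ^ 'n) \<Rightarrow> (real \<Rightarrow> real ^ 'n) \<Rightarrow> bool" where
  "geodesic_in_chart I x v \<longleftrightarrow> (\<forall>t\<in>I. x t \<in> U \<and> (x has_vector_derivative v t) (at t) \<and>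
     (v has_vector_derivative - \<Gamma> (x t) (v t) (v t)) (at t))"

lemma geodesic_in_chartD:
  assumes "geodesic_in_chart I x v" "t \<in> I"
  shows "x t \<in> U" "(x has_vector_derivative v t) (at t)"
    "(v has_vector_derivative - \<Gamma> (x t) (v t) (v t)) (at t)"
  using assms by (auto simp: geodesic_in_chart_def)

lemma geodesic_in_chart_phase:
  assumes "geodesic_in_chart I x v" "t \<in> I"
  shows "((\<lambda>t. (x t, v t)) has_vector_derivative geodesic_field (x t, v t)) (at t)"
  unfolding geodesic_field_def
  using has_vector_derivative_Pair[OF geodesic_in_chartD(2,3)[OF assms]] by simp

lemma geodesic_field_lipschitz: "locally_lipschitz_on (U \<times> UNIV) geodesic_field"
  by (rule C1_imp_locally_lipschitz_on[OF open_phase geodesic_field_Ck])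

lemma geodesic_in_chart_unique:
  assumes "geodesic_in_chart I x v" "geodesic_in_chart I x' v'" "open I" "connected I" "t0 \<in> I"
    "x t0 = x' t0" "v t0 = v' t0" "t \<in> I"
  shows "x t = x' t" "v t = v' t"
proof -
  have "(x t, v t) = (x' t, v' t)"
    by (rule ode_unique[OF geodesic_field_lipschitz, where J=I and ?t0.0=t0 and z="\<lambda>t. (x t, v t)"
          and w="\<lambda>t. (x' t, v' t)"])
      (use assms geodesic_in_chart_phase geodesic_in_chartD(1) in auto)
  then show "x t = x' t" "v t = v' t" by auto
qed

lemma geodesic_in_chart_rescale:
  assumes "geodesic_in_chart I x v" "\<And>t. t \<in> I' \<Longrightarrow> k * t \<in> I"
  shows "geodesic_in_chart I' (\<lambda>t. x (k * t)) (\<lambda>t. k *\<^sub>R v (k * t))"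
  unfolding geodesic_in_chart_def
proof (intro ballI conjI)
  fix t assume "t \<in> I'"
  note g = geodesic_in_chartD[OF assms(1) assms(2)[OF this]]
  show "x (k * t) \<in> U" by (rule g)
  show "((\<lambda>t. x (k * t)) has_vector_derivative k *\<^sub>R v (k * t)) (at t)"
    by (rule has_vector_derivative_scale_arg[OF g(2)])
  show "((\<lambda>t. k *\<^sub>R v (k * t)) has_vector_derivative
      - \<Gamma> (x (k * t)) (k *\<^sub>R v (k * t)) (k *\<^sub>R v (k * t))) (at t)"
    using bounded_linear.has_vector_derivative[OF bounded_linear_scaleR_right
        has_vector_derivative_scale_arg[OF g(3)], of k]
    by (simp add: christoffel_simps[OF g(1)])
qed

text \<open>Near the constant geodesic at \<open>x0\<close> the flow exists for a short time.
  Rescaling time trades short times for small velocities, so every small \<open>\<xi>\<close> yields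
  a geodesic defined beyond time 1.\<close>

lemma geodesic_flow:
  assumes x0: "x0 \<in> U"
  obtains \<rho> :: real and X V and J W :: "real ^ 'n \<Rightarrow> real \<Rightarrow> real ^ 'n \<Rightarrow> real ^ 'n" where "\<rho> > 0"
    "\<And>\<xi>. norm \<xi> < \<rho> \<Longrightarrow> geodesic_in_chart {-2<..<2} (X \<xi>) (V \<xi>)"
    "\<And>\<xi>. norm \<xi> < \<rho> \<Longrightarrow> X \<xi> 0 = x0" "\<And>\<xi>. norm \<xi> < \<rho> \<Longrightarrow> V \<xi> 0 = \<xi>"
    "\<And>\<xi> \<eta>. norm \<xi> < \<rho> \<Longrightarrow> J \<xi> 0 \<eta> = 0" "\<And>\<xi> \<eta>. norm \<xi> < \<rho> \<Longrightarrow> W \<xi> 0 \<eta> = \<eta>"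
    "\<And>\<xi> t \<eta>. norm \<xi> < \<rho> \<Longrightarrow> t \<in> {-2<..<2} \<Longrightarrow> ((\<lambda>t. J \<xi> t \<eta>) has_vector_derivative W \<xi> t \<eta>) (at t)"
    "\<And>\<xi> t \<eta>. norm \<xi> < \<rho> \<Longrightarrow> t \<in> {-2<..<2} \<Longrightarrow> ((\<lambda>t. W \<xi> t \<eta>) has_vector_derivative
       - (d\<Gamma> (X \<xi> t) (V \<xi> t) (V \<xi> t) (J \<xi> t \<eta>) + \<Gamma> (X \<xi> t) (W \<xi> t \<eta>) (V \<xi> t)
          + \<Gamma> (X \<xi> t) (V \<xi> t) (W \<xi> t \<eta>))) (at t)"
    "\<And>\<xi> t. norm \<xi> < \<rho> \<Longrightarrow> t \<in> {-2<..<2} \<Longrightarrow> ((\<lambda>\<xi>. X \<xi> t) has_derivative J \<xi> t) (at \<xi>)"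
proof -
  obtain \<rho>0 \<tau> :: real and Z and D :: "(real ^ 'n) \<times> (real ^ 'n) \<Rightarrow> real \<Rightarrow> (real ^ 'n) \<times> (real ^ 'n) \<Rightarrow> (real ^ 'n) \<times> (real ^ 'n)"
    where pos: "\<rho>0 > 0" "\<tau> > 0"
    and ZS: "\<And>a t. a \<in> ball (x0, 0) \<rho>0 \<Longrightarrow> t \<in> {-\<tau>..\<tau>} \<Longrightarrow> Z a t \<in> U \<times> UNIV"
    and Z0: "\<And>a. a \<in> ball (x0, 0) \<rho>0 \<Longrightarrow> Z a 0 = a"
    and dZ: "\<And>a t. a \<in> ball (x0, 0) \<rho>0 \<Longrightarrow> t \<in> {-\<tau>..\<tau>} \<Longrightarrow>
       (Z a has_vector_derivative geodesic_field (Z a t)) (at t within {-\<tau>..\<tau>})"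
    and D0: "\<And>a h. a \<in> ball (x0, 0) \<rho>0 \<Longrightarrow> D a 0 h = h"
    and dD: "\<And>a t h. a \<in> ball (x0, 0) \<rho>0 \<Longrightarrow> t \<in> {-\<tau>..\<tau>} \<Longrightarrow> ((\<lambda>t. D a t h) has_vector_derivative
       frechet_derivative geodesic_field (at (Z a t)) (D a t h)) (at t within {-\<tau>..\<tau>})"
    and der: "\<And>a t. a \<in> ball (x0, 0) \<rho>0 \<Longrightarrow> t \<in> {-\<tau>..\<tau>} \<Longrightarrow> ((\<lambda>a. Z a t) has_derivative D a t) (at a)"
    using C1_flow[OF open_phase geodesic_field_Ck, of "(x0, 0)"] x0 by blast
  \<comment> \<open>This factor carries the time interval (-2, 2) into (-\<tau>, \<tau>); the
    initial velocities are divided by it in \<open>a\<close>.\<close>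
  define s where "s = \<tau> / 2"
  define \<rho> where "\<rho> = \<rho>0 * s"
  have s: "s > 0" and \<rho>: "\<rho> > 0" using pos by (auto simp: s_def \<rho>_def)
  define a where "a \<xi> = (x0, \<xi> /\<^sub>R s)" for \<xi> :: "real ^ 'n"
  define X where "X \<xi> t = fst (Z (a \<xi>) (s * t))" for \<xi> t
  define V where "V \<xi> t = s *\<^sub>R snd (Z (a \<xi>) (s * t))" for \<xi> t
  define J where "J \<xi> t \<eta> = fst (D (a \<xi>) (s * t) (0, \<eta> /\<^sub>R s))" for \<xi> t \<eta>
  define W where "W \<xi> t \<eta> = s *\<^sub>R snd (D (a \<xi>) (s * t) (0, \<eta> /\<^sub>R s))" for \<xi> t \<eta>
  have ab: "a \<xi> \<in> ball (x0, 0) \<rho>0" if "norm \<xi> < \<rho>" for \<xi>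
  proof -
    have "dist (x0, 0) (a \<xi>) = norm \<xi> / s"
      using s by (simp add: a_def dist_Pair_Pair divide_inverse mult.commute)
    then show ?thesis using that s by (simp add: \<rho>_def pos_divide_less_eq)
  qed
  have st: "s * t \<in> {-\<tau><..<\<tau>}" if "t \<in> {-2<..<2}" for t
    using that mult_strict_left_mono[of t 2 s] mult_strict_left_mono[of "-2" t s] s by (auto simp: s_def)
  have st': "s * t \<in> {-\<tau>..\<tau>}" if "t \<in> {-2<..<2}" for t using st[OF that] by auto
  have at_eq: "at (s * t) within {-\<tau>..\<tau>} = at (s * t)" if "t \<in> {-2<..<2}" for t
    by (rule at_within_interior) (use st[OF that] in auto)
  have XU: "X \<xi> t \<in> U" if "norm \<xi> < \<rho>" "t \<in> {-2<..<2}" for \<xi> t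
    using ZS[OF ab[OF that(1)] st'[OF that(2)]] by (auto simp: X_def)
  have dZ': "((\<lambda>t. Z (a \<xi>) (s * t)) has_vector_derivative s *\<^sub>R geodesic_field (Z (a \<xi>) (s * t))) (at t)"
    if "norm \<xi> < \<rho>" "t \<in> {-2<..<2}" for \<xi> t
    by (rule has_vector_derivative_scale_arg)
      (use dZ[OF ab[OF that(1)] st'[OF that(2)]] at_eq[OF that(2)] in simp)
  have dD': "((\<lambda>t. D (a \<xi>) (s * t) h) has_vector_derivative
      s *\<^sub>R frechet_derivative geodesic_field (at (Z (a \<xi>) (s * t))) (D (a \<xi>) (s * t) h)) (at t)"
    if "norm \<xi> < \<rho>" "t \<in> {-2<..<2}" for \<xi> t h
    by (rule has_vector_derivative_scale_arg)
      (use dD[OF ab[OF that(1)] st'[OF that(2)]] at_eq[OF that(2)] in simp)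
  show ?thesis
  proof (rule that[OF \<rho>])
    fix \<xi> :: "real ^ 'n" assume \<xi>: "norm \<xi> < \<rho>"
    show "geodesic_in_chart {-2<..<2} (X \<xi>) (V \<xi>)"
      unfolding geodesic_in_chart_def
    proof (intro ballI conjI)
      fix t :: real assume t: "t \<in> {-2<..<2}"
      show XU': "X \<xi> t \<in> U" by (rule XU[OF \<xi> t])
      show "(X \<xi> has_vector_derivative V \<xi> t) (at t)"
        using bounded_linear.has_vector_derivative[OF bounded_linear_fst dZ'[OF \<xi> t]]
        by (simp add: X_def[abs_def] V_def geodesic_field_def)
      show "(V \<xi> has_vector_derivative - \<Gamma> (X \<xi> t) (V \<xi> t) (V \<xi> t)) (at t)"
        using bounded_linear.has_vector_derivative[OF bounded_linear_scaleR_right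
            bounded_linear.has_vector_derivative[OF bounded_linear_snd dZ'[OF \<xi> t]], of s] XU'
        by (simp add: X_def[abs_def] V_def[abs_def] geodesic_field_def christoffel_simps)
    qed
    show "X \<xi> 0 = x0" "V \<xi> 0 = \<xi>" "J \<xi> 0 \<eta> = 0" "W \<xi> 0 \<eta> = \<eta>" for \<eta>
      using Z0[OF ab[OF \<xi>]] D0[OF ab[OF \<xi>]] s by (auto simp: X_def V_def J_def W_def a_def)
    fix t :: real assume t: "t \<in> {-2<..<2}"
    show "((\<lambda>\<xi>. X \<xi> t) has_derivative J \<xi> t) (at \<xi>)"
    proof -
      have "(a has_derivative (\<lambda>\<eta>. (0, \<eta> /\<^sub>R s))) (at \<xi>)"
        unfolding a_def[abs_def] by (auto intro!: derivative_eq_intros)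
      from has_derivative_compose[OF this der[OF ab[OF \<xi>] st'[OF t]]]
      show ?thesis unfolding X_def J_def
        by (rule bounded_linear.has_derivative[OF bounded_linear_fst])
    qed
    fix \<eta>
    let ?D = "D (a \<xi>) (s * t) (0, \<eta> /\<^sub>R s)" and ?Z = "Z (a \<xi>) (s * t)"
    have fd: "frechet_derivative geodesic_field (at ?Z) ?D =
        (snd ?D, - (d\<Gamma> (fst ?Z) (snd ?Z) (snd ?Z) (fst ?D) + \<Gamma> (fst ?Z) (snd ?D) (snd ?Z)
          + \<Gamma> (fst ?Z) (snd ?Z) (snd ?D)))"
      using geodesic_field_derivative[OF XU[OF \<xi> t], of "snd ?Z" "fst ?D" "snd ?D"] by (simp add: X_def)
    show "((\<lambda>t. J \<xi> t \<eta>) has_vector_derivative W \<xi> t \<eta>) (at t)"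
      using bounded_linear.has_vector_derivative[OF bounded_linear_fst dD'[OF \<xi> t], of "(0, \<eta> /\<^sub>R s)"]
      unfolding J_def W_def by (simp add: fd)
    have XU': "fst ?Z \<in> U" using XU[OF \<xi> t] by (simp add: X_def)
    show "((\<lambda>t. W \<xi> t \<eta>) has_vector_derivative
       - (d\<Gamma> (X \<xi> t) (V \<xi> t) (V \<xi> t) (J \<xi> t \<eta>) + \<Gamma> (X \<xi> t) (W \<xi> t \<eta>) (V \<xi> t)
          + \<Gamma> (X \<xi> t) (V \<xi> t) (W \<xi> t \<eta>))) (at t)"
      using bounded_linear.has_vector_derivative[OF bounded_linear_scaleR_right
          bounded_linear.has_vector_derivative[OF bounded_linear_snd dD'[OF \<xi> t]], of s "(0, \<eta> /\<^sub>R s)"]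
      unfolding W_def J_def V_def X_def
      by (simp add: fd christoffel_simps[OF XU'] dchristoffel_simps[OF XU'] algebra_simps)
  qed
qed

text \<open>The Jacobi equation is the variational equation of the geodesic equation, rewritten in terms
  of the covariant derivative \<open>K\<close> of \<open>J\<close>.\<close>

definition jacobi_along ::
  "real set \<Rightarrow> (real \<Rightarrow> real ^ 'n) \<Rightarrow> (real \<Rightarrow> real ^ 'n) \<Rightarrow> (real \<Rightarrow> real ^ 'n) \<Rightarrow> (real \<Rightarrow> real ^ 'n) \<Rightarrow> bool" where
  "jacobi_along I x v J K \<longleftrightarrow> (\<forall>t\<in>I.
     (J has_vector_derivative K t - \<Gamma> (x t) (v t) (J t)) (at t) \<and>
     (K has_vector_derivative - \<Gamma> (x t) (v t) (K t) - Rm (x t) (J t) (v t) (v t)) (at t))"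

text \<open>Passing from \<open>W\<close> to the covariant derivative adds a derivative of
  \<open>\<Gamma>\<close> in the direction \<open>v\<close> to the one in the direction
  \<open>J t\<close>, which has the opposite sign; together with the quadratic terms they form the
  curvature.\<close>

lemma jacobi_along_variation:
  assumes geo: "geodesic_in_chart I x v"
    and J: "\<And>t. t \<in> I \<Longrightarrow> (J has_vector_derivative W t) (at t)"
    and W: "\<And>t. t \<in> I \<Longrightarrow> (W has_vector_derivative
       - (d\<Gamma> (x t) (v t) (v t) (J t) + \<Gamma> (x t) (W t) (v t) + \<Gamma> (x t) (v t) (W t))) (at t)"
  shows "jacobi_along I x v J (\<lambda>t. W t + \<Gamma> (x t) (v t) (J t))"
  unfolding jacobi_along_def
proof (intro ballI conjI)
  fix t assume t: "t \<in> I"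
  note g = geodesic_in_chartD[OF geo t]
  show "(J has_vector_derivative W t + \<Gamma> (x t) (v t) (J t) - \<Gamma> (x t) (v t) (J t)) (at t)"
    using J[OF t] by simp
  have "((\<lambda>t. W t + \<Gamma> (x t) (v t) (J t)) has_vector_derivative
     - (d\<Gamma> (x t) (v t) (v t) (J t) + \<Gamma> (x t) (W t) (v t) + \<Gamma> (x t) (v t) (W t)) +
     (d\<Gamma> (x t) (v t) (J t) (v t) + \<Gamma> (x t) (- \<Gamma> (x t) (v t) (v t)) (J t) + \<Gamma> (x t) (v t) (W t))) (at t)"
    by (intro has_vector_derivative_add W t christoffel_field_vector_derivative g J)
  then show "((\<lambda>t. W t + \<Gamma> (x t) (v t) (J t)) has_vector_derivative
     - \<Gamma> (x t) (v t) (W t + \<Gamma> (x t) (v t) (J t)) - Rm (x t) (J t) (v t) (v t)) (at t)"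
    using christoffel_sym[OF g(1), of "W t" "v t"] christoffel_sym[OF g(1), of "J t" "v t"]
      christoffel_sym[OF g(1), of "\<Gamma> (x t) (v t) (v t)" "J t"] dchristoffel_sym[OF g(1), of "J t" "v t" "v t"]
    by (simp add: curvature_def christoffel_simps[OF g(1)] algebra_simps)
qed

text \<open>Here \<open>X \<xi> 1\<close> is the exponential map in the chart. Geodesics are
  homogeneous in their initial velocity, so along the ray of \<open>\<theta>\<close> it reproduces
  one geodesic, and its derivative is a Jacobi field divided by \<open>t\<close>. As
  \<open>\<theta>\<close> is arbitrary, the interval shrinks with its length.\<close>

lemma exponential_chart:
  assumes x0: "x0 \<in> U"
  obtains \<rho> :: real and X V where "\<rho> > 0"
    "\<And>\<xi>. norm \<xi> < \<rho> \<Longrightarrow> geodesic_in_chart {-2<..<2} (X \<xi>) (V \<xi>)"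
    "\<And>\<xi>. norm \<xi> < \<rho> \<Longrightarrow> X \<xi> 0 = x0" "\<And>\<xi>. norm \<xi> < \<rho> \<Longrightarrow> V \<xi> 0 = \<xi>"
    "\<And>\<theta>. \<exists>s>0. \<exists>x v J K. geodesic_in_chart {-s<..<s} x v \<and> x 0 = x0 \<and> v 0 = \<theta> \<and>
       (\<forall>\<eta>. jacobi_along {-s<..<s} x v (\<lambda>t. J t \<eta>) (\<lambda>t. K t \<eta>) \<and> J 0 \<eta> = 0 \<and> K 0 \<eta> = \<eta>) \<and>
       (\<forall>t\<in>{0<..<s}. norm (t *\<^sub>R \<theta>) < \<rho> \<and> X (t *\<^sub>R \<theta>) 1 = x t \<and>
          ((\<lambda>\<xi>. X \<xi> 1) has_derivative (\<lambda>\<eta>. J t \<eta> /\<^sub>R t)) (at (t *\<^sub>R \<theta>)))"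
proof -
  obtain \<rho> :: real and X V and J W :: "real ^ 'n \<Rightarrow> real \<Rightarrow> real ^ 'n \<Rightarrow> real ^ 'n" where \<rho>: "\<rho> > 0"
    and geo: "\<And>\<xi>. norm \<xi> < \<rho> \<Longrightarrow> geodesic_in_chart {-2<..<2} (X \<xi>) (V \<xi>)"
    and X0: "\<And>\<xi>. norm \<xi> < \<rho> \<Longrightarrow> X \<xi> 0 = x0" and V0: "\<And>\<xi>. norm \<xi> < \<rho> \<Longrightarrow> V \<xi> 0 = \<xi>"
    and J0: "\<And>\<xi> \<eta>. norm \<xi> < \<rho> \<Longrightarrow> J \<xi> 0 \<eta> = 0" and W0: "\<And>\<xi> \<eta>. norm \<xi> < \<rho> \<Longrightarrow> W \<xi> 0 \<eta> = \<eta>"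
    and dJ: "\<And>\<xi> t \<eta>. norm \<xi> < \<rho> \<Longrightarrow> t \<in> {-2<..<2} \<Longrightarrow> ((\<lambda>t. J \<xi> t \<eta>) has_vector_derivative W \<xi> t \<eta>) (at t)"
    and dW: "\<And>\<xi> t \<eta>. norm \<xi> < \<rho> \<Longrightarrow> t \<in> {-2<..<2} \<Longrightarrow> ((\<lambda>t. W \<xi> t \<eta>) has_vector_derivative
       - (d\<Gamma> (X \<xi> t) (V \<xi> t) (V \<xi> t) (J \<xi> t \<eta>) + \<Gamma> (X \<xi> t) (W \<xi> t \<eta>) (V \<xi> t)
          + \<Gamma> (X \<xi> t) (V \<xi> t) (W \<xi> t \<eta>))) (at t)"
    and der: "\<And>\<xi> t. norm \<xi> < \<rho> \<Longrightarrow> t \<in> {-2<..<2} \<Longrightarrow> ((\<lambda>\<xi>. X \<xi> t) has_derivative J \<xi> t) (at \<xi>)"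
    using geodesic_flow[OF x0] by blast
  have scaling: "X (k *\<^sub>R \<xi>) t = X \<xi> (k * t)"
    if \<xi>: "norm \<xi> < \<rho>" and k: "\<bar>k\<bar> \<le> 1" and t: "t \<in> {-2<..<2}" for \<xi> k t
  proof (rule geodesic_in_chart_unique(1)[where I="{-2<..<2}" and ?t0.0=0 and x="X (k *\<^sub>R \<xi>)"
        and v="V (k *\<^sub>R \<xi>)" and x'="\<lambda>t. X \<xi> (k * t)" and v'="\<lambda>t. k *\<^sub>R V \<xi> (k * t)"])
    have k\<xi>: "norm (k *\<^sub>R \<xi>) < \<rho>"
      using mult_right_mono[OF k norm_ge_zero[of \<xi>]] \<xi> by simp
    show "geodesic_in_chart {-2<..<2} (X (k *\<^sub>R \<xi>)) (V (k *\<^sub>R \<xi>))" by (rule geo[OF k\<xi>])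
    have "k * t \<in> {-2<..<2}" if "t \<in> {-2<..<2}" for t
    proof -
      have "\<bar>k * t\<bar> \<le> \<bar>t\<bar>" using mult_right_mono[OF k abs_ge_zero[of t]] by (simp add: abs_mult)
      then show ?thesis using that by auto
    qed
    then show "geodesic_in_chart {-2<..<2} (\<lambda>t. X \<xi> (k * t)) (\<lambda>t. k *\<^sub>R V \<xi> (k * t))"
      by (rule geodesic_in_chart_rescale[OF geo[OF \<xi>]])
    show "X (k *\<^sub>R \<xi>) 0 = X \<xi> (k * 0)" "V (k *\<^sub>R \<xi>) 0 = k *\<^sub>R V \<xi> (k * 0)"
      using X0[OF \<xi>] X0[OF k\<xi>] V0[OF \<xi>] V0[OF k\<xi>] by auto
  qed (use t in auto)
  have "\<exists>s>0. \<exists>x v J K. geodesic_in_chart {-s<..<s} x v \<and> x 0 = x0 \<and> v 0 = \<theta> \<and>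
       (\<forall>\<eta>. jacobi_along {-s<..<s} x v (\<lambda>t. J t \<eta>) (\<lambda>t. K t \<eta>) \<and> J 0 \<eta> = 0 \<and> K 0 \<eta> = \<eta>) \<and>
       (\<forall>t\<in>{0<..<s}. norm (t *\<^sub>R \<theta>) < \<rho> \<and> X (t *\<^sub>R \<theta>) 1 = x t \<and>
          ((\<lambda>\<xi>. X \<xi> 1) has_derivative (\<lambda>\<eta>. J t \<eta> /\<^sub>R t)) (at (t *\<^sub>R \<theta>)))" for \<theta>
  proof -
    define s where "s = \<rho> / (norm \<theta> + 1)"
    have n1: "norm \<theta> + 1 > 0" by (simp add: add_nonneg_pos)
    have s: "s > 0" using \<rho> n1 by (simp add: s_def)
    have s\<theta>: "norm (s *\<^sub>R \<theta>) < \<rho>" using \<rho> n1 by (simp add: s_def field_simps)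
    define k where "k = 1 / s"
    have k: "k > 0" "k * s = 1" using s by (auto simp: k_def)
    have kt: "k * t \<in> {-2<..<2}" if "t \<in> {-s<..<s}" for t
      using that s by (auto simp: k_def field_simps)
    define x where "x t = X (s *\<^sub>R \<theta>) (k * t)" for t
    define v where "v t = k *\<^sub>R V (s *\<^sub>R \<theta>) (k * t)" for t
    \<comment> \<open>The factor compensates the time change by \<open>k\<close>, so that the
      initial derivative is again \<open>\<eta>\<close>.\<close>
    define J' where "J' t \<eta> = s *\<^sub>R J (s *\<^sub>R \<theta>) (k * t) \<eta>" for t \<eta>
    define W' where "W' t \<eta> = W (s *\<^sub>R \<theta>) (k * t) \<eta>" for t \<eta>
    define K where "K t \<eta> = W' t \<eta> + \<Gamma> (x t) (v t) (J' t \<eta>)" for t \<eta>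
    have geo': "geodesic_in_chart {-s<..<s} x v"
      unfolding x_def v_def by (rule geodesic_in_chart_rescale[OF geo[OF s\<theta>] kt])
    have jac: "jacobi_along {-s<..<s} x v (\<lambda>t. J' t \<eta>) (\<lambda>t. K t \<eta>)" for \<eta>
      unfolding K_def
    proof (rule jacobi_along_variation[OF geo'])
      fix t assume t: "t \<in> {-s<..<s}"
      show "((\<lambda>t. J' t \<eta>) has_vector_derivative W' t \<eta>) (at t)"
        using bounded_linear.has_vector_derivative[OF bounded_linear_scaleR_right
            has_vector_derivative_scale_arg[OF dJ[OF s\<theta> kt[OF t]]], of s] k
        unfolding J'_def W'_def by (simp add: mult.commute)
      have xU: "x t \<in> U" using geodesic_in_chartD(1)[OF geo' t] .
      have sk: "s * k = 1" using k by (simp add: mult.commute)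
      have V_eq: "V (s *\<^sub>R \<theta>) (k * t) = s *\<^sub>R v t" "J (s *\<^sub>R \<theta>) (k * t) \<eta> = k *\<^sub>R J' t \<eta>"
        using k sk by (simp_all add: v_def J'_def)
      have "k *\<^sub>R - (d\<Gamma> (x t) (s *\<^sub>R v t) (s *\<^sub>R v t) (k *\<^sub>R J' t \<eta>) + \<Gamma> (x t) (W' t \<eta>) (s *\<^sub>R v t)
          + \<Gamma> (x t) (s *\<^sub>R v t) (W' t \<eta>)) =
        - ((k * s * (s * k)) *\<^sub>R d\<Gamma> (x t) (v t) (v t) (J' t \<eta>) + (k * s) *\<^sub>R \<Gamma> (x t) (W' t \<eta>) (v t)
          + (k * s) *\<^sub>R \<Gamma> (x t) (v t) (W' t \<eta>))"
        by (simp add: dchristoffel_simps[OF xU] christoffel_simps[OF xU] scaleR_add_right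
            scaleR_diff_right mult_ac)
      then show "((\<lambda>t. W' t \<eta>) has_vector_derivative - (d\<Gamma> (x t) (v t) (v t) (J' t \<eta>)
          + \<Gamma> (x t) (W' t \<eta>) (v t) + \<Gamma> (x t) (v t) (W' t \<eta>))) (at t)"
        using has_vector_derivative_scale_arg[OF dW[OF s\<theta> kt[OF t], of \<eta>]]
        unfolding V_eq W'_def[symmetric] x_def[symmetric] by (simp add: k sk)
    qed
    show ?thesis
    proof (rule exI[of _ s], intro conjI s, rule exI[of _ x], rule exI[of _ v], rule exI[of _ J'],
        rule exI[of _ K], intro conjI allI ballI geo' jac)
      show x0: "x 0 = x0" and v0: "v 0 = \<theta>" using X0[OF s\<theta>] V0[OF s\<theta>] k by (auto simp: x_def v_def)
      show J'0: "J' 0 \<eta> = 0" for \<eta> using J0[OF s\<theta>] by (simp add: J'_def)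
      show "K 0 \<eta> = \<eta>" for \<eta>
        using W0[OF s\<theta>, of \<eta>] christoffel_simps(10)[of "x 0" "v 0"] assms x0 by (simp add: K_def W'_def J'0)
      fix t assume t: "t \<in> {0<..<s}"
      have kt1: "\<bar>k * t\<bar> \<le> 1" "k * t > 0" using t s by (auto simp: k_def)
      have kt2: "k * t \<in> {-2<..<2}" using kt t by auto
      have t\<theta>: "t *\<^sub>R \<theta> = (k * t) *\<^sub>R (s *\<^sub>R \<theta>)" using k by (simp add: mult.commute mult.left_commute)
      show "norm (t *\<^sub>R \<theta>) < \<rho>"
        unfolding t\<theta> norm_scaleR[of "k * t"]
        using mult_right_mono[OF kt1(1) norm_ge_zero[of "s *\<^sub>R \<theta>"]] s\<theta> by linarith
      show "X (t *\<^sub>R \<theta>) 1 = x t"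
        unfolding t\<theta> x_def using scaling[OF s\<theta> kt1(1), of 1] by simp
      \<comment> \<open>The flow is differentiated at the fixed vector
        \<open>s *\<^sub>R \<theta>\<close> and time \<open>k * t\<close>; scaling the argument by
        \<open>?l\<close> moves this to the vector \<open>t *\<^sub>R \<theta>\<close> and time
        1.\<close>
      let ?l = "1 / (k * t)"
      have ls: "?l *\<^sub>R (t *\<^sub>R \<theta>) = s *\<^sub>R \<theta>" using t k s by (simp add: k_def)
      have "((\<lambda>\<xi>. ?l *\<^sub>R \<xi>) has_derivative (\<lambda>\<eta>. ?l *\<^sub>R \<eta>)) (at (t *\<^sub>R \<theta>))"
        by (rule bounded_linear_imp_has_derivative[OF bounded_linear_scaleR_right])
      from has_derivative_compose[OF this, of "\<lambda>\<xi>. X \<xi> (k * t)" "J (s *\<^sub>R \<theta>) (k * t)", unfolded ls]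
      have d1: "((\<lambda>\<xi>. X (?l *\<^sub>R \<xi>) (k * t)) has_derivative (\<lambda>\<eta>. J (s *\<^sub>R \<theta>) (k * t) (?l *\<^sub>R \<eta>))) (at (t *\<^sub>R \<theta>))"
        using der[OF s\<theta> kt2] by blast
      have lin: "linear (J (s *\<^sub>R \<theta>) (k * t))" by (rule has_derivative_linear[OF der[OF s\<theta> kt2]])
      have "J (s *\<^sub>R \<theta>) (k * t) (?l *\<^sub>R \<eta>) = J' t \<eta> /\<^sub>R t" for \<eta>
        using linear_scale[OF lin, of ?l \<eta>] s by (simp add: J'_def k_def divide_inverse mult.commute)
      with d1 have d2: "((\<lambda>\<xi>. X (?l *\<^sub>R \<xi>) (k * t)) has_derivative (\<lambda>\<eta>. J' t \<eta> /\<^sub>R t)) (at (t *\<^sub>R \<theta>))"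
        by simp
      show "((\<lambda>\<xi>. X \<xi> 1) has_derivative (\<lambda>\<eta>. J' t \<eta> /\<^sub>R t)) (at (t *\<^sub>R \<theta>))"
      proof (rule has_derivative_transform_within_open[OF d2])
        show "open {\<xi>. norm (?l *\<^sub>R \<xi>) < \<rho>}" by (intro open_Collect_less continuous_intros)
        show "t *\<^sub>R \<theta> \<in> {\<xi>. norm (?l *\<^sub>R \<xi>) < \<rho>}" unfolding mem_Collect_eq ls by (rule s\<theta>)
        show "X (?l *\<^sub>R \<xi>) (k * t) = X \<xi> 1" if "\<xi> \<in> {\<xi>. norm (?l *\<^sub>R \<xi>) < \<rho>}" for \<xi>
        proof -
          have "X ((k * t) *\<^sub>R (?l *\<^sub>R \<xi>)) 1 = X (?l *\<^sub>R \<xi>) (k * t * 1)"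
            by (rule scaling) (use that kt1(1) in auto)
          moreover have "(k * t) *\<^sub>R (?l *\<^sub>R \<xi>) = \<xi>" using k(1) t by simp
          ultimately show ?thesis by simp
        qed
      qed
    qed
  qed
  with \<rho> geo X0 V0 show ?thesis using that by blast
qed

end

section \<open>Change of charts\<close>

lemma frechet_derivative_vec_nth:
  fixes f :: "'a::real_normed_vector \<Rightarrow> real ^ 'n"
  assumes "f differentiable (at x)"
  shows "frechet_derivative (\<lambda>y. f y $ k) (at x) v = frechet_derivative f (at x) v $ k"
proof -
  have "((\<lambda>y. f y $ k) has_derivative (\<lambda>v. frechet_derivative f (at x) v $ k)) (at x)"
    using assms frechet_derivative_works
    by (intro bounded_linear.has_derivative[OF bounded_linear_vec_nth]) blast
  from frechet_derivative_at[OF this] show ?thesis by metis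
qed

lemma symmetric_second_derivative_vec:
  fixes f :: "'a::real_normed_vector \<Rightarrow> real ^ 'n"
  assumes S: "open S" and f: "Ck_on 2 S f" and x: "x \<in> S"
  shows "frechet_derivative (\<lambda>y. frechet_derivative f (at y) u) (at x) v =
         frechet_derivative (\<lambda>y. frechet_derivative f (at y) v) (at x) u"
proof -
  have f1: "f differentiable (at y)" if "y \<in> S" for y using f that by (simp add: numeral_2_eq_2)
  have f2: "(\<lambda>y. frechet_derivative f (at y) w) differentiable (at x)" for w
    using f x by (simp add: numeral_2_eq_2)
  have "frechet_derivative (\<lambda>y. frechet_derivative f (at y) w) (at x) z $ k =
      frechet_derivative (\<lambda>y. frechet_derivative (\<lambda>y. f y $ k) (at y) w) (at x) z" for w z k
  proof -
    have "frechet_derivative (\<lambda>y. frechet_derivative f (at y) w) (at x) z $ k =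
        frechet_derivative (\<lambda>y. frechet_derivative f (at y) w $ k) (at x) z"
      by (rule frechet_derivative_vec_nth[OF f2, symmetric])
    also have "frechet_derivative (\<lambda>y. frechet_derivative f (at y) w $ k) (at x) =
        frechet_derivative (\<lambda>y. frechet_derivative (\<lambda>y. f y $ k) (at y) w) (at x)"
      by (rule frechet_derivative_cong_open[OF S x]) (simp add: frechet_derivative_vec_nth[OF f1])
    finally show ?thesis .
  qed
  then show ?thesis
    using symmetric_second_derivative[OF S Ck_on_bounded_linear_comp[OF bounded_linear_vec_nth S f] x]
    by (simp add: vec_eq_iff)
qed

context riem_chart begin

lemma manifold: "smooth_manifold M"
  using riemannian by (simp add: riemannian_manifold_def)

lemma chart_props:
  shows "openin (top_of M) (dom_of c)" "dom_of c \<subseteq> points M"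
    "homeomorphic_map (subtopology (top_of M) (dom_of c)) (top_of_set U) (coord c)"
    "topspace (subtopology (top_of M) (dom_of c)) = dom_of c"
    "inj_on (coord c) (dom_of c)"
proof -
  have ch: "is_chart (top_of M) c" using manifold chart by (auto simp: smooth_manifold_def)
  then show 1: "openin (top_of M) (dom_of c)"
    and 2: "homeomorphic_map (subtopology (top_of M) (dom_of c)) (top_of_set U) (coord c)"
    by (auto simp: is_chart_def U_def)
  show 3: "dom_of c \<subseteq> points M" using openin_subset[OF 1] .
  then show 4: "topspace (subtopology (top_of M) (dom_of c)) = dom_of c" by (simp add: Int_absorb1)
  show "inj_on (coord c) (dom_of c)" using homeomorphic_imp_injective_map[OF 2] 4 by simp
qed

definition point_at :: "real ^ 'n \<Rightarrow> 'a" where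
  "point_at = inv_into (dom_of c) (coord c)"

lemma point_at: "p \<in> dom_of c \<Longrightarrow> point_at (coord c p) = p"
  "x \<in> U \<Longrightarrow> coord c (point_at x) = x" "x \<in> U \<Longrightarrow> point_at x \<in> dom_of c"
  unfolding point_at_def U_def
  by (auto simp: inv_into_f_f[OF chart_props(5)] f_inv_into_f inv_into_into)

lemma point_at_continuous: "continuous_map (top_of_set U) (top_of M) point_at"
proof -
  obtain h where h: "homeomorphic_maps (subtopology (top_of M) (dom_of c)) (top_of_set U) (coord c) h"
    using chart_props(3) homeomorphic_map_maps by blast
  have "continuous_map (top_of_set U) (top_of M) h"
    using h by (auto simp: homeomorphic_maps_def continuous_map_in_subtopology)
  moreover have "h x = point_at x" if "x \<in> U" for x
  proof -
    have "h x \<in> dom_of c" "coord c (h x) = x"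
      using h that chart_props(4) unfolding homeomorphic_maps_def continuous_map_def
      by (auto simp: Pi_iff)
    then show ?thesis using point_at(1) by metis
  qed
  ultimately show ?thesis by (rule continuous_map_eq) simp
qed

lemma coord_continuous_open:
  assumes \<gamma>: "continuous_map (top_of_set I) (top_of M) \<gamma>" and I: "open I" and T: "T \<in> I" "\<gamma> T \<in> dom_of c"
  obtains N where "open N" "T \<in> N" "N \<subseteq> I" "\<And>t. t \<in> N \<Longrightarrow> \<gamma> t \<in> dom_of c"
proof -
  have "openin (top_of_set I) {t \<in> topspace (top_of_set I). \<gamma> t \<in> dom_of c}"
    by (rule openin_continuous_map_preimage[OF \<gamma> chart_props(1)])
  then have "openin (top_of_set I) {t \<in> I. \<gamma> t \<in> dom_of c}" by simp
  from openin_open_trans[OF this I] show ?thesis by (rule that) (use T in auto)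
qed

end

section \<open>Transformation laws between two charts\<close>

locale riem_chart_pair = riem_chart M c + c': riem_chart M c'
  for M :: "('a, 'n::finite) rspace" and c c' :: "('a, 'n) chart"
begin

abbreviation "\<phi> \<equiv> transition c c'"
abbreviation "D\<phi> x \<equiv> frechet_derivative \<phi> (at x)"
definition V where "V = coord c ` (dom_of c \<inter> dom_of c')"

lemma V_subset: "V \<subseteq> U" by (auto simp: V_def U_def)

lemma open_V: "open V"
proof -
  have "openin (subtopology (top_of M) (dom_of c)) (dom_of c \<inter> dom_of c')"
    by (metis c'.chart_props(1) inf_commute openin_subtopology_Int)
  then have "openin (top_of_set U) V"
    unfolding V_def using homeomorphic_imp_open_map[OF chart_props(3)] by (auto simp: open_map_def)
  then show ?thesis using open_U openin_open_trans by blast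
qed

lemma transition_coord: "p \<in> dom_of c \<Longrightarrow> \<phi> (coord c p) = coord c' p"
  using point_at(1) by (simp add: transition_def point_at_def)

lemma transition_mem: "x \<in> V \<Longrightarrow> \<phi> x \<in> c'.U"
  by (auto simp: V_def transition_coord c'.U_def)

lemma transition_Ck: "Ck_on k V \<phi>"
  using manifold chart c'.chart by (auto simp: smooth_manifold_def smooth_on_def V_def)

lemma transition_has_derivative: "x \<in> V \<Longrightarrow> (\<phi> has_derivative D\<phi> x) (at x)"
  using transition_Ck[of "Suc 0"] by (rule Ck_on_has_derivative)

lemma transition_linear: "x \<in> V \<Longrightarrow> linear (D\<phi> x)"
  using transition_has_derivative has_derivative_linear by blast

lemma metric_transition:
  assumes "x \<in> V"
  shows "g x u v = c'.g (\<phi> x) (D\<phi> x u) (D\<phi> x v)"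
proof -
  obtain p where p: "x = coord c p" "p \<in> dom_of c \<inter> dom_of c'" using assms by (auto simp: V_def)
  have "g (coord c p) u v = c'.g (coord c' p) (D\<phi> (coord c p) u) (D\<phi> (coord c p) v)"
    using riemannian chart c'.chart p(2) unfolding riemannian_manifold_def by blast
  then show ?thesis using p transition_coord by simp
qed

text \<open>A vector in the kernel would have length 0 because the transition carries one metric to
  the other; injectivity gives surjectivity by dimension.\<close>

lemma transition_derivative_surj: assumes x: "x \<in> V" shows "surj (D\<phi> x)"
proof (rule linear_injective_imp_surjective[OF transition_linear[OF x]])
  show "inj (D\<phi> x)"
  proof (subst linear_injective_0[OF transition_linear[OF x]], intro allI impI)
    fix u assume "D\<phi> x u = 0"
    then have "g x u u = 0" using metric_transition[OF x, of u u] c'.g_simps(9)[OF transition_mem[OF x]] by simp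
    then show "u = 0" using g_pos[of x u] x V_subset by auto
  qed
qed simp

abbreviation "D2\<phi> x u v \<equiv> frechet_derivative (\<lambda>y. D\<phi> y v) (at x) u"

lemma transition_derivative_differentiable:
  "x \<in> V \<Longrightarrow> (\<lambda>y. D\<phi> y v) differentiable (at x)"
  using transition_Ck[of "Suc (Suc 0)"] by simp

lemma transition_second_derivative_sym: "x \<in> V \<Longrightarrow> D2\<phi> x u v = D2\<phi> x v u"
  using symmetric_second_derivative_vec[OF open_V transition_Ck] by blast

lemma dg_transition:
  assumes x: "x \<in> V"
  shows "dg x u v w = c'.dg (\<phi> x) (D\<phi> x u) (D\<phi> x v) (D\<phi> x w)
    + c'.g (\<phi> x) (D2\<phi> x w u) (D\<phi> x v) + c'.g (\<phi> x) (D\<phi> x u) (D2\<phi> x w v)"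
proof -
  have "frechet_derivative (\<lambda>y. g y u v) (at x) =
      frechet_derivative (\<lambda>y. c'.g (\<phi> y) (D\<phi> y u) (D\<phi> y v)) (at x)"
    by (rule frechet_derivative_cong_open[OF open_V x]) (rule metric_transition)
  also have "\<dots> = (\<lambda>w. c'.dg (\<phi> x) (D\<phi> x u) (D\<phi> x v) (D\<phi> x w)
    + c'.g (\<phi> x) (D2\<phi> x w u) (D\<phi> x v) + c'.g (\<phi> x) (D\<phi> x u) (D2\<phi> x w v))"
    by (rule frechet_derivative_at[symmetric])
      (intro c'.g_field_derivative transition_has_derivative x transition_mem
        transition_derivative_differentiable[THEN iffD1[OF frechet_derivative_works]])
  finally show ?thesis by simp
qed

text \<open>Of the six second derivative terms in the transported Koszul formula four cancel by
  symmetry and two form the inhomogeneous term. Surjectivity of the derivative allows every test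
  vector to be written as an image.\<close>

lemma christoffel_transition:
  assumes x: "x \<in> V"
  shows "D\<phi> x (\<Gamma> x u v) = c'.\<Gamma> (\<phi> x) (D\<phi> x u) (D\<phi> x v) + D2\<phi> x u v"
proof (rule c'.g_eqI[OF transition_mem[OF x]])
  fix z'
  obtain z where z: "z' = D\<phi> x z" using transition_derivative_surj[OF x] by blast
  note x' = transition_mem[OF x]
  have xU: "x \<in> U" using x V_subset by auto
  have "2 * g x (\<Gamma> x u v) z = 2 * (c'.g (\<phi> x) (c'.\<Gamma> (\<phi> x) (D\<phi> x u) (D\<phi> x v)) (D\<phi> x z)
      + c'.g (\<phi> x) (D2\<phi> x u v) (D\<phi> x z))"
    unfolding christoffel_eq[OF xU] dg_transition[OF x] distrib_left c'.christoffel_eq[OF x']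
    using transition_second_derivative_sym[OF x, of u v] transition_second_derivative_sym[OF x, of u z]
      transition_second_derivative_sym[OF x, of v z]
      c'.g_sym[OF x', of "D\<phi> x v" "D2\<phi> x u z"] c'.g_sym[OF x', of "D\<phi> x u" "D2\<phi> x v z"]
    by simp
  then show "c'.g (\<phi> x) (D\<phi> x (\<Gamma> x u v)) z' =
      c'.g (\<phi> x) (c'.\<Gamma> (\<phi> x) (D\<phi> x u) (D\<phi> x v) + D2\<phi> x u v) z'"
    using metric_transition[OF x, of "\<Gamma> x u v" z] by (simp add: z c'.g_simps[OF x'])
qed

lemma geodesic_transition:
  assumes geo: "geodesic_in_chart I x v" and t: "t \<in> I" "x t \<in> V"
  shows "((\<lambda>t. \<phi> (x t)) has_vector_derivative D\<phi> (x t) (v t)) (at t)"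
    "((\<lambda>t. D\<phi> (x t) (v t)) has_vector_derivative
       - c'.\<Gamma> (\<phi> (x t)) (D\<phi> (x t) (v t)) (D\<phi> (x t) (v t))) (at t)"
proof -
  note g = geodesic_in_chartD[OF geo t(1)]
  show "((\<lambda>t. \<phi> (x t)) has_vector_derivative D\<phi> (x t) (v t)) (at t)"
    unfolding has_vector_derivative_def
    by (rule has_derivative_eq_rhs[OF has_derivative_compose[OF g(2)[unfolded has_vector_derivative_def]
        transition_has_derivative[OF t(2)]]])
      (simp add: linear_scale[OF transition_linear[OF t(2)]])
  \<comment> \<open>A one-dimensional second slot turns the linear family \<open>D\<phi> y\<close>
    into an instance of the bilinear product rule.\<close>
  have B: "((\<lambda>t. (1::real^1) $ 1 *\<^sub>R D\<phi> (x t) (v t)) has_vector_derivative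
     frechet_derivative (\<lambda>y. (1::real^1) $ 1 *\<^sub>R D\<phi> y (v t)) (at (x t)) (v t)
        + (1::real^1) $ 1 *\<^sub>R D\<phi> (x t) (- \<Gamma> (x t) (v t) (v t)) + (0::real^1) $ 1 *\<^sub>R D\<phi> (x t) (v t)) (at t)"
  proof (rule bilinear_field_has_vector_derivative[where B="\<lambda>y u (r::real^1). r $ 1 *\<^sub>R D\<phi> y u",
        OF open_V _ _ g(2) t(2) g(3) has_vector_derivative_const])
    show "bilinear (\<lambda>u (r::real^1). r $ 1 *\<^sub>R D\<phi> y u)" if "y \<in> V" for y
      unfolding bilinear_def
      using transition_linear[OF that]
      by (auto intro!: linearI simp: linear_add linear_scale scaleR_add_left scaleR_add_right)
    show "(\<lambda>y. (r::real^1) $ 1 *\<^sub>R D\<phi> y u) differentiable (at y)" if "y \<in> V" for y u r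
      using transition_derivative_differentiable[OF that]
      by (intro differentiable_scaleR differentiable_const)
  qed
  have "D2\<phi> (x t) (v t) (v t) - D\<phi> (x t) (\<Gamma> (x t) (v t) (v t)) =
      - c'.\<Gamma> (\<phi> (x t)) (D\<phi> (x t) (v t)) (D\<phi> (x t) (v t))"
    unfolding christoffel_transition[OF t(2)] by simp
  with B show "((\<lambda>t. D\<phi> (x t) (v t)) has_vector_derivative
       - c'.\<Gamma> (\<phi> (x t)) (D\<phi> (x t) (v t)) (D\<phi> (x t) (v t))) (at t)"
    by (simp add: linear_neg[OF transition_linear[OF t(2)]])
qed

end

lemma transition_derivative_inverse:
  assumes "riem_chart M c" "riem_chart M c'" "p \<in> dom_of c" "p \<in> dom_of c'"
  shows "frechet_derivative (transition c' c) (at (coord c' p))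
    (frechet_derivative (transition c c') (at (coord c p)) u) = u"
proof -
  interpret a: riem_chart_pair M c c' using assms by (simp add: riem_chart_pair_def)
  interpret b: riem_chart_pair M c' c using assms by (simp add: riem_chart_pair_def)
  have pV: "coord c p \<in> a.V" "coord c' p \<in> b.V" using assms by (auto simp: a.V_def b.V_def)
  have "((\<lambda>x. transition c' c (transition c c' x)) has_derivative
      (\<lambda>u. b.D\<phi> (coord c' p) (a.D\<phi> (coord c p) u))) (at (coord c p))"
    using has_derivative_compose[OF a.transition_has_derivative[OF pV(1)]]
      b.transition_has_derivative[OF pV(2)] a.transition_coord[OF assms(3)] by simp
  moreover have "((\<lambda>x. transition c' c (transition c c' x)) has_derivative (\<lambda>u. u)) (at (coord c p))"
    by (rule has_derivative_transform_within_open[OF has_derivative_ident a.open_V pV(1)])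
      (auto simp: a.V_def a.transition_coord b.transition_coord)
  ultimately show ?thesis using has_derivative_unique by metis
qed

section \<open>The exponential map and the density in a chart\<close>

context riem_chart begin

lemma other_chart: "c' \<in> atlas M \<Longrightarrow> riem_chart_pair M c c'"
  by (simp add: riem_chart_pair_def riem_chart_def riemannian chart)

text \<open>\<open>geodesic_on\<close> asks for a velocity in every chart of the atlas; the
  derivative of the transition supplies it from \<open>v\<close>.\<close>

lemma geodesic_on_of_chart:
  assumes geo: "geodesic_in_chart I x v" and I: "open I" "is_interval I"
  shows "geodesic_on M I (\<lambda>t. point_at (x t))"
  unfolding geodesic_on_def
proof (intro conjI I ballI)
  have x: "continuous_on I x"
    using geodesic_in_chartD(2)[OF geo]
    by (intro continuous_at_imp_continuous_on ballI) (rule has_vector_derivative_continuous)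
  have xU: "x t \<in> U" if "t \<in> I" for t using geodesic_in_chartD(1)[OF geo that] .
  have "continuous_map (top_of_set I) (top_of_set U) x"
    using x xU by (auto simp: continuous_map_in_subtopology)
  from continuous_map_compose[OF this point_at_continuous]
  show "continuous_map (top_of_set I) (top_of M) (\<lambda>t. point_at (x t))" by (simp add: o_def)
  fix c' assume "c' \<in> atlas M"
  then interpret a: riem_chart_pair M c c' by (rule other_chart)
  show "\<exists>v. \<forall>s\<in>I. point_at (x s) \<in> dom_of c' \<longrightarrow>
        ((\<lambda>t. coord c' (point_at (x t))) has_vector_derivative v s) (at s) \<and>
        (v has_vector_derivative - christoffel M c' (coord c' (point_at (x s))) (v s) (v s)) (at s)"
  proof (intro exI[of _ "\<lambda>s. a.D\<phi> (x s) (v s)"] ballI impI)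
    fix s assume s: "s \<in> I" "point_at (x s) \<in> dom_of c'"
    have \<phi>: "coord c' (point_at (x t)) = a.\<phi> (x t)" if "t \<in> I" for t
      using a.transition_coord[OF point_at(3)[OF xU[OF that]]] point_at(2)[OF xU[OF that]] by simp
    have xV: "x s \<in> a.V"
      unfolding a.V_def using s point_at(2,3)[OF xU[OF s(1)]] by (metis IntI image_eqI)
    show "((\<lambda>t. coord c' (point_at (x t))) has_vector_derivative a.D\<phi> (x s) (v s)) (at s) \<and>
        ((\<lambda>s. a.D\<phi> (x s) (v s)) has_vector_derivative
          - christoffel M c' (coord c' (point_at (x s))) (a.D\<phi> (x s) (v s)) (a.D\<phi> (x s) (v s))) (at s)"
      unfolding \<phi>[OF s(1)]
      using has_vector_derivative_transform_within_open[OF a.geodesic_transition(1)[OF geo s(1) xV] I(1) s(1)]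
        a.geodesic_transition(2)[OF geo s(1) xV] \<phi> by auto
  qed
qed

text \<open>Only the first geodesic is known to stay in the chart, so uniqueness in the chart does
  not apply on all of [0, 1]. Connectedness replaces it: openness comes from local uniqueness,
  closedness from the Hausdorff property.\<close>

lemma geodesic_on_agree:
  assumes \<gamma>: "geodesic_on M I \<gamma>" and \<gamma>': "geodesic_on M I' \<gamma>'"
    and I: "{0..1} \<subseteq> I" "{0..1} \<subseteq> I'" and dom: "\<And>t. t \<in> {0..1} \<Longrightarrow> \<gamma> t \<in> dom_of c"
    and init: "\<gamma> 0 = \<gamma>' 0" "((\<lambda>t. coord c (\<gamma> t)) has_vector_derivative w) (at 0)"
      "((\<lambda>t. coord c (\<gamma>' t)) has_vector_derivative w) (at 0)"
  shows "\<gamma> 1 = \<gamma>' 1"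
proof -
  have oI: "open I" "open I'" and cont: "continuous_map (top_of_set I) (top_of M) \<gamma>"
    "continuous_map (top_of_set I') (top_of M) \<gamma>'"
    using \<gamma> \<gamma>' by (auto simp: geodesic_on_def)
  obtain v where v: "\<And>s. s \<in> I \<Longrightarrow> \<gamma> s \<in> dom_of c \<Longrightarrow> ((\<lambda>t. coord c (\<gamma> t)) has_vector_derivative v s) (at s) \<and>
        (v has_vector_derivative - \<Gamma> (coord c (\<gamma> s)) (v s) (v s)) (at s)"
    using \<gamma> chart unfolding geodesic_on_def by blast
  obtain v' where v': "\<And>s. s \<in> I' \<Longrightarrow> \<gamma>' s \<in> dom_of c \<Longrightarrow> ((\<lambda>t. coord c (\<gamma>' t)) has_vector_derivative v' s) (at s) \<and>
        (v' has_vector_derivative - \<Gamma> (coord c (\<gamma>' s)) (v' s) (v' s)) (at s)"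
    using \<gamma>' chart unfolding geodesic_on_def by blast
  \<comment> \<open>Closedness needs two stages: positions can be compared anywhere, velocities only
    where both curves lie in the chart, and this is guaranteed on \<open>?A\<close>.\<close>
  let ?A = "{t \<in> {0..1}. \<gamma> t = \<gamma>' t}"
  let ?E = "{t \<in> ?A. v t = v' t}"
  have d0: "\<gamma> 0 \<in> dom_of c" "\<gamma>' 0 \<in> dom_of c" using dom[of 0] init(1) by auto
  have "0 \<in> ?E"
  proof -
    have 0: "0 \<in> I" "0 \<in> I'" using I by auto
    have "v 0 = w" using vector_derivative_unique_at[OF conjunct1[OF v[OF 0(1) d0(1)]] init(2)] .
    moreover have "v' 0 = w" using vector_derivative_unique_at[OF conjunct1[OF v'[OF 0(2) d0(2)]] init(3)] .
    ultimately show ?thesis using init(1) by simp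
  qed
  moreover have "openin (top_of_set {0..1}) ?E"
  proof (subst openin_contains_ball, intro conjI ballI)
    fix T assume T: "T \<in> ?E"
    then have T1: "T \<in> I" "T \<in> I'" "\<gamma> T \<in> dom_of c" "\<gamma>' T \<in> dom_of c"
      using I dom[of T] by auto
    obtain N where N: "open N" "T \<in> N" "N \<subseteq> I" "\<And>t. t \<in> N \<Longrightarrow> \<gamma> t \<in> dom_of c"
      using coord_continuous_open[OF cont(1) oI(1) T1(1,3)] by blast
    obtain N' where N': "open N'" "T \<in> N'" "N' \<subseteq> I'" "\<And>t. t \<in> N' \<Longrightarrow> \<gamma>' t \<in> dom_of c"
      using coord_continuous_open[OF cont(2) oI(2) T1(2,4)] by blast
    have g1: "geodesic_in_chart (N \<inter> N') (\<lambda>t. coord c (\<gamma> t)) v"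
      unfolding geodesic_in_chart_def using N v by (auto simp: U_def)
    have g2: "geodesic_in_chart (N \<inter> N') (\<lambda>t. coord c (\<gamma>' t)) v'"
      unfolding geodesic_in_chart_def using N' v' by (auto simp: U_def)
    obtain \<eta> where \<eta>: "\<eta> > 0"
      "\<And>t. \<bar>t - T\<bar> \<le> \<eta> \<Longrightarrow> t \<in> N \<inter> N' \<and> (coord c (\<gamma> t), v t) = (coord c (\<gamma>' t), v' t)"
    proof (rule ode_unique_near[OF geodesic_field_lipschitz, where z="\<lambda>t. (coord c (\<gamma> t), v t)"
          and w="\<lambda>t. (coord c (\<gamma>' t), v' t)" and T=T and J="N \<inter> N'"])
      show "(coord c (\<gamma> T), v T) \<in> U \<times> UNIV" using T1 by (auto simp: U_def)
      show "(coord c (\<gamma> T), v T) = (coord c (\<gamma>' T), v' T)" using T by auto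
      show "open (N \<inter> N')" "T \<in> N \<inter> N'" using N N' by auto
    qed (use geodesic_in_chart_phase[OF g1] geodesic_in_chart_phase[OF g2] in blast)+
    have "ball T \<eta> \<inter> {0..1} \<subseteq> ?E"
    proof
      fix t assume t: "t \<in> ball T \<eta> \<inter> {0..1}"
      then have "\<bar>t - T\<bar> \<le> \<eta>" by (auto simp: dist_norm)
      from \<eta>(2)[OF this] have "coord c (\<gamma> t) = coord c (\<gamma>' t)" "v t = v' t" "\<gamma> t \<in> dom_of c" "\<gamma>' t \<in> dom_of c"
        using N(4) N'(4) by auto
      then show "t \<in> ?E" using t inj_onD[OF chart_props(5)] by auto
    qed
    with \<eta>(1) show "\<exists>e>0. ball T e \<inter> {0..1} \<subseteq> ?E" by blast
  qed auto
  moreover have "closedin (top_of_set {0..1}) ?E"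
  proof (rule closedin_trans)
    have "Hausdorff_space (top_of M)" using manifold by (simp add: smooth_manifold_def)
    moreover have "continuous_map (top_of_set {0..1}) (top_of M) \<gamma>" "continuous_map (top_of_set {0..1}) (top_of M) \<gamma>'"
      using cont I by (auto intro: continuous_map_from_subtopology_mono)
    ultimately show "closedin (top_of_set {0..1}) ?A"
      using closedin_continuous_maps_eq[of "top_of M" "top_of_set {0..1}" \<gamma> \<gamma>'] by simp
    have "continuous_on ?A v"
    proof (intro continuous_at_imp_continuous_on ballI)
      fix t assume t: "t \<in> ?A"
      then have "\<gamma> t \<in> dom_of c" "t \<in> I" using dom[of t] I by auto
      then show "isCont v t" using v has_vector_derivative_continuous by blast
    qed
    moreover have "continuous_on ?A v'"
    proof (intro continuous_at_imp_continuous_on ballI)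
      fix t assume t: "t \<in> ?A"
      then have "\<gamma>' t \<in> dom_of c" "t \<in> I'" using dom[of t] I by auto
      then show "isCont v' t" using v' has_vector_derivative_continuous by blast
    qed
    ultimately have "closedin (top_of_set ?A) (?A \<inter> (\<lambda>t. v t - v' t) -` {0})"
      by (intro continuous_closedin_preimage continuous_intros) auto
    moreover have "?A \<inter> (\<lambda>t. v t - v' t) -` {0} = ?E" by auto
    ultimately show "closedin (top_of_set ?A) ?E" by simp
  qed
  ultimately have "?E = {0..1}"
    using connected_clopen[of "{0..1::real}"] connected_Icc by blast
  then have "1 \<in> ?E" by simp
  then show ?thesis by simp
qed

lemma chart_at: "P \<in> points M \<Longrightarrow> chart_at M P \<in> atlas M \<and> P \<in> dom_of (chart_at M P)"
proof -
  assume "P \<in> points M"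
  moreover have "(\<Union>c\<in>atlas M. dom_of c) = points M" using manifold by (simp add: smooth_manifold_def)
  ultimately have "\<exists>c. c \<in> atlas M \<and> P \<in> dom_of c" by blast
  then show ?thesis unfolding chart_at_def by (rule someI_ex)
qed

end

section \<open>Orthonormal bases, Gram determinants and the density in a chart\<close>

context riem_chart begin

text \<open>Gram-Schmidt, one index at a time; a dimension count supplies a vector outside the span
  of those already chosen.\<close>

lemma orthonormal_basis_exists:
  assumes x: "x \<in> U"
  shows "\<exists>f::'n \<Rightarrow> real ^ 'n. \<forall>i j. g x (f i) (f j) = (if i = j then 1 else 0)"
proof -
  have "\<exists>f::'n \<Rightarrow> real ^ 'n. \<forall>i\<in>S. \<forall>j\<in>S. g x (f i) (f j) = (if i = j then 1 else 0)" for S :: "'n set"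
  proof (induction S rule: finite_induct[OF finite])
    case (2 k S)
    then obtain f :: "'n \<Rightarrow> real ^ 'n"
      where f: "\<And>i j. i \<in> S \<Longrightarrow> j \<in> S \<Longrightarrow> g x (f i) (f j) = (if i = j then 1 else 0)" by blast
    have "card S < CARD('n)" using 2(2) by (intro psubset_card_mono) auto
    moreover have "dim (span (f ` S)) \<le> card S"
      using dim_le_card'[of "f ` S"] card_image_le[of S f] by (simp add: dim_span)
    ultimately have "span (f ` S) \<noteq> UNIV" by (metis DIM_cart DIM_real dim_UNIV mult.right_neutral not_le)
    then obtain w where w: "w \<notin> span (f ` S)" by blast
    define u where "u = w - (\<Sum>i\<in>S. g x w (f i) *\<^sub>R f i)"
    have sp: "(\<Sum>i\<in>S. g x w (f i) *\<^sub>R f i) \<in> span (f ` S)"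
      by (intro span_sum span_scale span_base) auto
    have "u \<noteq> 0" using w sp by (auto simp: u_def)
    then have upos: "g x u u > 0" by (rule g_pos[OF x])
    have uf: "g x u (f j) = 0" if "j \<in> S" for j
    proof -
      have "g x u (f j) = g x w (f j) - (\<Sum>i\<in>S. g x w (f i) * g x (f i) (f j))"
        unfolding u_def
        by (simp add: g_simps[OF x] linear_sum[OF g_linear(1)[OF x]])
      also have "(\<Sum>i\<in>S. g x w (f i) * g x (f i) (f j)) = (\<Sum>i\<in>S. if i = j then g x w (f i) else 0)"
        using that by (intro sum.cong) (auto simp: f)
      also have "\<dots> = g x w (f j)" using that by simp
      finally show ?thesis by simp
    qed
    let ?r = "1 / sqrt (g x u u)"
    have rr: "?r * (?r * g x u u) = 1" using upos by (simp add: field_simps)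
    show ?case
    proof (intro exI[of _ "f(k := ?r *\<^sub>R u)"] ballI)
      fix i j assume ij: "i \<in> insert k S" "j \<in> insert k S"
      have fu: "g x (f i) u = 0" if "i \<in> S" for i using uf[OF that] g_sym[OF x] by metis
      show "g x ((f(k := ?r *\<^sub>R u)) i) ((f(k := ?r *\<^sub>R u)) j) = (if i = j then 1 else 0)"
        using ij 2(2) f uf fu rr by (auto simp: g_simps[OF x])
    qed
  qed simp
  from this[of UNIV] show ?thesis by simp
qed

lemma orthonormal_expansion:
  fixes f :: "'n \<Rightarrow> real ^ 'n"
  assumes x: "x \<in> U" and f: "\<And>i j. g x (f i) (f j) = (if i = j then 1 else 0)"
  shows "w = (\<Sum>k\<in>UNIV. g x w (f k) *\<^sub>R f k)"
proof -
  define E where "E u = (\<Sum>k\<in>UNIV. u $ k *\<^sub>R f k)" for u :: "real ^ 'n"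
  have E: "linear E" unfolding E_def
    by (rule linearI) (simp_all add: scaleR_add_left sum.distrib scaleR_sum_right)
  have gE: "g x (E u) (f k) = u $ k" for u k
    unfolding E_def by (simp add: linear_sum[OF g_linear(1)[OF x]] g_simps[OF x] f if_distrib cong: if_cong)
  have "inj E"
  proof (subst linear_injective_0[OF E], intro allI impI)
    fix u assume "E u = 0"
    then have "u $ k = 0" for k using gE[of u k] g_simps(9)[OF x] by simp
    then show "u = 0" by (simp add: vec_eq_iff)
  qed
  then have "surj E" using linear_injective_imp_surjective[OF E] by blast
  then obtain u where "w = E u" by blast
  then show ?thesis using gE[of u] by (simp add: E_def)
qed

lemma parseval:
  fixes f :: "'n \<Rightarrow> real ^ 'n"
  assumes x: "x \<in> U" and f: "\<And>i j. g x (f i) (f j) = (if i = j then 1 else 0)"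
  shows "g x u v = (\<Sum>k\<in>UNIV. g x u (f k) * g x v (f k))"
proof -
  have "g x u v = g x u (\<Sum>k\<in>UNIV. g x v (f k) *\<^sub>R f k)"
    using orthonormal_expansion[OF x f, of v] by simp
  then show ?thesis by (simp add: linear_sum[OF g_linear(2)[OF x]] g_simps[OF x] mult.commute)
qed

lemma gram_factorization:
  fixes f :: "'n \<Rightarrow> real ^ 'n" and J K :: "'n \<Rightarrow> real ^ 'n"
  assumes x: "x \<in> U" and f: "\<And>i j. g x (f i) (f j) = (if i = j then 1 else 0)"
  shows "(\<chi> i j. g x (J i) (K j)) = (\<chi> i k. g x (J i) (f k)) ** transpose (\<chi> j k. g x (K j) (f k))"
  unfolding vec_eq_iff
  by (intro allI, simp add: matrix_matrix_mult_def transpose_def, rule parseval[OF x f])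

text \<open>In an orthonormal basis the Gram matrix is a matrix times its transpose. The sign is
  what permits squaring away the root in \<open>density\<close>.\<close>

lemma gram_det_nonneg:
  fixes J :: "'n \<Rightarrow> real ^ 'n"
  assumes x: "x \<in> U" shows "det (\<chi> i j. g x (J i) (J j)) \<ge> 0"
proof -
  obtain f :: "'n \<Rightarrow> real ^ 'n" where f: "\<And>i j. g x (f i) (f j) = (if i = j then 1 else 0)"
    using orthonormal_basis_exists[OF x] by blast
  show ?thesis by (subst gram_factorization[OF x f]) (simp add: det_mul det_transpose)
qed

text \<open>Tangent vectors at \<open>P\<close> are recorded in the chart
  \<open>chart_at M P\<close>; this converts them to the working chart \<open>c\<close>.\<close>

definition to_chart :: "'a \<Rightarrow> real ^ 'n \<Rightarrow> real ^ 'n" where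
  "to_chart P = frechet_derivative (transition (chart_at M P) c) (at (coord (chart_at M P) P))"

lemma chart_at_pairs:
  assumes "P \<in> dom_of c"
  shows "riem_chart_pair M (chart_at M P) c" "riem_chart_pair M c (chart_at M P)"
    "P \<in> dom_of (chart_at M P)"
  using chart_at[of P] chart_props(2) assms
  by (auto simp: riem_chart_pair_def riem_chart_def riemannian chart)

lemma to_chart:
  assumes P: "P \<in> dom_of c"
  shows "linear (to_chart P)" "surj (to_chart P)"
    "tangent_inner M P u v = g (coord c P) (to_chart P u) (to_chart P v)"
proof -
  interpret a: riem_chart_pair M "chart_at M P" c by (rule chart_at_pairs[OF P])
  have PV: "coord (chart_at M P) P \<in> a.V" using P chart_at_pairs(3)[OF P] by (auto simp: a.V_def)
  show "linear (to_chart P)" "surj (to_chart P)"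
    unfolding to_chart_def by (rule a.transition_linear[OF PV], rule a.transition_derivative_surj[OF PV])
  show "tangent_inner M P u v = g (coord c P) (to_chart P u) (to_chart P v)"
    unfolding to_chart_def tangent_inner_def
    using a.metric_transition[OF PV] a.transition_coord[OF chart_at_pairs(3)[OF P]] by simp
qed

text \<open>\<open>riem_exp\<close> quantifies over arbitrary geodesics of the manifold with the
  given initial data. Each of them ends where the geodesic in the chart ends, which settles both
  existence and uniqueness for \<open>THE\<close>.\<close>

lemma riem_exp_eq:
  assumes P: "P \<in> dom_of c" and geo: "geodesic_in_chart {-2<..<2} x v"
    and x0: "x 0 = coord c P" and v0: "v 0 = to_chart P \<xi>"
  shows "riem_exp M P \<xi> = point_at (x 1)"
proof -
  let ?c = "chart_at M P" and ?I = "{-2<..<2::real}"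
  let ?\<gamma> = "\<lambda>t. point_at (x t)"
  interpret a: riem_chart_pair M ?c c by (rule chart_at_pairs[OF P])
  interpret b: riem_chart_pair M c ?c by (rule chart_at_pairs[OF P])
  have PV: "coord ?c P \<in> a.V" "coord c P \<in> b.V" using P chart_at_pairs(3)[OF P] by (auto simp: a.V_def b.V_def)
  have xU: "x t \<in> U" if "t \<in> ?I" for t using geodesic_in_chartD(1)[OF geo that] .
  have geoM: "geodesic_on M ?I ?\<gamma>" by (rule geodesic_on_of_chart[OF geo]) (auto simp: is_interval_oo)
  have \<gamma>0: "?\<gamma> 0 = P" using x0 point_at(1)[OF P] by simp
  have d0: "((\<lambda>t. coord ?c (?\<gamma> t)) has_vector_derivative \<xi>) (at 0)"
  proof (rule has_vector_derivative_transform_within_open[of "\<lambda>t. b.\<phi> (x t)" _ _ ?I])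
    have "b.D\<phi> (x 0) (v 0) = \<xi>"
      unfolding x0 v0 to_chart_def
      by (rule transition_derivative_inverse[OF a.riem_chart_axioms riem_chart_axioms chart_at_pairs(3)[OF P] P])
    then show "((\<lambda>t. b.\<phi> (x t)) has_vector_derivative \<xi>) (at 0)"
      using b.geodesic_transition(1)[OF geo, of 0] PV x0 by simp
    show "b.\<phi> (x t) = coord ?c (?\<gamma> t)" if "t \<in> ?I" for t
      using b.transition_coord[OF point_at(3)[OF xU[OF that]]] point_at(2)[OF xU[OF that]] by simp
  qed auto
  show ?thesis
    unfolding riem_exp_def
  proof (rule the_equality)
    show "\<exists>I \<gamma>. {0..1} \<subseteq> I \<and> geodesic_on M I \<gamma> \<and> \<gamma> 0 = P \<and>
        ((\<lambda>t. coord ?c (\<gamma> t)) has_vector_derivative \<xi>) (at 0) \<and> \<gamma> 1 = point_at (x 1)"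
      by (intro exI[of _ ?I] exI[of _ ?\<gamma>] conjI geoM \<gamma>0 d0) auto
    fix q assume "\<exists>I \<gamma>. {0..1} \<subseteq> I \<and> geodesic_on M I \<gamma> \<and> \<gamma> 0 = P \<and>
        ((\<lambda>t. coord ?c (\<gamma> t)) has_vector_derivative \<xi>) (at 0) \<and> \<gamma> 1 = q"
    then obtain I \<gamma> where I: "{0..1} \<subseteq> I" and \<gamma>: "geodesic_on M I \<gamma>" "\<gamma> 0 = P"
      "((\<lambda>t. coord ?c (\<gamma> t)) has_vector_derivative \<xi>) (at 0)" "\<gamma> 1 = q" by blast
    have "?\<gamma> 1 = \<gamma> 1"
    proof (rule geodesic_on_agree[OF geoM \<gamma>(1) _ I])
      show "?\<gamma> t \<in> dom_of c" if "t \<in> {0..1}" for t using point_at(3)[OF xU, of t] that by simp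
      show "?\<gamma> 0 = \<gamma> 0" using \<gamma>0 \<gamma>(2) by simp
      show "((\<lambda>t. coord c (?\<gamma> t)) has_vector_derivative to_chart P \<xi>) (at 0)"
        by (rule has_vector_derivative_transform_within_open[of x _ _ ?I])
          (use geodesic_in_chartD(2)[OF geo, of 0] v0 point_at(2)[OF xU] in auto)
      have I0: "open I" "0 \<in> I" "continuous_map (top_of_set I) (top_of M) \<gamma>"
        using \<gamma>(1) I by (auto simp: geodesic_on_def)
      obtain N where N: "open N" "0 \<in> N" "\<And>t. t \<in> N \<Longrightarrow> \<gamma> t \<in> dom_of ?c"
        using a.coord_continuous_open[OF I0(3,1,2)] chart_at_pairs(3)[OF P] \<gamma>(2) by metis
      show "((\<lambda>t. coord c (\<gamma> t)) has_vector_derivative to_chart P \<xi>) (at 0)"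
      proof (rule has_vector_derivative_transform_within_open[OF _ N(1,2)])
        show "a.\<phi> (coord ?c (\<gamma> t)) = coord c (\<gamma> t)" if "t \<in> N" for t
          by (rule a.transition_coord[OF N(3)[OF that]])
        have "(a.\<phi> has_derivative to_chart P) (at (coord ?c (\<gamma> 0)))"
          unfolding to_chart_def \<gamma>(2) by (rule a.transition_has_derivative[OF PV(1)])
        from has_derivative_compose[OF \<gamma>(3)[unfolded has_vector_derivative_def] this]
        show "((\<lambda>t. a.\<phi> (coord ?c (\<gamma> t))) has_vector_derivative to_chart P \<xi>) (at 0)"
          unfolding has_vector_derivative_def
          by (rule has_derivative_eq_rhs) (simp add: linear_scale[OF to_chart(1)[OF P]])
      qed
    qed auto
    then show "q = point_at (x 1)" using \<gamma>(4) by simp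
  qed
qed

text \<open>The definition measures the differential of the exponential map in whatever chart is
  selected at the image point. Transitions preserve the metric, so the working chart yields the same
  matrix.\<close>

lemma normal_metric_eq:
  assumes P: "P \<in> dom_of c" and E: "linear E"
    and ex: "\<And>\<xi>. norm (to_chart P \<xi>) < \<rho> \<Longrightarrow> X (to_chart P \<xi>) \<in> U \<and> riem_exp M P \<xi> = point_at (X (to_chart P \<xi>))"
    and y: "norm (to_chart P (E y)) < \<rho>" and A: "(X has_derivative A) (at (to_chart P (E y)))"
  shows "normal_metric M P E y = (\<chi> i j. g (X (to_chart P (E y)))
     (A (to_chart P (E (axis i 1)))) (A (to_chart P (E (axis j 1)))))"
proof -
  let ?L = "\<lambda>y. to_chart P (E y)"
  define x1 where "x1 = X (?L y)"
  define q where "q = point_at x1"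
  have x1: "x1 \<in> U" and q: "riem_exp M P (E y) = q" using ex[OF y] by (auto simp: x1_def q_def)
  have qd: "q \<in> dom_of c" and cq: "coord c q = x1" using point_at(2,3)[OF x1] by (auto simp: q_def)
  let ?c = "chart_at M q"
  interpret b: riem_chart_pair M c ?c by (rule chart_at_pairs[OF qd])
  have qV: "x1 \<in> b.V" unfolding b.V_def using qd chart_at_pairs(3)[OF qd] cq by (metis IntI image_eqI)
  have lin: "linear ?L" using linear_compose[OF E to_chart(1)[OF P]] by (simp add: o_def)
  have dL: "(?L has_derivative ?L) (at y)"
    by (rule bounded_linear_imp_has_derivative) (use lin linear_conv_bounded_linear in blast)
  have "((\<lambda>y. b.\<phi> (X (?L y))) has_derivative (\<lambda>h. b.D\<phi> x1 (A (?L h)))) (at y)"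
    using has_derivative_compose[OF has_derivative_compose[OF dL A] b.transition_has_derivative]
      qV unfolding x1_def .
  then have "((\<lambda>y. coord ?c (riem_exp M P (E y))) has_derivative (\<lambda>h. b.D\<phi> x1 (A (?L h)))) (at y)"
  proof (rule has_derivative_transform_within_open)
    show "open {y. norm (?L y) < \<rho>}"
      using lin linear_conv_bounded_linear[of ?L] linear_continuous_on[of ?L UNIV]
      by (intro open_Collect_less continuous_intros) auto
    show "b.\<phi> (X (?L y)) = coord ?c (riem_exp M P (E y))" if "y \<in> {y. norm (?L y) < \<rho>}" for y
    proof -
      have "X (?L y) \<in> U" "riem_exp M P (E y) = point_at (X (?L y))" using ex[of "E y"] that by auto
      then show ?thesis using b.transition_coord[OF point_at(3), of "X (?L y)"] point_at(2) by simp
    qed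
  qed (use y in simp)
  from frechet_derivative_at[OF this, symmetric]
  have D: "frechet_derivative (\<lambda>y. coord ?c (riem_exp M P (E y))) (at y) = (\<lambda>h. b.D\<phi> x1 (A (?L h)))" .
  have "tangent_inner M q (b.D\<phi> x1 u) (b.D\<phi> x1 v) = g x1 u v" for u v
    unfolding tangent_inner_def using b.metric_transition[OF qV, of u v] b.transition_coord[OF qd] cq by simp
  then show ?thesis unfolding normal_metric_def Let_def q D x1_def[symmetric] by simp
qed

lemma orthonormal_frame_exists: assumes "P \<in> points M" shows "\<exists>E. orthonormal_frame M P E"
proof -
  interpret c0: riem_chart M "chart_at M P"
    using chart_at[OF assms] riemannian by (simp add: riem_chart_def)
  let ?x = "coord (chart_at M P) P"
  have x: "?x \<in> c0.U" using chart_at[OF assms] by (auto simp: c0.U_def)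
  obtain f :: "'n \<Rightarrow> real ^ 'n" where f: "\<And>i j. c0.g ?x (f i) (f j) = (if i = j then 1 else 0)"
    using c0.orthonormal_basis_exists[OF x] by blast
  show ?thesis
    unfolding orthonormal_frame_def
  proof (intro exI[of _ "\<lambda>u. \<Sum>k\<in>UNIV. u $ k *\<^sub>R f k"] conjI allI)
    show "linear (\<lambda>u. \<Sum>k\<in>UNIV. u $ k *\<^sub>R f k)"
      by (rule linearI) (simp_all add: scaleR_add_left sum.distrib scaleR_sum_right)
    show "tangent_inner M P (\<Sum>k\<in>UNIV. u $ k *\<^sub>R f k) (\<Sum>k\<in>UNIV. v $ k *\<^sub>R f k) = u \<bullet> v" for u v
      unfolding tangent_inner_def
      by (simp add: linear_sum[OF c0.g_linear(1)[OF x]] linear_sum[OF c0.g_linear(2)[OF x]]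
          c0.g_simps[OF x] f if_distrib inner_vec_def mult.commute cong: if_cong)
  qed
qed

lemma jacobi_along_subset: "jacobi_along I x v J K \<Longrightarrow> I' \<subseteq> I \<Longrightarrow> jacobi_along I' x v J K"
  and geodesic_in_chart_subset: "geodesic_in_chart I x v \<Longrightarrow> I' \<subseteq> I \<Longrightarrow> geodesic_in_chart I' x v"
  by (auto simp: jacobi_along_def geodesic_in_chart_def)

text \<open>The metric in normal coordinates is the Gram matrix of the fields divided by
  \<open>t\<close>, so its determinant carries t^(-2n). The factor t^(n-1) of the density, squared,
  leaves t^2, which is the squared length of the radial field.\<close>

lemma density_jacobi:
  assumes P: "P \<in> dom_of c" and dens: "density_function M \<Theta>" and \<theta>: "g (coord c P) \<theta> \<theta> = 1"
  obtains s x v J K and f :: "'n \<Rightarrow> real ^ 'n" where "s > 0"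
    "\<And>i j. g (coord c P) (f i) (f j) = (if i = j then 1 else 0)"
    "geodesic_in_chart {-s<..<s} x v" "x 0 = coord c P" "v 0 = \<theta>"
    "\<And>\<eta>. jacobi_along {-s<..<s} x v (\<lambda>t. J t \<eta>) (\<lambda>t. K t \<eta>)" "\<And>\<eta>. J 0 \<eta> = 0" "\<And>\<eta>. K 0 \<eta> = \<eta>"
    "\<And>t. t \<in> {0<..<s} \<Longrightarrow> linear (J t)" "\<And>t. t \<in> {0<..<s} \<Longrightarrow> J t \<theta> = t *\<^sub>R v t"
    "\<And>t. t \<in> {0<..<s} \<Longrightarrow> det (\<chi> i j. g (x t) (J t (f i)) (J t (f j))) = t\<^sup>2 * (\<Theta> t)\<^sup>2"
proof -
  let ?x0 = "coord c P" and ?L = "to_chart P"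
  \<comment> \<open>This is the frame chosen inside \<open>density\<close>; as the choice is not
    under control, the basis \<open>f\<close> derived from it cannot be adapted to
    \<open>\<theta>\<close>.\<close>
  define E where "E = (SOME E. orthonormal_frame M P E)"
  have x0: "?x0 \<in> U" and PM: "P \<in> points M" using P chart_props(2) by (auto simp: U_def)
  have E: "orthonormal_frame M P E"
    unfolding E_def using someI_ex[OF orthonormal_frame_exists[OF PM]] .
  have linE: "linear E" using E by (simp add: orthonormal_frame_def)
  have gE: "g ?x0 (?L (E u)) (?L (E v)) = u \<bullet> v" for u v
    using E to_chart(3)[OF P] by (simp add: orthonormal_frame_def)
  have "inj E"
  proof (subst linear_injective_0[OF linE], intro allI impI)
    fix u assume "E u = 0"
    then have "?L (E u) = 0" using linear_0[OF to_chart(1)[OF P]] by simp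
    then show "u = 0" using gE[of u u] g_simps(9)[OF x0] by simp
  qed
  then have surjE: "surj E" using linear_injective_imp_surjective[OF linE] by blast
  define f where "f i = ?L (E (axis i 1))" for i :: 'n
  have f: "g ?x0 (f i) (f j) = (if i = j then 1 else 0)" for i j
    unfolding f_def gE by (simp add: inner_axis_axis)
  obtain \<delta> where \<delta>: "\<delta> > 0" "\<And>\<xi>. 0 < tangent_norm M P \<xi> \<Longrightarrow> tangent_norm M P \<xi> < \<delta> \<Longrightarrow>
      density M P \<xi> = \<Theta> (tangent_norm M P \<xi>)"
    using dens PM unfolding density_function_def by blast
  obtain \<rho> X V where \<rho>: "\<rho> > 0"
    and geo: "\<And>\<xi>. norm \<xi> < \<rho> \<Longrightarrow> geodesic_in_chart {-2<..<2} (X \<xi>) (V \<xi>)"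
    and X0: "\<And>\<xi>. norm \<xi> < \<rho> \<Longrightarrow> X \<xi> 0 = ?x0" and V0: "\<And>\<xi>. norm \<xi> < \<rho> \<Longrightarrow> V \<xi> 0 = \<xi>"
    and jac: "\<And>\<theta>. \<exists>s>0. \<exists>x v J K. geodesic_in_chart {-s<..<s} x v \<and> x 0 = ?x0 \<and> v 0 = \<theta> \<and>
       (\<forall>\<eta>. jacobi_along {-s<..<s} x v (\<lambda>t. J t \<eta>) (\<lambda>t. K t \<eta>) \<and> J 0 \<eta> = 0 \<and> K 0 \<eta> = \<eta>) \<and>
       (\<forall>t\<in>{0<..<s}. norm (t *\<^sub>R \<theta>) < \<rho> \<and> X (t *\<^sub>R \<theta>) 1 = x t \<and>
          ((\<lambda>\<xi>. X \<xi> 1) has_derivative (\<lambda>\<eta>. J t \<eta> /\<^sub>R t)) (at (t *\<^sub>R \<theta>)))"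
    by (rule exponential_chart[OF x0]) blast
  obtain s0 x v J K where s0: "s0 > 0" and g1: "geodesic_in_chart {-s0<..<s0} x v" "x 0 = ?x0" "v 0 = \<theta>"
    and j1: "\<And>\<eta>. jacobi_along {-s0<..<s0} x v (\<lambda>t. J t \<eta>) (\<lambda>t. K t \<eta>)" "\<And>\<eta>. J 0 \<eta> = 0" "\<And>\<eta>. K 0 \<eta> = \<eta>"
    and e1: "\<And>t. t \<in> {0<..<s0} \<Longrightarrow> norm (t *\<^sub>R \<theta>) < \<rho>" "\<And>t. t \<in> {0<..<s0} \<Longrightarrow> X (t *\<^sub>R \<theta>) 1 = x t"
      "\<And>t. t \<in> {0<..<s0} \<Longrightarrow> ((\<lambda>\<xi>. X \<xi> 1) has_derivative (\<lambda>\<eta>. J t \<eta> /\<^sub>R t)) (at (t *\<^sub>R \<theta>))"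
    using jac[of \<theta>] by blast
  have ex: "X (?L \<xi>) 1 \<in> U \<and> riem_exp M P \<xi> = point_at (X (?L \<xi>) 1)" if "norm (?L \<xi>) < \<rho>" for \<xi>
    using riem_exp_eq[OF P geo[OF that] X0[OF that] V0[OF that]] geodesic_in_chartD(1)[OF geo[OF that], of 1]
    by simp
  have linJ: "linear (J t)" if t: "t \<in> {0<..<s0}" for t
  proof -
    have "linear (\<lambda>\<eta>. t *\<^sub>R (J t \<eta> /\<^sub>R t))"
      using linear_compose_scale_right[OF has_derivative_linear[OF e1(3)[OF t]], of t] .
    then show ?thesis using t by simp
  qed
  \<comment> \<open>The exponential map is differentiated along the ray, where it reproduces the
    geodesic.\<close>
  have J\<theta>: "J t \<theta> = t *\<^sub>R v t" if t: "t \<in> {0<..<s0}" for t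
  proof -
    have "((\<lambda>t. t *\<^sub>R \<theta>) has_vector_derivative \<theta>) (at t)"
      by (auto intro!: derivative_eq_intros)
    from has_derivative_compose[OF this[unfolded has_vector_derivative_def] e1(3)[OF t]]
    have "((\<lambda>t. X (t *\<^sub>R \<theta>) 1) has_vector_derivative J t \<theta> /\<^sub>R t) (at t)"
      unfolding has_vector_derivative_def
      by (rule has_derivative_eq_rhs) (simp add: linear_scale[OF linJ[OF t]] mult.commute)
    then have "(x has_vector_derivative J t \<theta> /\<^sub>R t) (at t)"
      by (rule has_vector_derivative_transform_within_open[of _ _ _ "{0<..<s0}"]) (use t e1(2) in auto)
    moreover have "(x has_vector_derivative v t) (at t)" by (rule geodesic_in_chartD(2)[OF g1(1)]) (use t in auto)
    ultimately have "v t = J t \<theta> /\<^sub>R t" by (rule vector_derivative_unique_at[symmetric])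
    then show ?thesis using t by simp
  qed
  have det: "det (\<chi> i j. g (x t) (J t (f i)) (J t (f j))) = t\<^sup>2 * (\<Theta> t)\<^sup>2" if t: "t \<in> {0<..<s0}" "t < \<delta>" for t
  proof -
    let ?n = "CARD('n)"
    have t0: "t > 0" using t by simp
    have xU: "x t \<in> U" by (rule geodesic_in_chartD(1)[OF g1(1)]) (use t in auto)
    obtain \<xi> where \<xi>: "?L \<xi> = t *\<^sub>R \<theta>" using to_chart(2)[OF P] by (metis surjD)
    define y where "y = inv E \<xi>"
    have Ey: "E y = \<xi>" unfolding y_def by (rule surj_f_inv_f[OF surjE])
    have norm: "tangent_norm M P \<xi> = t"
      unfolding tangent_norm_def to_chart(3)[OF P] \<xi> using t0 \<theta>
      by (simp add: g_simps[OF x0] real_sqrt_mult)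
    let ?G = "\<chi> i j. g (x t) (J t (f i)) (J t (f j))"
    have "normal_metric M P E y = (\<chi> i j. g (X (?L (E y)) 1)
        (J t (?L (E (axis i 1))) /\<^sub>R t) (J t (?L (E (axis j 1))) /\<^sub>R t))"
      by (rule normal_metric_eq[OF P linE ex, where \<rho>=\<rho>]) (use e1(1,3)[OF t(1)] in \<open>simp_all add: Ey \<xi>\<close>)
    also have "\<dots> = (\<chi> i. (1 / t\<^sup>2) *s ?G $ i)"
      unfolding Ey \<xi> e1(2)[OF t(1)] f_def
      by (simp add: vec_eq_iff g_simps[OF xU] power2_eq_square field_simps)
    also have "det \<dots> = (1 / t\<^sup>2) ^ ?n * det ?G"
      by (subst det_rows_mul) simp
    finally have dn: "det (normal_metric M P E y) = (1 / t\<^sup>2) ^ ?n * det ?G" .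
    have dG: "det ?G \<ge> 0" by (rule gram_det_nonneg[OF xU])
    have "\<Theta> t = density M P \<xi>" using \<delta>(2)[of \<xi>] norm t by simp
    also have "\<dots> = t ^ (?n - 1) * sqrt (det (normal_metric M P E y))"
      unfolding density_def Let_def E_def[symmetric] y_def norm ..
    finally have "(\<Theta> t)\<^sup>2 = (t ^ (?n - 1))\<^sup>2 * ((1 / t\<^sup>2) ^ ?n * det ?G)"
      using dn dG by (simp add: power_mult_distrib)
    then have "t\<^sup>2 * (\<Theta> t)\<^sup>2 = (t * t ^ (?n - 1))\<^sup>2 * (1 / t\<^sup>2) ^ ?n * det ?G"
      by (simp add: power_mult_distrib)
    also have "t * t ^ (?n - 1) = t ^ ?n"
      using power_Suc[of t "?n - 1"] by simp
    also have "(t ^ ?n)\<^sup>2 * (1 / t\<^sup>2) ^ ?n = 1"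
      using t0 by (simp add: power_divide power_mult[symmetric] mult.commute)
    finally show ?thesis by simp
  qed
  have sub: "{- min s0 \<delta><..<min s0 \<delta>} \<subseteq> {-s0<..<s0}" by auto
  show ?thesis
    by (rule that[of "min s0 \<delta>" f x v J K])
      (use s0 \<delta> f g1 j1 linJ J\<theta> det jacobi_along_subset[OF j1(1) sub]
        geodesic_in_chart_subset[OF g1(1) sub] in auto)
qed

end

section \<open>The Riccati inequality for Gram matrices\<close>

lemma trace_scaleR: "trace (r *\<^sub>R A) = r * trace (A :: real^'n^'n)"
  by (simp add: trace_def sum_distrib_left)

lemma trace_square_symmetric:
  fixes Z :: "real^'n^'n"
  assumes "transpose Z = Z"
  shows "trace (Z ** Z) = (\<Sum>i\<in>UNIV. \<Sum>j\<in>UNIV. (Z $ i $ j)\<^sup>2)"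
proof -
  have "Z $ j $ i = Z $ i $ j" for i j using arg_cong[OF assms, of "\<lambda>A. A $ i $ j"] by (simp add: transpose_def)
  then show ?thesis by (simp add: trace_def matrix_matrix_mult_def power2_eq_square)
qed

definition outer :: "real^'n \<Rightarrow> real^'n \<Rightarrow> real^'n^'n" where
  "outer u v = (\<chi> i j. u $ i * v $ j)"

lemma matrix_mult_outer: "A ** outer u v = outer (A *v u) v"
  by (simp add: outer_def matrix_matrix_mult_def matrix_vector_mult_def vec_eq_iff sum_distrib_right
      mult.assoc)

lemma outer_mult_matrix: "outer u v ** A = outer u (transpose A *v v)"
  by (simp add: outer_def matrix_matrix_mult_def matrix_vector_mult_def vec_eq_iff sum_distrib_left
      transpose_def mult_ac)

lemma transpose_outer: "transpose (outer u v) = outer v u"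
  by (simp add: outer_def transpose_def vec_eq_iff mult.commute)

lemma trace_outer: "trace (outer u v) = u \<bullet> v"
  by (simp add: outer_def trace_def inner_vec_def)

lemma outer_mult_outer: "outer u v ** outer a b = (v \<bullet> a) *\<^sub>R outer u b"
  by (simp add: outer_def matrix_matrix_mult_def vec_eq_iff inner_vec_def sum_distrib_left
      sum_distrib_right mult_ac)

lemmas matrix_bilinear_simps =
  bounded_bilinear.add_left[OF bounded_bilinear_matrix_mult]
  bounded_bilinear.add_right[OF bounded_bilinear_matrix_mult]
  bounded_bilinear.diff_left[OF bounded_bilinear_matrix_mult]
  bounded_bilinear.diff_right[OF bounded_bilinear_matrix_mult]
  bounded_bilinear.scaleR_left[OF bounded_bilinear_matrix_mult]
  bounded_bilinear.scaleR_right[OF bounded_bilinear_matrix_mult]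

lemma transpose_diff: "transpose (A - B) = transpose A - transpose (B :: real^'n^'m)"
  and transpose_scaleR: "transpose (r *\<^sub>R A) = r *\<^sub>R transpose (A :: real^'n^'m)"
  by (simp_all add: transpose_def vec_eq_iff)

text \<open>In an orthonormal basis, with respect to which \<open>B\<close> and \<open>C\<close> hold the coordinates of the Jacobi
  fields and of their covariant derivatives, \<open>Y = B\<inverse> C\<close> is the shape operator of the geodesic sphere
  extended by \<open>1/t\<close> in the radial direction \<open>w\<close>.  The inequality says that \<open>Y - \<phi>\<close> has nonnegative
  squared norm on the orthogonal complement of \<open>w\<close>.\<close>

lemma shape_operator_inequality:
  fixes B C \<rho> G H L R :: "real^'n^'n" and th :: "real^'n"
  assumes G: "G = B ** transpose B" and H: "H = C ** transpose B" "transpose H = H"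
    and L: "L = C ** transpose C" and R: "R = B ** \<rho> ** transpose B" and det: "det G \<noteq> 0"
    and th: "G *v th = t\<^sup>2 *\<^sub>R th" "H *v th = t *\<^sub>R th" "th \<bullet> th = 1" and t: "t \<noteq> 0"
  obtains Gi where "Gi ** G = mat 1"
    "trace (Gi ** L) = trace (Gi ** H ** Gi ** H)" "trace (Gi ** R) = trace \<rho>"
    "\<And>\<phi>. 0 \<le> trace (Gi ** H ** Gi ** H) - 1 / t\<^sup>2 + \<phi>\<^sup>2 * (real CARD('n) - 1)
       - 2 * \<phi> * (trace (Gi ** H) - 1 / t)"
    "\<And>\<phi>. trace (Gi ** H ** Gi ** H) - 1 / t\<^sup>2 + \<phi>\<^sup>2 * (real CARD('n) - 1)
       - 2 * \<phi> * (trace (Gi ** H) - 1 / t) = 0 \<Longrightarrow>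
       H = t *\<^sub>R outer th th + \<phi> *\<^sub>R (G - t\<^sup>2 *\<^sub>R outer th th)"
proof -
  have "det B \<noteq> 0" using det by (auto simp: G det_mul)
  then obtain Bi where Bi: "B ** Bi = mat 1" "Bi ** B = mat 1"
    using invertible_det_nz[of B] unfolding invertible_def by blast
  have BiT: "transpose B ** transpose Bi = mat 1" "transpose Bi ** transpose B = mat 1"
    using arg_cong[OF Bi(1), of transpose] arg_cong[OF Bi(2), of transpose]
    by (simp_all add: matrix_transpose_mul transpose_mat)
  have cancel: "X ** B ** Bi = X" "X ** Bi ** B = X" "X ** transpose B ** transpose Bi = X"
    "X ** transpose Bi ** transpose B = X" for X :: "real^'n^'n"
    by (simp_all add: matrix_mul_assoc[symmetric] Bi BiT)
  define Y where "Y = Bi ** C"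
  have C: "C = B ** Y" by (simp add: Y_def matrix_mul_assoc Bi)
  have H': "H = B ** Y ** transpose B" using H C by simp
  have Ysym: "transpose Y = Y"
  proof -
    have "B ** transpose Y ** transpose B = B ** Y ** transpose B"
      using H(2) by (simp add: H' matrix_transpose_mul transpose_transpose matrix_mul_assoc)
    then have "Bi ** (B ** transpose Y ** transpose B) ** transpose Bi
        = Bi ** (B ** Y ** transpose B) ** transpose Bi" by simp
    then show ?thesis by (simp add: matrix_mul_assoc Bi cancel)
  qed
  have L': "L = B ** Y ** Y ** transpose B"
    by (simp add: L C matrix_transpose_mul Ysym matrix_mul_assoc)
  define Gi where "Gi = transpose Bi ** Bi"
  have tr: "trace (transpose Bi ** X ** transpose B) = trace X" for X :: "real^'n^'n"
    by (subst trace_mul_sym) (simp add: matrix_mul_assoc BiT)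
  have GiG: "Gi ** G = mat 1" by (simp add: Gi_def G matrix_mul_assoc cancel BiT)
  have GiH: "Gi ** H = transpose Bi ** Y ** transpose B" by (simp add: Gi_def H' matrix_mul_assoc cancel)
  have trH: "trace (Gi ** H) = trace Y" by (simp add: GiH tr)
  have "Gi ** H ** Gi ** H = transpose Bi ** (Y ** Y) ** transpose B"
    by (simp add: GiH matrix_mul_assoc[of _ Gi H, symmetric]) (simp add: matrix_mul_assoc cancel)
  then have trHH: "trace (Gi ** H ** Gi ** H) = trace (Y ** Y)" by (simp only: tr)
  have "Gi ** L = transpose Bi ** (Y ** Y) ** transpose B" by (simp add: Gi_def L' matrix_mul_assoc cancel)
  then have trL: "trace (Gi ** L) = trace (Y ** Y)" by (simp only: tr)
  have "Gi ** R = transpose Bi ** \<rho> ** transpose B" by (simp add: Gi_def R matrix_mul_assoc cancel)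
  then have trR: "trace (Gi ** R) = trace \<rho>" by (simp only: tr)

  \<comment> \<open>In the application \<open>transpose B *v th\<close> holds the coordinates of the
    radial Jacobi field, of length \<open>t\<close>; dividing by \<open>t\<close> gives those of the
    unit velocity.\<close>
  define w where "w = (1 / t) *\<^sub>R (transpose B *v th)"
  have Bw: "B *v w = t *\<^sub>R th"
    using th(1) t by (simp add: w_def G matrix_vector_mul_assoc[symmetric] matrix_vector_mult_scaleR power2_eq_square)
  have Bith: "Bi *v th = (1 / t) *\<^sub>R w"
  proof -
    have "Bi *v (B *v w) = w" by (simp add: matrix_vector_mul_assoc Bi)
    then show ?thesis using t unfolding Bw by (auto simp: matrix_vector_mult_scaleR)
  qed
  have ww: "w \<bullet> w = 1"
  proof -
    have "w \<bullet> w = (1 / t) * (th \<bullet> (B *v w))"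
      by (simp add: w_def dot_lmul_matrix[symmetric] transpose_matrix_vector)
    then show ?thesis using t th(3) by (simp add: Bw)
  qed
  have Yw: "Y *v w = (1 / t) *\<^sub>R w"
  proof -
    have "Bi *v (H *v th) = Y *v (transpose B *v th)"
      by (simp add: H' matrix_vector_mul_assoc matrix_mul_assoc Bi del: transpose_matrix_vector)
    moreover have "transpose B *v th = t *\<^sub>R w" using t by (simp add: w_def)
    moreover have "Bi *v (t *\<^sub>R th) = w" using t by (simp add: matrix_vector_mult_scaleR Bith)
    ultimately have "w = t *\<^sub>R (Y *v w)" by (simp add: th(2) matrix_vector_mult_scaleR)
    then have "(1 / t) *\<^sub>R w = (1 / t) *\<^sub>R (t *\<^sub>R (Y *v w))" by simp
    then show ?thesis using t by simp
  qed
  \<comment> \<open>On \<open>w\<close> the matrix \<open>Y\<close> acts as 1/t, so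
    \<open>Z \<phi>\<close> is 0 there and Y - \<phi> on the complement. Being symmetric, it has a
    square whose trace is a sum of squares.\<close>
  define Z where "Z \<phi> = Y - (1 / t) *\<^sub>R outer w w - \<phi> *\<^sub>R (mat 1 - outer w w)" for \<phi>
  have Zsym: "transpose (Z \<phi>) = Z \<phi>" for \<phi>
    by (simp add: Z_def transpose_diff transpose_scaleR transpose_outer Ysym transpose_mat)
  have YP: "Y ** outer w w = (1 / t) *\<^sub>R outer w w" "outer w w ** Y = (1 / t) *\<^sub>R outer w w"
    unfolding matrix_mult_outer outer_mult_matrix Ysym Yw by (simp_all add: outer_def vec_eq_iff)
  have PP: "outer w w ** outer w w = outer w w" by (simp add: outer_mult_outer ww)
  have trZ: "trace (Z \<phi> ** Z \<phi>) = trace (Y ** Y) - 1 / t\<^sup>2 + \<phi>\<^sup>2 * (real CARD('n) - 1)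
       - 2 * \<phi> * (trace Y - 1 / t)" for \<phi>
    using t unfolding Z_def
    by (simp only: matrix_bilinear_simps YP PP matrix_mul_lid matrix_mul_rid trace_sub trace_scaleR
        trace_outer ww trace_I) (simp add: power2_eq_square field_simps)
  show ?thesis
  proof (rule that[OF GiG])
    show "trace (Gi ** L) = trace (Gi ** H ** Gi ** H)" by (simp add: trL trHH)
    show "trace (Gi ** R) = trace \<rho>" by (rule trR)
    show "0 \<le> trace (Gi ** H ** Gi ** H) - 1 / t\<^sup>2 + \<phi>\<^sup>2 * (real CARD('n) - 1)
       - 2 * \<phi> * (trace (Gi ** H) - 1 / t)" for \<phi>
      unfolding trHH trH trZ[symmetric] trace_square_symmetric[OF Zsym] by (simp add: sum_nonneg)
    fix \<phi> assume "trace (Gi ** H ** Gi ** H) - 1 / t\<^sup>2 + \<phi>\<^sup>2 * (real CARD('n) - 1)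
       - 2 * \<phi> * (trace (Gi ** H) - 1 / t) = 0"
    then have "(\<Sum>i\<in>UNIV. \<Sum>j\<in>UNIV. (Z \<phi> $ i $ j)\<^sup>2) = 0"
      unfolding trHH trH trZ[symmetric] trace_square_symmetric[OF Zsym] .
    then have "Z \<phi> = 0" by (simp add: sum_nonneg_eq_0_iff sum_nonneg vec_eq_iff)
    then have Y: "Y = (1 / t) *\<^sub>R outer w w + \<phi> *\<^sub>R (mat 1 - outer w w)" by (simp add: Z_def algebra_simps)
    have "B ** outer w w ** transpose B = t\<^sup>2 *\<^sub>R outer th th"
      unfolding matrix_mult_outer outer_mult_matrix transpose_transpose Bw
      by (simp add: outer_def vec_eq_iff power2_eq_square)
    then show "H = t *\<^sub>R outer th th + \<phi> *\<^sub>R (G - t\<^sup>2 *\<^sub>R outer th th)"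
      using t by (simp add: H' Y matrix_bilinear_simps G power2_eq_square)
  qed
qed


section \<open>Gram matrices of Jacobi fields\<close>

context riem_chart begin

text \<open>With the derivatives written in this form \<open>A\<close> and \<open>B\<close> are
  covariant derivatives, and metric compatibility removes the Christoffel terms once and for all
  from the Gram matrix computations.\<close>

lemma covariant_product_rule:
  assumes x: "(x has_vector_derivative v) (at t)" "x t \<in> U"
    and a: "(a has_vector_derivative A - \<Gamma> (x t) v (a t)) (at t)"
    and b: "(b has_vector_derivative B - \<Gamma> (x t) v (b t)) (at t)"
  shows "((\<lambda>t. g (x t) (a t) (b t)) has_real_derivative g (x t) A (b t) + g (x t) (a t) B) (at t)"
proof -
  have "((\<lambda>t. g (x t) (a t) (b t)) has_vector_derivative dg (x t) (a t) (b t) v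
      + g (x t) (A - \<Gamma> (x t) v (a t)) (b t) + g (x t) (a t) (B - \<Gamma> (x t) v (b t))) (at t)"
    by (rule g_field_vector_derivative[OF _ _ x a b])
  then show ?thesis
    unfolding has_real_derivative_iff_has_vector_derivative
    by (simp add: metric_compatible[OF x(2)] g_simps[OF x(2)])
qed

lemma g_tendsto:
  assumes x: "(X \<longlongrightarrow> x) F" "x \<in> U" "\<forall>\<^sub>F t in F. X t \<in> U"
    and "(a \<longlongrightarrow> u) F" "(b \<longlongrightarrow> v) F"
  shows "((\<lambda>t. g (X t) (a t) (b t)) \<longlongrightarrow> g x u v) F"
proof -
  let ?e = "\<lambda>i. axis i 1 :: real ^ 'n"
  have "((\<lambda>t. g (X t) u v) \<longlongrightarrow> g x u v) F" for u v
    using isCont_tendsto_compose[OF _ x(1), of "\<lambda>y. g y u v"]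
      Ck_on_continuous_on[OF g_Ck[of 0 u v]] open_U x(2)
    by (simp add: continuous_on_eq_continuous_at)
  then have "((\<lambda>t. \<Sum>i\<in>UNIV. \<Sum>j\<in>UNIV. (a t $ i * b t $ j) *\<^sub>R g (X t) (?e i) (?e j)) \<longlongrightarrow>
      (\<Sum>i\<in>UNIV. \<Sum>j\<in>UNIV. (u $ i * v $ j) *\<^sub>R g x (?e i) (?e j))) F"
    using assms by (intro tendsto_intros)
  then show ?thesis
    unfolding bilinear_expand_axis[OF g_bilinear[OF x(2)], symmetric]
    by (rule Lim_transform_eventually)
      (use x(3) in \<open>eventually_elim, simp only: bilinear_expand_axis[OF g_bilinear, symmetric]\<close>)
qed

end

text \<open>The basis \<open>f\<close> comes from the frame inside the density and need not contain
  \<open>\<theta>\<close>. The assumption \<open>radial\<close> therefore states through coordinates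
  that the Jacobi field with initial derivative \<open>\<theta>\<close> is
  \<open>t *\<^sub>R v t\<close>.\<close>

locale jacobi_frame = riem_chart M c
  for M :: "('a, 'n::finite) rspace" and c :: "('a, 'n) chart" +
  fixes s :: real and x v :: "real \<Rightarrow> real ^ 'n" and J K :: "'n \<Rightarrow> real \<Rightarrow> real ^ 'n"
    and f :: "'n \<Rightarrow> real ^ 'n" and \<theta> :: "real ^ 'n"
  assumes s: "s > 0" and geodesic: "geodesic_in_chart {-s<..<s} x v"
    and jacobi: "\<And>i. jacobi_along {-s<..<s} x v (J i) (K i)"
    and J0: "\<And>i. J i 0 = 0" and K0: "\<And>i. K i 0 = f i" and v0: "v 0 = \<theta>"
    and frame: "\<And>i j. g (x 0) (f i) (f j) = (if i = j then 1 else 0)"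
    and unit: "g (x 0) \<theta> \<theta> = 1"
    and radial: "\<And>t. t \<in> {0<..<s} \<Longrightarrow> (\<Sum>i\<in>UNIV. g (x 0) \<theta> (f i) *\<^sub>R J i t) = t *\<^sub>R v t"
begin

abbreviation "I \<equiv> {-s<..<s}"

definition "th = (\<chi> i. g (x 0) \<theta> (f i))"
definition "G t = (\<chi> i j. g (x t) (J i t) (J j t))"
definition "H t = (\<chi> i j. g (x t) (K i t) (J j t))"
definition "L t = (\<chi> i j. g (x t) (K i t) (K j t))"
definition "R t = (\<chi> i j. g (x t) (Rm (x t) (J i t) (v t) (v t)) (J j t))"
definition "R0 = (\<chi> i j. g (x 0) (Rm (x 0) (f i) \<theta> \<theta>) (f j))"

lemma xU: "t \<in> I \<Longrightarrow> x t \<in> U"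
  and dx: "t \<in> I \<Longrightarrow> (x has_vector_derivative v t) (at t)"
  using geodesic_in_chartD[OF geodesic] by blast+

lemma dv: "t \<in> I \<Longrightarrow> (v has_vector_derivative 0 - \<Gamma> (x t) (v t) (v t)) (at t)"
  using geodesic_in_chartD(3)[OF geodesic] by simp

lemma dJ: "t \<in> I \<Longrightarrow> (J i has_vector_derivative K i t - \<Gamma> (x t) (v t) (J i t)) (at t)"
  and dK: "t \<in> I \<Longrightarrow>
    (K i has_vector_derivative - Rm (x t) (J i t) (v t) (v t) - \<Gamma> (x t) (v t) (K i t)) (at t)"
  using jacobi[of i] unfolding jacobi_along_def by (blast, metis minus_diff_commute)

lemma zero_I: "0 \<in> I" using s by simp
lemma x0U: "x 0 \<in> U" by (rule xU[OF zero_I])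

section \<open>Conserved quantities along the geodesic\<close>

lemma constant_on_I:
  assumes "\<And>t. t \<in> I \<Longrightarrow> (h has_real_derivative 0) (at t)" "t \<in> I"
  shows "h t = h 0"
  using has_field_derivative_zero_constant[of I h] assms zero_I
  by (metis convex_real_interval(8) has_field_derivative_at_within)

lemma curvature_v: "t \<in> I \<Longrightarrow> g (x t) (Rm (x t) a (v t) (v t)) (v t) = 0"
  using jacobi_operator_self_adjoint[OF xU, of t a "v t" "v t"]
  by (simp add: curvature_self g_simps[OF xU])

lemma unit_speed: assumes t: "t \<in> I" shows "g (x t) (v t) (v t) = 1"
proof -
  have "((\<lambda>t. g (x t) (v t) (v t)) has_real_derivative 0) (at t)" if "t \<in> I" for t
    using covariant_product_rule[OF dx[OF that] xU[OF that] dv[OF that] dv[OF that]]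
    by (simp add: g_simps[OF xU[OF that]])
  from constant_on_I[OF this t] show ?thesis using unit v0 by simp
qed

lemma K_v: assumes t: "t \<in> I" shows "g (x t) (K i t) (v t) = th $ i"
proof -
  have "((\<lambda>t. g (x t) (K i t) (v t)) has_real_derivative 0) (at t)" if "t \<in> I" for t
    using covariant_product_rule[OF dx[OF that] xU[OF that] dK[OF that] dv[OF that]] curvature_v[OF that]
    by (simp add: g_simps[OF xU[OF that]])
  from constant_on_I[OF this t] show ?thesis using K0 v0 g_sym[OF x0U] by (simp add: th_def)
qed

text \<open>The velocity is parallel, so the derivative of the product is the constant found for
  \<open>K i\<close>.\<close>

lemma gauss_lemma: assumes t: "t \<in> I" shows "g (x t) (J i t) (v t) = t * th $ i"
proof -
  have "((\<lambda>t. g (x t) (J i t) (v t) - t * th $ i) has_real_derivative 0) (at t)" if "t \<in> I" for t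
    using DERIV_diff[OF covariant_product_rule[OF dx[OF that] xU[OF that] dJ[OF that, of i] dv[OF that]]
        DERIV_cmult_right[OF DERIV_ident, of "th $ i"]] K_v[OF that]
    by (simp add: g_simps[OF xU[OF that]])
  from constant_on_I[OF this t] show ?thesis using J0 g_simps(9)[OF x0U] by simp
qed

text \<open>The Wronskian of two Jacobi fields is constant because the Jacobi operator is
  self-adjoint, and both fields vanish at time 0. This is the symmetry of the shape
  operator.\<close>

lemma H_sym: assumes t: "t \<in> I" shows "g (x t) (K i t) (J j t) = g (x t) (K j t) (J i t)"
proof -
  have "((\<lambda>t. g (x t) (K i t) (J j t) - g (x t) (J i t) (K j t)) has_real_derivative 0) (at t)"
    if "t \<in> I" for t
    using DERIV_diff[OF covariant_product_rule[OF dx[OF that] xU[OF that] dK[OF that, of i] dJ[OF that, of j]]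
        covariant_product_rule[OF dx[OF that] xU[OF that] dJ[OF that, of i] dK[OF that, of j]]]
      jacobi_operator_self_adjoint[OF xU[OF that], of "J i t" "v t" "J j t"]
      g_sym[OF xU[OF that], of "J i t"]
    by (simp add: g_simps[OF xU[OF that]])
  from constant_on_I[OF this t] show ?thesis
    using J0 g_simps(9,10)[OF x0U] g_sym[OF xU[OF t], of "J i t" "K j t"] by simp
qed

lemma H_transpose: "t \<in> I \<Longrightarrow> transpose (H t) = H t"
  using H_sym by (simp add: H_def transpose_def vec_eq_iff)

lemma dG: assumes t: "t \<in> I"
  shows "((\<lambda>t. G t $ i $ j) has_real_derivative 2 * H t $ i $ j) (at t)"
  using covariant_product_rule[OF dx[OF t] xU[OF t] dJ[OF t, of i] dJ[OF t, of j]]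
    H_sym[OF t, of i j] g_sym[OF xU[OF t], of "J i t" "K j t"]
  by (simp add: G_def H_def)

lemma dH: assumes t: "t \<in> I"
  shows "((\<lambda>t. H t $ i $ j) has_real_derivative L t $ i $ j - R t $ i $ j) (at t)"
  using covariant_product_rule[OF dx[OF t] xU[OF t] dK[OF t, of i] dJ[OF t, of j]]
  by (simp add: H_def L_def R_def g_simps[OF xU[OF t]])

lemma dL: assumes t: "t \<in> I"
  shows "((\<lambda>t. L t $ i $ j) has_real_derivative
    - g (x t) (Rm (x t) (J i t) (v t) (v t)) (K j t) - g (x t) (Rm (x t) (J j t) (v t) (v t)) (K i t)) (at t)"
  using covariant_product_rule[OF dx[OF t] xU[OF t] dK[OF t, of i] dK[OF t, of j]]
    g_sym[OF xU[OF t], of "K i t" "Rm (x t) (J j t) (v t) (v t)"]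
  by (simp add: L_def g_simps[OF xU[OF t]])

lemma dG_matrix: "t \<in> I \<Longrightarrow> (G has_vector_derivative 2 *\<^sub>R H t) (at t)"
  and dH_matrix: "t \<in> I \<Longrightarrow> (H has_vector_derivative L t - R t) (at t)"
  by (intro has_vector_derivative_vecI;
      use dG dH in \<open>simp add: has_real_derivative_iff_has_vector_derivative\<close>)+

lemma H_continuous: "continuous_on I H"
  by (intro continuous_at_imp_continuous_on ballI)
    (rule has_vector_derivative_continuous[OF dH_matrix])

lemma th_unit: "th \<bullet> th = 1"
  using parseval[OF x0U frame, of \<theta> \<theta>] unit by (simp add: th_def inner_vec_def)

lemma J_radial: "t \<in> {0<..<s} \<Longrightarrow> (\<Sum>j\<in>UNIV. th $ j * g (x t) w (J j t)) = t * g (x t) w (v t)"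
  using arg_cong[OF radial, of t "g (x t) w"] xU[of t]
  by (simp add: linear_sum[OF g_linear(2)] g_simps th_def)

lemma G_th: assumes t: "t \<in> {0<..<s}" shows "G t *v th = t\<^sup>2 *\<^sub>R th"
  using J_radial[OF t] gauss_lemma[of t] t
  by (simp add: vec_eq_iff matrix_vector_mult_def G_def mult.commute power2_eq_square)

lemma H_th: assumes t: "t \<in> {0<..<s}" shows "H t *v th = t *\<^sub>R th"
  using J_radial[OF t] K_v[of t] t
  by (simp add: vec_eq_iff matrix_vector_mult_def H_def mult.commute)

section \<open>Expansion of the Gram matrices at the centre\<close>

lemma ev_I: "\<forall>\<^sub>F t in at_right 0. t \<in> {0<..<s}"
  using eventually_at_right_less[of "0::real"] s
  by (auto intro: eventually_at_rightI[of 0 s])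

lemma lim_x: "(x \<longlongrightarrow> x 0) (at_right 0)" and lim_v: "(v \<longlongrightarrow> \<theta>) (at_right 0)"
  and lim_K: "(K i \<longlongrightarrow> f i) (at_right 0)"
proof -
  have "isCont x 0" "isCont v 0" "isCont (K i) 0"
    using dx[OF zero_I] dv[OF zero_I] dK[OF zero_I] by (blast intro: has_vector_derivative_continuous)+
  then show "(x \<longlongrightarrow> x 0) (at_right 0)" "(v \<longlongrightarrow> \<theta>) (at_right 0)" "(K i \<longlongrightarrow> f i) (at_right 0)"
    unfolding isCont_def v0[symmetric] K0[symmetric]
    by (simp_all add: filterlim_at_split)
qed

lemma lim_J: "((\<lambda>t. J i t /\<^sub>R t) \<longlongrightarrow> f i) (at_right 0)"
proof -
  have "(J i has_vector_derivative f i) (at 0)"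
    using dJ[OF zero_I, of i] by (simp add: J0 K0 christoffel_simps[OF x0U])
  then have "((\<lambda>t. (J i t - t *\<^sub>R f i) /\<^sub>R norm t) \<longlongrightarrow> 0) (at_right 0)"
    unfolding has_vector_derivative_def has_derivative_at_within
    by (simp add: J0 filterlim_at_split)
  then have "((\<lambda>t. J i t /\<^sub>R t - f i) \<longlongrightarrow> 0) (at_right 0)"
  proof (rule Lim_transform_eventually)
    show "\<forall>\<^sub>F t in at_right 0. (J i t - t *\<^sub>R f i) /\<^sub>R norm t = J i t /\<^sub>R t - f i"
      using eventually_at_right_less[of "0::real"]
      by eventually_elim (simp add: scaleR_diff_right)
  qed
  then show ?thesis by (rule LIM_zero_cancel)
qed

lemma lim_J_zero: "(J i \<longlongrightarrow> 0) (at_right 0)"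
proof -
  have "isCont (J i) 0" using dJ[OF zero_I] by (rule has_vector_derivative_continuous)
  then show ?thesis by (simp add: isCont_def J0 filterlim_at_split)
qed

lemma ev_xU: "\<forall>\<^sub>F t in at_right 0. x t \<in> U"
  using ev_I by eventually_elim (auto intro: xU)

lemmas lim_g = g_tendsto[OF lim_x x0U ev_xU]

lemma lim_RJ: "((\<lambda>t. Rm (x t) (J i t /\<^sub>R t) (v t) (v t)) \<longlongrightarrow> Rm (x 0) (f i) \<theta> \<theta>) (at_right 0)"
  by (intro curvature_tendsto lim_x x0U ev_xU lim_J lim_v)

lemma lim_R: "((\<lambda>t. R t $ i $ j / t\<^sup>2) \<longlongrightarrow> R0 $ i $ j) (at_right 0)"
proof (rule Lim_transform_eventually)
  show "((\<lambda>t. g (x t) (Rm (x t) (J i t /\<^sub>R t) (v t) (v t)) (J j t /\<^sub>R t)) \<longlongrightarrow> R0 $ i $ j) (at_right 0)"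
    unfolding R0_def using lim_g[OF lim_RJ lim_J, of i j] by simp
  show "\<forall>\<^sub>F t in at_right 0. g (x t) (Rm (x t) (J i t /\<^sub>R t) (v t) (v t)) (J j t /\<^sub>R t) = R t $ i $ j / t\<^sup>2"
    using ev_I
  proof eventually_elim
    case (elim t)
    then have "x t \<in> U" by (intro xU) auto
    then show ?case
      by (simp add: R_def linear_scale[OF curvature_linear(1)] g_simps power2_eq_square divide_inverse mult_ac)
  qed
qed

lemma lim_RK: "((\<lambda>t. g (x t) (Rm (x t) (J i t) (v t) (v t)) (K j t) / t) \<longlongrightarrow> R0 $ i $ j) (at_right 0)"
proof (rule Lim_transform_eventually)
  show "((\<lambda>t. g (x t) (Rm (x t) (J i t /\<^sub>R t) (v t) (v t)) (K j t)) \<longlongrightarrow> R0 $ i $ j) (at_right 0)"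
    unfolding R0_def using lim_g[OF lim_RJ lim_K, of i j] by simp
  show "\<forall>\<^sub>F t in at_right 0. g (x t) (Rm (x t) (J i t /\<^sub>R t) (v t) (v t)) (K j t) =
      g (x t) (Rm (x t) (J i t) (v t) (v t)) (K j t) / t"
    using ev_I
  proof eventually_elim
    case (elim t)
    then have "x t \<in> U" by (intro xU) auto
    then show ?case
      by (simp add: linear_scale[OF curvature_linear(1)] g_simps divide_inverse mult_ac)
  qed
qed

lemma R0_sym: "R0 $ i $ j = R0 $ j $ i"
  unfolding R0_def using jacobi_operator_self_adjoint[OF x0U] by simp

text \<open>The expansion is built upwards by l'Hospital's rule: this limit enters the one for
  \<open>H\<close>, and that one the limit for \<open>G\<close>. The derivative of \<open>L\<close>
  contributes \<open>R0\<close> twice at first order, and t^2 contributes the divisor 2.\<close>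

lemma lim_L: "((\<lambda>t. (L t $ i $ j - mat 1 $ i $ j) / t\<^sup>2) \<longlongrightarrow> - R0 $ i $ j) (at_right 0)"
proof (rule lhopital_right_0)
  have "((\<lambda>t. L t $ i $ j - mat 1 $ i $ j) \<longlongrightarrow> g (x 0) (f i) (f j) - mat 1 $ i $ j) (at_right 0)"
    unfolding L_def vec_lambda_beta by (intro tendsto_diff tendsto_const lim_g lim_K)
  then show "((\<lambda>t. L t $ i $ j - mat 1 $ i $ j) \<longlongrightarrow> 0) (at_right 0)" by (simp add: frame mat_def)
  show "((\<lambda>t::real. t\<^sup>2) \<longlongrightarrow> 0) (at_right 0)" by real_asymp
  let ?f' = "\<lambda>t. - g (x t) (Rm (x t) (J i t) (v t) (v t)) (K j t) - g (x t) (Rm (x t) (J j t) (v t) (v t)) (K i t)"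
  show "\<forall>\<^sub>F t in at_right 0. ((\<lambda>t. L t $ i $ j - mat 1 $ i $ j) has_real_derivative ?f' t) (at t)"
    using ev_I
  proof eventually_elim
    case (elim t)
    then have t: "t \<in> I" by auto
    from DERIV_diff[OF dL[OF t] DERIV_const] show ?case by simp
  qed
  show "\<forall>\<^sub>F t::real in at_right 0. ((\<lambda>t. t\<^sup>2) has_real_derivative 2 * t) (at t)"
    by (auto intro!: always_eventually derivative_eq_intros)
  have "((\<lambda>t. (- (g (x t) (Rm (x t) (J i t) (v t) (v t)) (K j t) / t)
      - g (x t) (Rm (x t) (J j t) (v t) (v t)) (K i t) / t) / 2) \<longlongrightarrow> (- R0 $ i $ j - R0 $ j $ i) / 2) (at_right 0)"
    by (intro tendsto_intros lim_RK) auto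
  then show "((\<lambda>t. ?f' t / (2 * t)) \<longlongrightarrow> - R0 $ i $ j) (at_right 0)"
    using R0_sym[of i j] by (simp add: diff_divide_distrib mult.commute)
qed (use eventually_at_right_less[of "0::real"] in \<open>auto elim: eventually_mono\<close>)

text \<open>The derivative of \<open>H\<close> is \<open>L - R\<close>, and each of the two
  contributes \<open>- R0\<close> at order t^2; the divisor 3 comes from t^3.\<close>

lemma lim_H: "((\<lambda>t. (H t $ i $ j - t * mat 1 $ i $ j) / t ^ 3) \<longlongrightarrow> - 2 / 3 * R0 $ i $ j) (at_right 0)"
proof (rule lhopital_right_0)
  have "((\<lambda>t. H t $ i $ j - t * mat 1 $ i $ j) \<longlongrightarrow> g (x 0) (f i) 0 - 0 * mat 1 $ i $ j) (at_right 0)"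
    unfolding H_def vec_lambda_beta
    by (intro tendsto_diff tendsto_mult tendsto_ident_at tendsto_const lim_g lim_K lim_J_zero)
  then show "((\<lambda>t. H t $ i $ j - t * mat 1 $ i $ j) \<longlongrightarrow> 0) (at_right 0)" by (simp add: g_simps[OF x0U])
  show "((\<lambda>t::real. t ^ 3) \<longlongrightarrow> 0) (at_right 0)" by real_asymp
  show "\<forall>\<^sub>F t in at_right 0. ((\<lambda>t. H t $ i $ j - t * mat 1 $ i $ j) has_real_derivative
      L t $ i $ j - R t $ i $ j - mat 1 $ i $ j) (at t)"
    using ev_I
  proof eventually_elim
    case (elim t)
    then have t: "t \<in> I" by auto
    from DERIV_diff[OF dH[OF t] DERIV_cmult_right[OF DERIV_ident]] show ?case by simp
  qed
  show "\<forall>\<^sub>F t::real in at_right 0. ((\<lambda>t. t ^ 3) has_real_derivative 3 * t\<^sup>2) (at t)"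
    by (auto intro!: always_eventually derivative_eq_intros)
  have "((\<lambda>t. ((L t $ i $ j - mat 1 $ i $ j) / t\<^sup>2 - R t $ i $ j / t\<^sup>2) / 3) \<longlongrightarrow>
      (- R0 $ i $ j - R0 $ i $ j) / 3) (at_right 0)"
    by (intro tendsto_intros lim_L lim_R) auto
  moreover have "(L t $ i $ j - R t $ i $ j - mat 1 $ i $ j) / (3 * t\<^sup>2) =
      ((L t $ i $ j - mat 1 $ i $ j) / t\<^sup>2 - R t $ i $ j / t\<^sup>2) / 3" for t
    by (simp add: diff_divide_distrib mult.commute)
  ultimately have "((\<lambda>t. (L t $ i $ j - R t $ i $ j - mat 1 $ i $ j) / (3 * t\<^sup>2)) \<longlongrightarrow>
      (- R0 $ i $ j - R0 $ i $ j) / 3) (at_right 0)"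
    by (simp only:)
  then show "((\<lambda>t. (L t $ i $ j - R t $ i $ j - mat 1 $ i $ j) / (3 * t\<^sup>2)) \<longlongrightarrow> - 2 / 3 * R0 $ i $ j) (at_right 0)"
    by simp
qed (use eventually_at_right_less[of "0::real"] in \<open>auto elim: eventually_mono\<close>)

lemma lim_G: "((\<lambda>t. (G t $ i $ j - t\<^sup>2 * mat 1 $ i $ j) / t ^ 4) \<longlongrightarrow> - 1 / 3 * R0 $ i $ j) (at_right 0)"
proof (rule lhopital_right_0)
  have "((\<lambda>t. G t $ i $ j - t\<^sup>2 * mat 1 $ i $ j) \<longlongrightarrow> g (x 0) 0 0 - 0\<^sup>2 * mat 1 $ i $ j) (at_right 0)"
    unfolding G_def vec_lambda_beta
    by (intro tendsto_diff tendsto_mult tendsto_power tendsto_ident_at tendsto_const lim_g lim_J_zero)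
  then show "((\<lambda>t. G t $ i $ j - t\<^sup>2 * mat 1 $ i $ j) \<longlongrightarrow> 0) (at_right 0)" by (simp add: g_simps[OF x0U])
  show "((\<lambda>t::real. t ^ 4) \<longlongrightarrow> 0) (at_right 0)" by real_asymp
  show "\<forall>\<^sub>F t in at_right 0. ((\<lambda>t. G t $ i $ j - t\<^sup>2 * mat 1 $ i $ j) has_real_derivative
      2 * H t $ i $ j - 2 * t * mat 1 $ i $ j) (at t)"
    using ev_I
  proof eventually_elim
    case (elim t)
    then have t: "t \<in> I" by auto
    have "((\<lambda>t. t\<^sup>2) has_real_derivative 2 * t) (at t)" by (auto intro!: derivative_eq_intros)
    from DERIV_diff[OF dG[OF t] DERIV_cmult_right[OF this]] show ?case by simp
  qed
  show "\<forall>\<^sub>F t::real in at_right 0. ((\<lambda>t. t ^ 4) has_real_derivative 4 * t ^ 3) (at t)"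
    by (auto intro!: always_eventually derivative_eq_intros)
  have "((\<lambda>t. (H t $ i $ j - t * mat 1 $ i $ j) / t ^ 3 / 2) \<longlongrightarrow> (- 2 / 3 * R0 $ i $ j) / 2) (at_right 0)"
    by (intro tendsto_intros lim_H) auto
  moreover have "(2 * H t $ i $ j - 2 * t * mat 1 $ i $ j) / (4 * t ^ 3) =
      (H t $ i $ j - t * mat 1 $ i $ j) / t ^ 3 / 2" for t
    by (cases "t = 0") (simp_all add: field_simps)
  ultimately have "((\<lambda>t. (2 * H t $ i $ j - 2 * t * mat 1 $ i $ j) / (4 * t ^ 3)) \<longlongrightarrow>
      (- 2 / 3 * R0 $ i $ j) / 2) (at_right 0)"
    by (simp only:)
  then show "((\<lambda>t. (2 * H t $ i $ j - 2 * t * mat 1 $ i $ j) / (4 * t ^ 3)) \<longlongrightarrow> - 1 / 3 * R0 $ i $ j) (at_right 0)"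
    by simp
qed (use eventually_at_right_less[of "0::real"] in \<open>auto elim: eventually_mono\<close>)

text \<open>Division by t^2 turns \<open>G\<close> into a perturbation of the identity, so its
  determinant sees the trace of \<open>R0\<close>, the Ricci curvature in the direction
  \<open>\<theta>\<close>.\<close>

lemma ricci_limit:
  "((\<lambda>t. (det (G t) / t ^ (2 * CARD('n)) - 1) / t\<^sup>2) \<longlongrightarrow> - trace R0 / 3) (at_right 0)"
proof -
  let ?N = "\<lambda>t. (1 / t\<^sup>2) *\<^sub>R G t"
  have "((\<lambda>t. (1 / t\<^sup>2) *\<^sub>R (?N t - mat 1)) \<longlongrightarrow> (- 1 / 3) *\<^sub>R R0) (at_right 0)"
  proof (intro vec_tendstoI)
    fix i j
    show "((\<lambda>t. ((1 / t\<^sup>2) *\<^sub>R (?N t - mat 1)) $ i $ j) \<longlongrightarrow> ((- 1 / 3) *\<^sub>R R0) $ i $ j) (at_right 0)"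
    proof (rule Lim_transform_eventually)
      show "((\<lambda>t. (G t $ i $ j - t\<^sup>2 * mat 1 $ i $ j) / t ^ 4) \<longlongrightarrow> ((- 1 / 3) *\<^sub>R R0) $ i $ j) (at_right 0)"
        using lim_G[of i j] by simp
      show "\<forall>\<^sub>F t in at_right 0. (G t $ i $ j - t\<^sup>2 * mat 1 $ i $ j) / t ^ 4 =
          ((1 / t\<^sup>2) *\<^sub>R (?N t - mat 1)) $ i $ j"
        using eventually_at_right_less[of "0::real"]
        by eventually_elim (simp add: field_simps power4_eq_xxxx power2_eq_square)
    qed
  qed
  from det_perturbation_limit[OF this]
  have "((\<lambda>t. (det (?N t) - 1) / t\<^sup>2) \<longlongrightarrow> - trace R0 / 3) (at_right 0)"
    unfolding trace_scaleR by simp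
  moreover have "det (?N t) = det (G t) / t ^ (2 * CARD('n))" for t
  proof -
    have "?N t = (\<chi> i. (1 / t\<^sup>2) *s (G t $ i))" by (simp add: vec_eq_iff)
    then have "det (?N t) = (1 / t\<^sup>2) ^ CARD('n) * det (G t)"
      by (subst \<open>?N t = _\<close>, subst det_rows_mul) simp
    then show ?thesis by (simp add: power_divide power_mult)
  qed
  ultimately show ?thesis by simp
qed

lemma radial_curvature:
  assumes "\<forall>\<^sub>F t in at_right 0. G t = t\<^sup>2 *\<^sub>R outer th th + F t *\<^sub>R (mat 1 - outer th th)"
    and "((\<lambda>t. (F t - t\<^sup>2) / t ^ 4) \<longlongrightarrow> - \<kappa> / 3) (at_right 0)"
  shows "R0 = \<kappa> *\<^sub>R (mat 1 - outer th th)"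
proof -
  have "R0 $ i $ j = (\<kappa> *\<^sub>R (mat 1 - outer th th)) $ i $ j" for i j
  proof -
    let ?p = "(mat 1 - outer th th) $ i $ j"
    have "((\<lambda>t. (F t - t\<^sup>2) / t ^ 4 * ?p) \<longlongrightarrow> - \<kappa> / 3 * ?p) (at_right 0)"
      by (intro tendsto_intros assms(2))
    moreover have "\<forall>\<^sub>F t in at_right 0. (F t - t\<^sup>2) / t ^ 4 * ?p = (G t $ i $ j - t\<^sup>2 * mat 1 $ i $ j) / t ^ 4"
      using assms(1)
    proof eventually_elim
      case (elim t)
      show ?case unfolding elim by (simp add: diff_divide_distrib add_divide_distrib algebra_simps)
    qed
    ultimately have "((\<lambda>t. (G t $ i $ j - t\<^sup>2 * mat 1 $ i $ j) / t ^ 4) \<longlongrightarrow> - \<kappa> / 3 * ?p) (at_right 0)"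
      by (rule Lim_transform_eventually)
    from tendsto_unique[OF _ this lim_G] show ?thesis by simp
  qed
  then show ?thesis by (simp add: vec_eq_iff)
qed

section \<open>The traced Riccati equation in Gram form\<close>

lemma gram_coordinates:
  assumes t: "t \<in> I"
  obtains B C and e :: "'n \<Rightarrow> real ^ 'n" where
    "\<And>k l. g (x t) (e k) (e l) = (if k = l then 1 else 0)"
    "G t = B ** transpose B" "H t = C ** transpose B" "L t = C ** transpose C"
    "R t = B ** (\<chi> k l. g (x t) (Rm (x t) (e k) (v t) (v t)) (e l)) ** transpose B"
proof -
  note xt = xU[OF t]
  \<comment> \<open>The basis is chosen at the single time \<open>t\<close>, without regularity in
    \<open>t\<close>: only matrices that do not involve it are differentiated later.\<close>
  obtain e :: "'n \<Rightarrow> real ^ 'n" where e: "\<And>k l. g (x t) (e k) (e l) = (if k = l then 1 else 0)"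
    using orthonormal_basis_exists[OF xt] by blast
  let ?B = "\<chi> i k. g (x t) (J i t) (e k)" and ?C = "\<chi> i k. g (x t) (K i t) (e k)"
  let ?\<rho> = "\<chi> k l. g (x t) (Rm (x t) (e k) (v t) (v t)) (e l)"
  show ?thesis
  proof (rule that[OF e])
    show "G t = ?B ** transpose ?B" "H t = ?C ** transpose ?B" "L t = ?C ** transpose ?C"
      unfolding G_def H_def L_def by (rule gram_factorization[OF xt e])+
    have "R t $ i $ j = (?B ** ?\<rho> ** transpose ?B) $ i $ j" for i j
    proof -
      have "Rm (x t) (J i t) (v t) (v t) = (\<Sum>k\<in>UNIV. g (x t) (J i t) (e k) *\<^sub>R Rm (x t) (e k) (v t) (v t))"
        by (subst orthonormal_expansion[OF xt e, of "J i t"])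
          (simp add: linear_sum[OF curvature_linear(1)[OF xt]] linear_scale[OF curvature_linear(1)[OF xt]])
      then have "R t $ i $ j = (\<Sum>l\<in>UNIV. (\<Sum>k\<in>UNIV. g (x t) (J i t) (e k) *
          g (x t) (Rm (x t) (e k) (v t) (v t)) (e l)) * g (x t) (J j t) (e l))"
        unfolding R_def using parseval[OF xt e, of "Rm (x t) (J i t) (v t) (v t)" "J j t"]
        by (simp add: linear_sum[OF g_linear(1)[OF xt]] g_simps[OF xt])
      then show ?thesis by (simp add: matrix_matrix_mult_def transpose_def)
    qed
    then show "R t = ?B ** ?\<rho> ** transpose ?B" by (simp add: vec_eq_iff)
  qed
qed

text \<open>Half the logarithmic derivative of det G is the trace of G^(-1) H, which is a + 1/t.
  Differentiating once more yields the trace of its square as 1/t^2 - a' - \<kappa>, and this is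
  inserted into the shape operator inequality.\<close>

lemma riccati_inequality:
  assumes det: "\<And>t. t \<in> {0<..<s} \<Longrightarrow> det (G t) = t\<^sup>2 * (\<Theta> t)\<^sup>2" and pos: "\<And>t. t \<in> {0<..<s} \<Longrightarrow> \<Theta> t \<noteq> 0"
    and \<Theta>: "\<And>t. t \<in> {0<..<s} \<Longrightarrow> (\<Theta> has_real_derivative \<Theta> t * a t) (at t)"
    and a: "\<And>t. t \<in> {0<..<s} \<Longrightarrow> (a has_real_derivative a' t) (at t)"
    and ric: "\<And>t e. t \<in> {0<..<s} \<Longrightarrow> (\<And>k l. g (x t) (e k) (e l) = (if k = l then 1 else 0)) \<Longrightarrow>
       (\<Sum>k\<in>UNIV. g (x t) (Rm (x t) (e (k :: 'n)) (v t) (v t)) (e k)) = \<kappa>"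
    and t: "t \<in> {0<..<s}"
  shows "0 \<le> - a' t - \<kappa> + \<phi>\<^sup>2 * (real CARD('n) - 1) - 2 * \<phi> * a t"
    "- a' t - \<kappa> + \<phi>\<^sup>2 * (real CARD('n) - 1) - 2 * \<phi> * a t = 0 \<Longrightarrow>
       H t = t *\<^sub>R outer th th + \<phi> *\<^sub>R (G t - t\<^sup>2 *\<^sub>R outer th th)"
proof -
  let ?n = "real CARD('n) - 1"
  let ?I = "{0<..<s}"
  have sub: "t \<in> I" if "t \<in> ?I" for t using that by auto
  have dn: "det (G t) \<noteq> 0" if "t \<in> ?I" for t using det[OF that] pos[OF that] that by simp
  \<comment> \<open>All properties are collected in one predicate, so that a single choice turns the
    pointwise inverses into a function \<open>Gi\<close> of time that can be differentiated.\<close>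
  define Q where "Q t Gi \<longleftrightarrow> Gi ** G t = mat 1 \<and> trace (Gi ** L t) = trace (Gi ** H t ** Gi ** H t) \<and>
      trace (Gi ** R t) = \<kappa> \<and>
      (\<forall>\<phi>. 0 \<le> trace (Gi ** H t ** Gi ** H t) - 1 / t\<^sup>2 + \<phi>\<^sup>2 * ?n - 2 * \<phi> * (trace (Gi ** H t) - 1 / t)) \<and>
      (\<forall>\<phi>. trace (Gi ** H t ** Gi ** H t) - 1 / t\<^sup>2 + \<phi>\<^sup>2 * ?n - 2 * \<phi> * (trace (Gi ** H t) - 1 / t) = 0 \<longrightarrow>
         H t = t *\<^sub>R outer th th + \<phi> *\<^sub>R (G t - t\<^sup>2 *\<^sub>R outer th th))" for t Gi
  have "\<exists>Gi. Q t Gi" if True: "t \<in> ?I" for t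
  proof -
    obtain B C and e :: "'n \<Rightarrow> real ^ 'n" where
      e: "\<And>k l. g (x t) (e k) (e l) = (if k = l then 1 else 0)"
      and BC: "G t = B ** transpose B" "H t = C ** transpose B" "L t = C ** transpose C"
        "R t = B ** (\<chi> k l. g (x t) (Rm (x t) (e k) (v t) (v t)) (e l)) ** transpose B"
      by (rule gram_coordinates[OF sub[OF True]], rule that)
    have tr: "trace (\<chi> k l. g (x t) (Rm (x t) (e k) (v t) (v t)) (e l)) = \<kappa>"
      using ric[OF True e] by (simp add: trace_def)
    have t0: "t \<noteq> 0" using True by simp
    show ?thesis
    proof (rule shape_operator_inequality[OF BC(1,2) H_transpose[OF sub[OF True]] BC(3,4) dn[OF True]
            G_th[OF True] H_th[OF True] th_unit t0, unfolded tr], goal_cases)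
      case (1 Gi)
      show ?case unfolding Q_def by (intro exI[of _ Gi] conjI allI impI 1)
    qed
  qed
  then obtain Gi where Gi': "\<And>t. t \<in> ?I \<Longrightarrow> Q t (Gi t)" by metis
  have Gi: "\<And>t. t \<in> ?I \<Longrightarrow> Gi t ** G t = mat 1"
    and GL: "\<And>t. t \<in> ?I \<Longrightarrow> trace (Gi t ** L t) = trace (Gi t ** H t ** Gi t ** H t)"
    and GR: "\<And>t. t \<in> ?I \<Longrightarrow> trace (Gi t ** R t) = \<kappa>"
    and ge: "\<And>t \<phi>. t \<in> ?I \<Longrightarrow> 0 \<le> trace (Gi t ** H t ** Gi t ** H t) - 1 / t\<^sup>2 + \<phi>\<^sup>2 * ?n
        - 2 * \<phi> * (trace (Gi t ** H t) - 1 / t)"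
    and eq: "\<And>t \<phi>. t \<in> ?I \<Longrightarrow> trace (Gi t ** H t ** Gi t ** H t) - 1 / t\<^sup>2 + \<phi>\<^sup>2 * ?n
        - 2 * \<phi> * (trace (Gi t ** H t) - 1 / t) = 0 \<Longrightarrow>
         H t = t *\<^sub>R outer th th + \<phi> *\<^sub>R (G t - t\<^sup>2 *\<^sub>R outer th th)"
    using Gi' unfolding Q_def by blast+
  \<comment> \<open>Jacobi's formula is compared with the derivative of the prescribed
    determinant.\<close>
  have q: "trace (Gi t ** H t) = a t + 1 / t" if t: "t \<in> ?I" for t
  proof -
    have "((\<lambda>s. det (G s)) has_real_derivative det (G t) * trace (Gi t ** (2 *\<^sub>R H t))) (at t)"
      by (rule det_has_real_derivative[OF dG_matrix[OF sub[OF t]] Gi[OF t]])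
    moreover have "((\<lambda>s. det (G s)) has_real_derivative 2 * t * (\<Theta> t)\<^sup>2 + t\<^sup>2 * (2 * \<Theta> t * (\<Theta> t * a t))) (at t)"
    proof (rule has_field_derivative_transform_within_open[where S="?I"])
      show "((\<lambda>t. t\<^sup>2 * (\<Theta> t)\<^sup>2) has_real_derivative 2 * t * (\<Theta> t)\<^sup>2 + t\<^sup>2 * (2 * \<Theta> t * (\<Theta> t * a t))) (at t)"
        using \<Theta>[OF t] by (auto intro!: derivative_eq_intros)
    qed (use det t in auto)
    ultimately have "det (G t) * trace (Gi t ** (2 *\<^sub>R H t)) = 2 * t * (\<Theta> t)\<^sup>2 + t\<^sup>2 * (2 * \<Theta> t * (\<Theta> t * a t))"
      by (rule DERIV_unique)
    then have "t\<^sup>2 * (\<Theta> t)\<^sup>2 * (2 * trace (Gi t ** H t)) = t\<^sup>2 * (\<Theta> t)\<^sup>2 * (2 * (a t + 1 / t))"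
      using t by (simp add: det[OF t] matrix_bilinear_simps trace_scaleR field_simps power2_eq_square)
    then show ?thesis using t pos[OF t] by simp
  qed
  have tr2: "trace (Gi t ** H t ** Gi t ** H t) = 1 / t\<^sup>2 - a' t - \<kappa>"
  proof -
    have dGi: "(Gi has_vector_derivative - (Gi t ** (2 *\<^sub>R H t) ** Gi t)) (at t)"
    proof (rule matrix_inverse_has_vector_derivative[of ?I t G "\<lambda>t. 2 *\<^sub>R H t" Gi])
      show "continuous_on ?I (\<lambda>t. 2 *\<^sub>R H t)"
        by (intro continuous_intros continuous_on_subset[OF H_continuous]) auto
    qed (use t dG_matrix sub Gi in auto)
    have bt: "bounded_linear (trace :: real^'n^'n \<Rightarrow> real)"
      unfolding linear_conv_bounded_linear[symmetric]
      by (rule linearI) (simp_all add: trace_add trace_scaleR)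
    have X: "- (Gi t ** (2 *\<^sub>R H t) ** Gi t) ** H t = - 2 *\<^sub>R (Gi t ** H t ** Gi t ** H t)"
      by (simp add: matrix_bilinear_simps bounded_bilinear.minus_left[OF bounded_bilinear_matrix_mult])
    have "((\<lambda>t. trace (Gi t ** H t)) has_vector_derivative
        trace (Gi t ** (L t - R t) + - (Gi t ** (2 *\<^sub>R H t) ** Gi t) ** H t)) (at t)"
      by (intro bounded_linear.has_vector_derivative[OF bt]
          bounded_bilinear.has_vector_derivative[OF bounded_bilinear_matrix_mult dGi dH_matrix[OF sub[OF t]]])
    \<comment> \<open>The product rule leaves the square with factor -2, and \<open>GL\<close>
      supplies it once with factor 1.\<close>
    moreover have "trace (Gi t ** (L t - R t) + - (Gi t ** (2 *\<^sub>R H t) ** Gi t) ** H t) =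
        - trace (Gi t ** H t ** Gi t ** H t) - \<kappa>"
      unfolding X unfolding trace_add trace_scaleR matrix_bilinear_simps trace_sub GL[OF t] GR[OF t] by simp
    ultimately have "((\<lambda>t. trace (Gi t ** H t)) has_real_derivative
        - trace (Gi t ** H t ** Gi t ** H t) - \<kappa>) (at t)"
      unfolding has_real_derivative_iff_has_vector_derivative by (simp only:)
    moreover have "((\<lambda>t. trace (Gi t ** H t)) has_real_derivative a' t - 1 / t\<^sup>2) (at t)"
    proof (rule has_field_derivative_transform_within_open[where S="?I"])
      show "((\<lambda>t. a t + 1 / t) has_real_derivative a' t - 1 / t\<^sup>2) (at t)"
        using a[OF t] t by (auto intro!: derivative_eq_intros simp: power2_eq_square)
    qed (use q t in auto)
    ultimately have "- trace (Gi t ** H t ** Gi t ** H t) - \<kappa> = a' t - 1 / t\<^sup>2" by (rule DERIV_unique)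
    then show ?thesis by simp
  qed
  show "0 \<le> - a' t - \<kappa> + \<phi>\<^sup>2 * ?n - 2 * \<phi> * a t"
    using ge[OF t, of \<phi>] by (simp add: tr2 q[OF t])
  show "H t = t *\<^sub>R outer th th + \<phi> *\<^sub>R (G t - t\<^sup>2 *\<^sub>R outer th th)"
    if "- a' t - \<kappa> + \<phi>\<^sup>2 * ?n - 2 * \<phi> * a t = 0"
    by (rule eq[OF t]) (use that in \<open>simp add: tr2 q[OF t]\<close>)
qed

end

section \<open>The model densities\<close>

text \<open>A pair with C' = -\<epsilon> S and C^2 + \<epsilon> S^2 = 1 treats both signs at once.
  The interval (0, 1) lies in (0, \<pi>/2), where sin and cos are positive. The last two limits
  carry the curvatures: S C is half of S(2t), whence 4 \<epsilon>.\<close>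

lemma model_functions:
  fixes \<epsilon> :: int
  assumes "\<epsilon> \<in> {1, -1}"
  obtains S C :: "real \<Rightarrow> real" where
    "\<And>m k r. model_density \<epsilon> m k r = S r powi (m - 1) * C r powi k"
    "\<And>t. (S has_real_derivative C t) (at t)" "\<And>t. (C has_real_derivative - of_int \<epsilon> * S t) (at t)"
    "\<And>t. (C t)\<^sup>2 + of_int \<epsilon> * (S t)\<^sup>2 = 1"
    "\<And>t. t \<in> {0<..<1} \<Longrightarrow> S t > 0" "\<And>t. t \<in> {0<..<1} \<Longrightarrow> C t > 0"
    "((\<lambda>t. (S t / t - 1) / t\<^sup>2) \<longlongrightarrow> - of_int \<epsilon> / 6) (at_right 0)"
    "((\<lambda>t. (C t - 1) / t\<^sup>2) \<longlongrightarrow> - of_int \<epsilon> / 2) (at_right 0)"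
    "((\<lambda>t. ((S t)\<^sup>2 - t\<^sup>2) / t ^ 4) \<longlongrightarrow> - of_int \<epsilon> / 3) (at_right 0)"
    "((\<lambda>t. ((S t * C t)\<^sup>2 - t\<^sup>2) / t ^ 4) \<longlongrightarrow> - (4 * of_int \<epsilon>) / 3) (at_right 0)"
proof (cases "\<epsilon> = 1")
  case True
  show ?thesis
  proof (rule that[of sin cos])
    show "cos t > 0" if "t \<in> {0<..<1}" for t :: real
      using that pi_gt3 by (intro cos_gt_zero_pi) auto
    show "sin t > 0" if "t \<in> {0<..<1}" for t :: real
      using that pi_gt3 by (intro sin_gt_zero) auto
    show "((\<lambda>t::real. (sin t / t - 1) / t\<^sup>2) \<longlongrightarrow> - of_int \<epsilon> / 6) (at_right 0)"
      unfolding True of_int_1 by real_asymp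
    show "((\<lambda>t::real. (cos t - 1) / t\<^sup>2) \<longlongrightarrow> - of_int \<epsilon> / 2) (at_right 0)"
      unfolding True of_int_1 by real_asymp
    show "((\<lambda>t::real. ((sin t)\<^sup>2 - t\<^sup>2) / t ^ 4) \<longlongrightarrow> - of_int \<epsilon> / 3) (at_right 0)"
      unfolding True of_int_1 by real_asymp
    show "((\<lambda>t::real. ((sin t * cos t)\<^sup>2 - t\<^sup>2) / t ^ 4) \<longlongrightarrow> - (4 * of_int \<epsilon>) / 3) (at_right 0)"
      unfolding True of_int_1 by real_asymp
  qed (auto simp: True model_density_def intro!: derivative_eq_intros)
next
  case False
  then have e: "\<epsilon> = -1" using assms by simp
  show ?thesis
  proof (rule that[of sinh cosh])
    show "((\<lambda>t::real. (sinh t / t - 1) / t\<^sup>2) \<longlongrightarrow> - of_int \<epsilon> / 6) (at_right 0)"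
      unfolding e of_int_minus of_int_1 by real_asymp
    show "((\<lambda>t::real. (cosh t - 1) / t\<^sup>2) \<longlongrightarrow> - of_int \<epsilon> / 2) (at_right 0)"
      unfolding e of_int_minus of_int_1 by real_asymp
    show "((\<lambda>t::real. ((sinh t)\<^sup>2 - t\<^sup>2) / t ^ 4) \<longlongrightarrow> - of_int \<epsilon> / 3) (at_right 0)"
      unfolding e of_int_minus of_int_1 by real_asymp
    show "((\<lambda>t::real. ((sinh t * cosh t)\<^sup>2 - t\<^sup>2) / t ^ 4) \<longlongrightarrow> - (4 * of_int \<epsilon>) / 3) (at_right 0)"
      unfolding e of_int_minus of_int_1 by real_asymp
  qed (auto simp: e model_density_def cosh_square_eq intro!: derivative_eq_intros)
qed

text \<open>An expansion 1 + A t^2 + o(t^2). Such coefficients add under products and are multiplied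
  by the exponent under integer powers, negative ones included; \<open>k\<close> is not known to be
  nonnegative at this stage.\<close>

definition second_order :: "(real \<Rightarrow> real) \<Rightarrow> real \<Rightarrow> bool" where
  "second_order a A \<longleftrightarrow> ((\<lambda>t. (a t - 1) / t\<^sup>2) \<longlongrightarrow> A) (at_right 0)"

lemma second_order_tendsto_1:
  assumes "second_order a A" shows "(a \<longlongrightarrow> 1) (at_right 0)"
proof -
  have "((\<lambda>t. (a t - 1) / t\<^sup>2 * t\<^sup>2 + 1) \<longlongrightarrow> A * 0\<^sup>2 + 1) (at_right 0)"
    using assms unfolding second_order_def by (intro tendsto_intros)
  then have "((\<lambda>t. (a t - 1) / t\<^sup>2 * t\<^sup>2 + 1) \<longlongrightarrow> 1) (at_right 0)" by simp
  then show ?thesis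
    by (rule Lim_transform_eventually)
      (use eventually_at_right_less[of "0::real"] in \<open>eventually_elim, simp\<close>)
qed

lemma second_order_mult:
  assumes "second_order a A" "second_order b B" shows "second_order (\<lambda>t. a t * b t) (A + B)"
proof -
  have "((\<lambda>t. (a t - 1) / t\<^sup>2 * b t + (b t - 1) / t\<^sup>2) \<longlongrightarrow> A * 1 + B) (at_right 0)"
    using assms second_order_tendsto_1[OF assms(2)] unfolding second_order_def by (intro tendsto_intros)
  moreover have "(a t - 1) / t\<^sup>2 * b t + (b t - 1) / t\<^sup>2 = (a t * b t - 1) / t\<^sup>2" for t
    by (simp add: add_divide_distrib[symmetric] algebra_simps)
  ultimately show ?thesis unfolding second_order_def by simp
qed

lemma second_order_inverse:
  assumes "second_order a A" shows "second_order (\<lambda>t. inverse (a t)) (- A)"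
proof -
  have a1: "(a \<longlongrightarrow> 1) (at_right 0)" by (rule second_order_tendsto_1[OF assms])
  have "((\<lambda>t. - ((a t - 1) / t\<^sup>2) * inverse (a t)) \<longlongrightarrow> - A * inverse 1) (at_right 0)"
    using assms a1 unfolding second_order_def by (intro tendsto_intros) auto
  then have "((\<lambda>t. - ((a t - 1) / t\<^sup>2) * inverse (a t)) \<longlongrightarrow> - A) (at_right 0)" by simp
  then show ?thesis
    unfolding second_order_def
  proof (rule Lim_transform_eventually)
    show "\<forall>\<^sub>F t in at_right 0. - ((a t - 1) / t\<^sup>2) * inverse (a t) = (inverse (a t) - 1) / t\<^sup>2"
      using tendsto_imp_eventually_ne[OF a1 one_neq_zero]
    proof eventually_elim
      case (elim t)
      then have "- (a t - 1) * inverse (a t) = inverse (a t) - 1" by (simp add: left_diff_distrib)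
      moreover have "- ((a t - 1) / t\<^sup>2) * inverse (a t) = - (a t - 1) * inverse (a t) / t\<^sup>2"
        by (simp only: mult_minus_left times_divide_eq_left minus_divide_left)
      ultimately show ?case by (simp only:)
    qed
  qed
qed

lemma second_order_power:
  assumes "second_order a A" shows "second_order (\<lambda>t. a t ^ n) (of_nat n * A)"
proof (induction n)
  case 0
  then show ?case by (simp add: second_order_def)
next
  case (Suc n)
  from second_order_mult[OF assms Suc] show ?case by (simp add: algebra_simps)
qed

lemma second_order_powi:
  assumes "second_order a A" shows "second_order (\<lambda>t. a t powi k) (of_int k * A)"
proof (cases "k \<ge> 0")
  case True
  then show ?thesis using second_order_power[OF assms, of "nat k"] by (simp add: power_int_def)
next
  case False
  then show ?thesis
    using second_order_power[OF second_order_inverse[OF assms], of "nat (- k)"] by (simp add: power_int_def)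
qed

lemma model_second_order:
  fixes m k :: int
  assumes S: "second_order (\<lambda>t. S t / t) A" and C: "second_order C B" and m: "m \<ge> 1"
  shows "second_order (\<lambda>t. (S t powi (m - 1) * C t powi k)\<^sup>2 / t ^ (2 * nat (m - 1)))
    (2 * (of_int m - 1) * A + 2 * of_int k * B)"
proof -
  have "second_order (\<lambda>t. (S t / t) ^ (2 * nat (m - 1)) * C t powi (2 * k))
     (of_nat (2 * nat (m - 1)) * A + of_int (2 * k) * B)"
    by (intro second_order_mult second_order_power second_order_powi S C)
  moreover have "(S t / t) ^ (2 * nat (m - 1)) * C t powi (2 * k) =
      (S t powi (m - 1) * C t powi k)\<^sup>2 / t ^ (2 * nat (m - 1))" for t
  proof -
    have "C t powi (2 * k) = (C t powi k)\<^sup>2"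
      by (simp add: power_int_mult[of _ k 2, simplified] mult.commute[of 2 k])
    moreover have "S t powi (m - 1) = S t ^ nat (m - 1)" using m by (simp add: power_int_def)
    ultimately show ?thesis
      by (simp add: power_divide power_mult_distrib power_mult[symmetric] mult.commute)
  qed
  ultimately show ?thesis using m by simp
qed

section \<open>Harmonic spaces with a model density\<close>

context riem_chart begin

text \<open>Parseval in \<open>f\<close>, exchange by self-adjointness, Parseval in
  \<open>e\<close>. The frame in the density is fixed by choice, while the Ricci trace is wanted for
  an arbitrary orthonormal basis.\<close>

lemma trace_frame_independent:
  fixes e f :: "'n \<Rightarrow> real ^ 'n"
  assumes x: "x \<in> U" and e: "\<And>i j. g x (e i) (e j) = (if i = j then 1 else 0)"
    and f: "\<And>i j. g x (f i) (f j) = (if i = j then 1 else 0)"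
    and T: "\<And>a b. g x (T a) b = g x (T b) a"
  shows "(\<Sum>i\<in>UNIV. g x (T (e i)) (e i)) = (\<Sum>i\<in>UNIV. g x (T (f i)) (f i))"
proof -
  have "(\<Sum>i\<in>UNIV. g x (T (e i)) (e i)) = (\<Sum>i\<in>UNIV. \<Sum>j\<in>UNIV. g x (T (e i)) (f j) * g x (e i) (f j))"
    by (intro sum.cong refl parseval[OF x f])
  also have "\<dots> = (\<Sum>j\<in>UNIV. \<Sum>i\<in>UNIV. g x (T (f j)) (e i) * g x (f j) (e i))"
    by (subst sum.swap) (intro sum.cong refl arg_cong2[of _ _ _ _ "(*)"] T g_sym[OF x])
  also have "\<dots> = (\<Sum>j\<in>UNIV. g x (T (f j)) (f j))"
    by (intro sum.cong refl parseval[OF x e, symmetric])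
  finally show ?thesis .
qed

text \<open>The bound \<open>\<sigma>\<close> allows the interval to be cut down to where the
  density agrees with the model and the model functions are positive.\<close>

lemma jacobi_frame_exists:
  assumes P: "P \<in> dom_of c" and dens: "density_function M \<Theta>" and \<theta>: "g (coord c P) \<theta> \<theta> = 1"
    and \<sigma>: "\<sigma> > 0"
  obtains s x v J K f where "jacobi_frame M c s x v J K f \<theta>" "s \<le> \<sigma>" "x 0 = coord c P"
    "\<And>t. t \<in> {0<..<s} \<Longrightarrow> det (\<chi> i j. g (x t) (J i t) (J j t)) = t\<^sup>2 * (\<Theta> t)\<^sup>2"
proof -
  have x0: "coord c P \<in> U" using P by (auto simp: U_def)
  show ?thesis
  proof (rule density_jacobi[OF P dens \<theta>], goal_cases)
    case (1 s x v J K f)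
    have sub: "{- min s \<sigma><..<min s \<sigma>} \<subseteq> {-s<..<s}" by auto
    show ?case
    proof (rule that[of "min s \<sigma>" x v "\<lambda>i t. J t (f i)" "\<lambda>i t. K t (f i)" f])
      show "jacobi_frame M c (min s \<sigma>) x v (\<lambda>i t. J t (f i)) (\<lambda>i t. K t (f i)) f \<theta>"
      proof unfold_locales
        fix t assume "t \<in> {0<..<min s \<sigma>}"
        then have t: "t \<in> {0<..<s}" by auto
        have "J t \<theta> = J t (\<Sum>i\<in>UNIV. g (coord c P) \<theta> (f i) *\<^sub>R f i)"
          using orthonormal_expansion[OF x0 1(2), of \<theta>] by simp
        also have "\<dots> = (\<Sum>i\<in>UNIV. g (coord c P) \<theta> (f i) *\<^sub>R J t (f i))"
          using 1(9)[OF t] by (simp add: linear_sum linear_scale)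
        finally show "(\<Sum>i\<in>UNIV. g (x 0) \<theta> (f i) *\<^sub>R J t (f i)) = t *\<^sub>R v t"
          using 1(10)[OF t] 1(4) by simp
      qed (use 1 \<sigma> \<theta> geodesic_in_chart_subset[OF 1(3) sub] jacobi_along_subset[OF 1(6) sub] in auto)
    qed (use 1 in auto)
  qed
qed

text \<open>The leading powers of det G, t^(2n) from the geometry and t^(2m) from the model, have to
  agree. Then so do the t^2 coefficients of the normalized determinants; the factor -6 is -3 from
  \<open>ricci_limit\<close> times 2 from squaring the density.\<close>

lemma ricci_of_density:
  fixes m k :: int and e :: "'n \<Rightarrow> real ^ 'n"
  assumes P: "P \<in> dom_of c" and dens: "density_function M \<Theta>" and \<theta>: "g (coord c P) \<theta> \<theta> = 1"
    and \<Theta>: "\<forall>\<^sub>F t in at_right 0. \<Theta> t = S t powi (m - 1) * C t powi k"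
    and S: "second_order (\<lambda>t. S t / t) A" and C: "second_order C B" and m: "m \<ge> 1"
    and e: "\<And>i j. g (coord c P) (e i) (e j) = (if i = j then 1 else 0)"
  shows "m = int CARD('n)"
    "(\<Sum>i\<in>UNIV. g (coord c P) (Rm (coord c P) (e i) \<theta> \<theta>) (e i)) = - 6 * ((of_int m - 1) * A + of_int k * B)"
proof -
  obtain s x v J K f where jf: "jacobi_frame M c s x v J K f \<theta>" and x0: "x 0 = coord c P"
    and det: "\<And>t. t \<in> {0<..<s} \<Longrightarrow> det (\<chi> i j. g (x t) (J i t) (J j t)) = t\<^sup>2 * (\<Theta> t)\<^sup>2"
    by (rule jacobi_frame_exists[OF P dens \<theta>, of 1]) auto
  interpret jf: jacobi_frame M c s x v J K f \<theta> by (rule jf)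
  let ?n = "CARD('n)" and ?m = "nat m"
  \<comment> \<open>The additional 2 is the radial factor t^2 in det G.\<close>
  have mm: "2 * ?m = 2 * nat (m - 1) + 2" using m by simp
  define h where "h t = (S t powi (m - 1) * C t powi k)\<^sup>2 / t ^ (2 * nat (m - 1))" for t
  have h: "second_order h (2 * (of_int m - 1) * A + 2 * of_int k * B)"
    unfolding h_def by (rule model_second_order[OF S C m])
  have lim: "second_order (\<lambda>t. det (jf.G t) / t ^ (2 * ?n)) (- trace jf.R0 / 3)"
    unfolding second_order_def by (rule jf.ricci_limit)
  have ev: "\<forall>\<^sub>F t in at_right 0. det (jf.G t) / t ^ (2 * ?n) = h t * (t ^ (2 * ?m) / t ^ (2 * ?n))"
    using jf.ev_I \<Theta> eventually_at_right_less[of "0::real"]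
  proof eventually_elim
    case (elim t)
    have "det (jf.G t) = t\<^sup>2 * (S t powi (m - 1) * C t powi k)\<^sup>2"
      using det[OF elim(1)] elim(2) by (simp add: jf.G_def)
    also have "\<dots> = h t * t ^ (2 * ?m)" using elim(3) unfolding mm h_def by (simp add: power_add power2_eq_square)
    finally show ?case by simp
  qed
  \<comment> \<open>Both normalized determinants tend to 1, which leaves a quotient of pure powers
    with limit 1.\<close>
  have ratio: "((\<lambda>t. t ^ (2 * ?m) / t ^ (2 * ?n)) \<longlongrightarrow> (1::real)) (at_right 0)"
  proof (rule Lim_transform_eventually)
    show "((\<lambda>t. det (jf.G t) / t ^ (2 * ?n) / h t) \<longlongrightarrow> 1) (at_right 0)"
      using tendsto_divide[OF second_order_tendsto_1[OF lim] second_order_tendsto_1[OF h]] by simp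
    show "\<forall>\<^sub>F t in at_right 0. det (jf.G t) / t ^ (2 * ?n) / h t = t ^ (2 * ?m) / t ^ (2 * ?n)"
      using ev tendsto_imp_eventually_ne[OF second_order_tendsto_1[OF h] one_neq_zero]
    proof eventually_elim
      case (elim t)
      show ?case unfolding elim(1) using elim(2) by simp
    qed
  qed
  have no: "\<not> ((\<lambda>t. t ^ a / t ^ b) \<longlongrightarrow> (1::real)) (at_right 0)" if "b < a" for a b :: nat
  proof
    assume one: "((\<lambda>t. t ^ a / t ^ b) \<longlongrightarrow> (1::real)) (at_right 0)"
    have "((\<lambda>t. t ^ a / t ^ b) \<longlongrightarrow> (0::real)) (at_right 0)"
    proof (rule Lim_transform_eventually)
      have "((\<lambda>t. t ^ (a - b)) \<longlongrightarrow> (0::real) ^ (a - b)) (at_right 0)" by (intro tendsto_intros)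
      then show "((\<lambda>t. t ^ (a - b)) \<longlongrightarrow> (0::real)) (at_right 0)" using that by (simp add: zero_power)
      show "\<forall>\<^sub>F t::real in at_right 0. t ^ (a - b) = t ^ a / t ^ b"
        using eventually_at_right_less[of "0::real"]
        by eventually_elim (use that in \<open>simp add: power_diff\<close>)
    qed
    from tendsto_unique[OF trivial_limit_at_right_real one this] show False by simp
  qed
  have "?m = ?n"
  proof (rule linorder_cases[of ?m ?n])
    assume "?n < ?m" then show ?thesis using no[of "2 * ?n" "2 * ?m"] ratio by simp
  next
    assume "?m < ?n"
    moreover have "((\<lambda>t. t ^ (2 * ?n) / t ^ (2 * ?m)) \<longlongrightarrow> (1::real)) (at_right 0)"
      using tendsto_inverse[OF ratio] by (simp add: field_simps)
    ultimately show ?thesis using no[of "2 * ?m" "2 * ?n"] by simp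
  qed auto
  then show mn: "m = int ?n" using m by simp
  have "\<forall>\<^sub>F t in at_right 0. (det (jf.G t) / t ^ (2 * ?n) - 1) / t\<^sup>2 = (h t - 1) / t\<^sup>2"
    using ev eventually_at_right_less[of "0::real"]
    by eventually_elim (simp add: mn)
  from Lim_transform_eventually[OF lim[unfolded second_order_def] this]
  have "- trace jf.R0 / 3 = 2 * (of_int m - 1) * A + 2 * of_int k * B"
    by (rule tendsto_unique[OF trivial_limit_at_right_real _ h[unfolded second_order_def]])
  moreover have "trace jf.R0 = (\<Sum>i\<in>UNIV. g (x 0) (Rm (x 0) (e i) \<theta> \<theta>) (e i))"
    unfolding jf.R0_def trace_def
    using trace_frame_independent[OF jf.x0U jf.frame e[folded x0], of "\<lambda>a. Rm (x 0) a \<theta> \<theta>"]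
      jacobi_operator_self_adjoint[OF jf.x0U] by simp
  ultimately show "(\<Sum>i\<in>UNIV. g (coord c P) (Rm (coord c P) (e i) \<theta> \<theta>) (e i)) =
      - 6 * ((of_int m - 1) * A + of_int k * B)"
    using x0 by (simp add: field_simps)
qed

text \<open>Both parts evaluate the Riccati inequality at the logarithmic derivative of S C^\<xi>.
  In the second part \<open>F\<close> is such a function, given through its differential equation,
  and \<open>\<kappa>\<close> is read off from the t^4 term of its square.\<close>

lemma model_density_rigidity:
  fixes m k :: int and \<epsilon> :: real and \<xi> :: real
  assumes P: "P \<in> dom_of c" and dens: "density_function M \<Theta>" and \<theta>: "g (coord c P) \<theta> \<theta> = 1"
    and \<Theta>: "\<forall>\<^sub>F t in at_right 0. \<Theta> t = S t powi (m - 1) * C t powi k" and m: "m \<ge> 1"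
    and dS: "\<And>t. (S has_real_derivative C t) (at t)" and dC: "\<And>t. (C has_real_derivative - \<epsilon> * S t) (at t)"
    and SC: "\<And>t. (C t)\<^sup>2 + \<epsilon> * (S t)\<^sup>2 = 1" and \<epsilon>: "\<epsilon>\<^sup>2 = 1"
    and pos: "\<And>t. t \<in> {0<..<1} \<Longrightarrow> S t > 0" "\<And>t. t \<in> {0<..<1} \<Longrightarrow> C t > 0"
    and S2: "second_order (\<lambda>t. S t / t) (- \<epsilon> / 6)" and C2: "second_order C (- \<epsilon> / 2)"
  shows "0 \<le> of_int k + (of_int m - 1) * \<xi>\<^sup>2 - 2 * \<xi> * of_int k"
    "of_int k + (of_int m - 1) * \<xi>\<^sup>2 - 2 * \<xi> * of_int k = 0 \<Longrightarrow>
     (\<And>t. t \<in> {0<..<1} \<Longrightarrow> (F has_real_derivative (C t / S t - \<epsilon> * \<xi> * (S t / C t)) * F t) (at t)) \<Longrightarrow>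
     (\<And>t. t \<in> {0<..<1} \<Longrightarrow> F t \<noteq> 0) \<Longrightarrow>
     ((\<lambda>t. ((F t)\<^sup>2 - t\<^sup>2) / t ^ 4) \<longlongrightarrow> - \<kappa> / 3) (at_right 0) \<Longrightarrow>
     g (coord c P) (Rm (coord c P) u \<theta> \<theta>) u = \<kappa> * (g (coord c P) u u - (g (coord c P) u \<theta>)\<^sup>2)"
proof -
  obtain b where b: "b > 0" "\<And>t. 0 < t \<Longrightarrow> t < b \<Longrightarrow> \<Theta> t = S t powi (m - 1) * C t powi k"
    using \<Theta> unfolding eventually_at_right_field by blast
  obtain s x v J K f where jf: "jacobi_frame M c s x v J K f \<theta>" and s: "s \<le> min 1 b" and x0: "x 0 = coord c P"
    and det: "\<And>t. t \<in> {0<..<s} \<Longrightarrow> det (\<chi> i j. g (x t) (J i t) (J j t)) = t\<^sup>2 * (\<Theta> t)\<^sup>2"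
    by (rule jacobi_frame_exists[OF P dens \<theta>, of "min 1 b"]) (use b in auto)
  interpret jf: jacobi_frame M c s x v J K f \<theta> by (rule jf)
  let ?I = "{0<..<s}"
  define \<Theta>' where "\<Theta>' t = S t powi (m - 1) * C t powi k" for t
  define a where "a t = (of_int m - 1) * (C t / S t) - \<epsilon> * of_int k * (S t / C t)" for t
  define a' where "a' t = - (of_int m - 1) / (S t)\<^sup>2 - \<epsilon> * of_int k / (C t)\<^sup>2" for t
  define \<phi> where "\<phi> t = C t / S t - \<epsilon> * \<xi> * (S t / C t)" for t
  define ric where "ric = \<epsilon> * (of_int m - 1 + 3 * of_int k)"
  have t1: "t \<in> {0<..<1}" if "t \<in> ?I" for t using that s by auto
  have p: "S t > 0" "C t > 0" if "t \<in> ?I" for t using pos t1[OF that] by blast+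
  have det': "det (jf.G t) = t\<^sup>2 * (\<Theta>' t)\<^sup>2" if "t \<in> ?I" for t
    using det[OF that] b(2)[of t] that s by (simp add: jf.G_def \<Theta>'_def)
  have \<Theta>'0: "\<Theta>' t \<noteq> 0" if "t \<in> ?I" for t using p[OF that] by (simp add: \<Theta>'_def)
  have d\<Theta>: "(\<Theta>' has_real_derivative \<Theta>' t * a t) (at t)" if "t \<in> ?I" for t
  proof -
    have "(\<Theta>' has_real_derivative (of_int (m - 1) * S t powi (m - 1 - 1) * C t) * C t powi k
        + S t powi (m - 1) * (of_int k * C t powi (k - 1) * (- \<epsilon> * S t))) (at t)"
      unfolding \<Theta>'_def using p[OF that] dS[of t] dC[of t]
      by (auto intro!: derivative_eq_intros)
    moreover have "S t powi (m - 1 - 1) = S t powi (m - 1) / S t" "C t powi (k - 1) = C t powi k / C t"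
      using p[OF that] power_int_diff[of "S t" "m - 1" 1] power_int_diff[of "C t" k 1] by auto
    ultimately show ?thesis by (simp add: \<Theta>'_def a_def algebra_simps diff_divide_distrib)
  qed
  have da: "(a has_real_derivative a' t) (at t)" if "t \<in> ?I" for t
  proof -
    note pt = p[OF that]
    have "(a has_real_derivative (of_int m - 1) * ((- \<epsilon> * S t * S t - C t * C t) / (S t * S t))
        - \<epsilon> * of_int k * ((C t * C t - S t * (- \<epsilon> * S t)) / (C t * C t))) (at t)"
      unfolding a_def using pt
      by (intro DERIV_diff DERIV_cmult DERIV_divide dS dC) auto
    moreover have "- \<epsilon> * S t * S t - C t * C t = - 1" "C t * C t - S t * (- \<epsilon> * S t) = 1"
      using SC[of t] by (simp_all add: power2_eq_square algebra_simps)
    ultimately show ?thesis by (simp add: a'_def power2_eq_square)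
  qed
  \<comment> \<open>The density hypothesis holds at every point, so the Ricci identity is applied
    with centre \<open>x t\<close> and unit vector \<open>v t\<close> instead of \<open>P\<close>
    and \<open>\<theta>\<close>.\<close>
  have ricci: "(\<Sum>k\<in>UNIV. g (x t) (Rm (x t) (e k) (v t) (v t)) (e k)) = ric"
    and mn: "m = int CARD('n)"
    if t: "t \<in> ?I" and e: "\<And>k l. g (x t) (e k) (e l) = (if k = l then 1 else 0)" for t and e :: "'n \<Rightarrow> real ^ 'n"
  proof -
    have tI: "t \<in> {-s<..<s}" using t by auto
    have xt: "x t \<in> U" by (rule jf.xU[OF tI])
    have c: "coord c (point_at (x t)) = x t" by (rule point_at(2)[OF xt])
    have "g (x t) (v t) (v t) = 1" by (rule jf.unit_speed[OF tI])
    note r = ricci_of_density[OF point_at(3)[OF xt] dens _ \<Theta> S2 C2 m, unfolded c, OF this e]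
    show "m = int CARD('n)" by (rule r(1))
    have "- 6 * ((of_int m - 1) * (- \<epsilon> / 6) + of_int k * (- \<epsilon> / 2)) = ric"
      by (simp add: ric_def field_simps)
    with r(2) show "(\<Sum>k\<in>UNIV. g (x t) (Rm (x t) (e k) (v t) (v t)) (e k)) = ric" by (simp only:)
  qed
  have m_card: "of_int m = real CARD('n)"
  proof -
    have t: "s / 2 \<in> ?I" "s / 2 \<in> {-s<..<s}" using jf.s by auto
    obtain e :: "'n \<Rightarrow> real ^ 'n" where "\<And>k l. g (x (s / 2)) (e k) (e l) = (if k = l then 1 else 0)"
      using orthonormal_basis_exists[OF jf.xU[OF t(2)]] by blast
    from mn[OF t(1) this] show ?thesis by simp
  qed
  have key: "- a' t - ric + (\<phi> t)\<^sup>2 * (real CARD('n) - 1) - 2 * \<phi> t * a t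
      = (S t / C t)\<^sup>2 * (of_int k + (of_int m - 1) * \<xi>\<^sup>2 - 2 * \<xi> * of_int k)" if t: "t \<in> ?I" for t
  proof -
    \<comment> \<open>With the quotient of \<open>S\<close> and \<open>C\<close> and its inverse as
      variables the identity becomes polynomial modulo u T = 1 and \<epsilon>^2 = 1.\<close>
    define T where "T = S t / C t"
    define u where "u = C t / S t"
    have uT: "u * T = 1" using p[OF t] by (simp add: u_def T_def)
    have 1: "1 / (S t)\<^sup>2 = u\<^sup>2 + \<epsilon>"
      using p[OF t] SC[of t] by (simp add: u_def field_simps)
    have 2: "1 / (C t)\<^sup>2 = 1 + \<epsilon> * T\<^sup>2"
      using p[OF t] SC[of t] by (simp add: T_def field_simps)
    have a'_eq: "a' t = - (of_int m - 1) * (u\<^sup>2 + \<epsilon>) - \<epsilon> * of_int k * (1 + \<epsilon> * T\<^sup>2)"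
      unfolding 1[symmetric] 2[symmetric] a'_def by simp
    have "- a' t - ric + (\<phi> t)\<^sup>2 * (of_int m - 1) - 2 * \<phi> t * a t =
        (of_int m - 1) * (u\<^sup>2 + \<epsilon>) + \<epsilon> * of_int k * (1 + \<epsilon> * T\<^sup>2) - ric
        + (u - \<epsilon> * \<xi> * T)\<^sup>2 * (of_int m - 1)
        - 2 * (u - \<epsilon> * \<xi> * T) * ((of_int m - 1) * u - \<epsilon> * of_int k * T)"
      unfolding a'_eq a_def \<phi>_def T_def[symmetric] u_def[symmetric] by (simp add: algebra_simps)
    also have "\<dots> = T\<^sup>2 * (of_int k + (of_int m - 1) * \<xi>\<^sup>2 - 2 * \<xi> * of_int k)"
      using uT \<epsilon> unfolding ric_def by algebra
    finally show ?thesis unfolding m_card T_def .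
  qed
  have ineq: "0 \<le> - a' t - ric + \<phi>\<^sup>2 * (real CARD('n) - 1) - 2 * \<phi> * a t"
    "- a' t - ric + \<phi>\<^sup>2 * (real CARD('n) - 1) - 2 * \<phi> * a t = 0 \<Longrightarrow>
       jf.H t = t *\<^sub>R outer jf.th jf.th + \<phi> *\<^sub>R (jf.G t - t\<^sup>2 *\<^sub>R outer jf.th jf.th)"
    if "t \<in> ?I" for t \<phi>
    by (rule jf.riccati_inequality[OF det' \<Theta>'0 d\<Theta> da ricci that]; assumption)+
  show "0 \<le> of_int k + (of_int m - 1) * \<xi>\<^sup>2 - 2 * \<xi> * of_int k"
  proof -
    \<comment> \<open>One time suffices, because the quadratic in \<open>\<xi>\<close> does not
      depend on it.\<close>
    have t: "s / 2 \<in> ?I" using jf.s by auto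
    have "0 \<le> (S (s / 2) / C (s / 2))\<^sup>2 * (of_int k + (of_int m - 1) * \<xi>\<^sup>2 - 2 * \<xi> * of_int k)"
      using ineq(1)[OF t, of "\<phi> (s / 2)"] unfolding key[OF t] .
    moreover have "(S (s / 2) / C (s / 2))\<^sup>2 > 0" using p[OF t] by simp
    ultimately show ?thesis by (simp only: zero_le_mult_iff) linarith
  qed
  assume eq0: "of_int k + (of_int m - 1) * \<xi>\<^sup>2 - 2 * \<xi> * of_int k = 0"
    and dF: "\<And>t. t \<in> {0<..<1} \<Longrightarrow> (F has_real_derivative (C t / S t - \<epsilon> * \<xi> * (S t / C t)) * F t) (at t)"
    and F0: "\<And>t. t \<in> {0<..<1} \<Longrightarrow> F t \<noteq> 0"
    and F4: "((\<lambda>t. ((F t)\<^sup>2 - t\<^sup>2) / t ^ 4) \<longlongrightarrow> - \<kappa> / 3) (at_right 0)"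
  let ?P = "outer jf.th jf.th"
  have H: "jf.H t = t *\<^sub>R ?P + \<phi> t *\<^sub>R (jf.G t - t\<^sup>2 *\<^sub>R ?P)" if t: "t \<in> ?I" for t
    by (rule ineq(2)[OF t]) (simp only: key[OF t] eq0 mult_zero_right)
  \<comment> \<open>In the equality case \<open>H\<close> is determined by \<open>G\<close>, so G' =
    2 H becomes a linear equation with coefficient 2 \<phi> for each entry of the nonradial part.
    The square of \<open>F\<close> solves it as well; the constant quotient is read off from the t^2
    term.\<close>
  have G: "jf.G t $ i $ j - t\<^sup>2 * ?P $ i $ j = (F t)\<^sup>2 * (mat 1 - ?P) $ i $ j" if t: "t \<in> ?I" for t i j
  proof -
    define N where "N t = jf.G t $ i $ j - t\<^sup>2 * ?P $ i $ j" for t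
    have "((\<lambda>t. N t / (F t)\<^sup>2) has_real_derivative 0) (at t)" if t: "t \<in> ?I" for t
    proof -
      have tI: "t \<in> {-s<..<s}" using t by auto
      have "((\<lambda>t. t\<^sup>2) has_real_derivative 2 * t) (at t)" by (auto intro!: derivative_eq_intros)
      from DERIV_diff[OF jf.dG[OF tI] DERIV_cmult_right[OF this]]
      have "(N has_real_derivative 2 * jf.H t $ i $ j - 2 * t * ?P $ i $ j) (at t)" by (simp add: N_def[abs_def])
      moreover have "2 * jf.H t $ i $ j - 2 * t * ?P $ i $ j = 2 * \<phi> t * N t"
        unfolding H[OF t] N_def by (simp add: algebra_simps)
      ultimately have dN: "(N has_real_derivative 2 * \<phi> t * N t) (at t)" by (simp only:)
      have "((\<lambda>t. (F t)\<^sup>2) has_real_derivative 2 * F t * (\<phi> t * F t)) (at t)"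
        using dF[OF t1[OF t]] by (auto intro!: derivative_eq_intros simp: \<phi>_def)
      from DERIV_divide[OF dN this] show ?thesis
        using F0[OF t1[OF t]] by (simp add: power2_eq_square algebra_simps)
    qed
    then obtain q where q': "\<And>t. t \<in> ?I \<Longrightarrow> N t / (F t)\<^sup>2 = q"
      using has_field_derivative_zero_constant[of ?I "\<lambda>t. N t / (F t)\<^sup>2"]
      by (metis convex_real_interval(8) has_field_derivative_at_within)
    have q: "N t = q * (F t)\<^sup>2" if "t \<in> ?I" for t
      using F0[OF t1[OF that]] q'[OF that, symmetric] by simp
    have F2: "second_order (\<lambda>t. (F t)\<^sup>2 / t\<^sup>2) (- \<kappa> / 3)"
      unfolding second_order_def
      by (rule Lim_transform_eventually[OF F4])
        (use eventually_at_right_less[of "0::real"] in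
          \<open>eventually_elim, simp add: field_simps power2_eq_square power4_eq_xxxx\<close>)
    have lim1: "((\<lambda>t. N t / t\<^sup>2) \<longlongrightarrow> q * 1) (at_right 0)"
    proof (rule Lim_transform_eventually)
      show "((\<lambda>t. q * ((F t)\<^sup>2 / t\<^sup>2)) \<longlongrightarrow> q * 1) (at_right 0)"
        by (intro tendsto_intros second_order_tendsto_1[OF F2])
      show "\<forall>\<^sub>F t in at_right 0. q * ((F t)\<^sup>2 / t\<^sup>2) = N t / t\<^sup>2"
        using jf.ev_I by eventually_elim (simp add: q)
    qed
    have "((\<lambda>t. N t / t\<^sup>2) \<longlongrightarrow> - 1 / 3 * jf.R0 $ i $ j * 0\<^sup>2 + (mat 1 - ?P) $ i $ j) (at_right 0)"
    proof (rule Lim_transform_eventually)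
      show "((\<lambda>t. (jf.G t $ i $ j - t\<^sup>2 * mat 1 $ i $ j) / t ^ 4 * t\<^sup>2 + (mat 1 - ?P) $ i $ j) \<longlongrightarrow>
          - 1 / 3 * jf.R0 $ i $ j * 0\<^sup>2 + (mat 1 - ?P) $ i $ j) (at_right 0)"
        by (intro tendsto_add tendsto_mult tendsto_power tendsto_const tendsto_ident_at jf.lim_G)
      show "\<forall>\<^sub>F t in at_right 0. (jf.G t $ i $ j - t\<^sup>2 * mat 1 $ i $ j) / t ^ 4 * t\<^sup>2 + (mat 1 - ?P) $ i $ j = N t / t\<^sup>2"
        using eventually_at_right_less[of "0::real"]
        by eventually_elim (simp add: N_def field_simps power2_eq_square power4_eq_xxxx)
    qed
    from tendsto_unique[OF trivial_limit_at_right_real lim1 this]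
    have "q = (mat 1 - ?P) $ i $ j" by simp
    then show ?thesis using q[OF t] by (simp add: N_def)
  qed
  have "jf.R0 = \<kappa> *\<^sub>R (mat 1 - ?P)"
  proof (rule jf.radial_curvature[OF _ F4])
    show "\<forall>\<^sub>F t in at_right 0. jf.G t = t\<^sup>2 *\<^sub>R ?P + (F t)\<^sup>2 *\<^sub>R (mat 1 - ?P)"
      using jf.ev_I
    proof eventually_elim
      case (elim t)
      show ?case using G[OF elim] by (simp add: vec_eq_iff algebra_simps)
    qed
  qed
  then have R0: "g (x 0) (Rm (x 0) (f i) \<theta> \<theta>) (f j) = \<kappa> * ((if i = j then 1 else 0) - jf.th $ i * jf.th $ j)" for i j
    unfolding jf.R0_def by (simp add: vec_eq_iff mat_def outer_def)
  define w where "w i = g (x 0) u (f i)" for i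
  note x0U = jf.x0U
  have uu: "u = (\<Sum>i\<in>UNIV. w i *\<^sub>R f i)" unfolding w_def by (rule orthonormal_expansion[OF x0U jf.frame])
  have "g (x 0) (Rm (x 0) u \<theta> \<theta>) u = (\<Sum>j\<in>UNIV. \<Sum>i\<in>UNIV. w i * w j * g (x 0) (Rm (x 0) (f i) \<theta> \<theta>) (f j))"
    by (subst (1 2) uu) (simp add: linear_sum[OF curvature_linear(1)[OF x0U]] linear_scale[OF curvature_linear(1)[OF x0U]]
        linear_sum[OF g_linear(1)[OF x0U]] linear_sum[OF g_linear(2)[OF x0U]] g_simps[OF x0U] sum_distrib_left mult_ac)
  also have "\<dots> = (\<Sum>i\<in>UNIV. \<Sum>j\<in>UNIV. w i * w j * g (x 0) (Rm (x 0) (f i) \<theta> \<theta>) (f j))"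
    by (rule sum.swap)
  also have "\<dots> = \<kappa> * ((\<Sum>i\<in>UNIV. w i * w i) - (\<Sum>i\<in>UNIV. w i * jf.th $ i) * (\<Sum>j\<in>UNIV. w j * jf.th $ j))"
  proof -
    have "(\<Sum>i\<in>UNIV. \<Sum>j\<in>UNIV. w i * w j * g (x 0) (Rm (x 0) (f i) \<theta> \<theta>) (f j)) =
        (\<Sum>i\<in>UNIV. \<Sum>j\<in>UNIV. \<kappa> * ((if i = j then w i * w j else 0) - (w i * jf.th $ i) * (w j * jf.th $ j)))"
      unfolding R0 by (intro sum.cong refl) (simp add: algebra_simps)
    also have "\<dots> = \<kappa> * ((\<Sum>i\<in>UNIV. \<Sum>j\<in>UNIV. if i = j then w i * w j else 0)
        - (\<Sum>i\<in>UNIV. \<Sum>j\<in>UNIV. (w i * jf.th $ i) * (w j * jf.th $ j)))"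
      by (simp only: sum_distrib_left[symmetric] sum_subtractf)
    also have "\<dots> = \<kappa> * ((\<Sum>i\<in>UNIV. w i * w i) - (\<Sum>i\<in>UNIV. w i * jf.th $ i) * (\<Sum>j\<in>UNIV. w j * jf.th $ j))"
      by (simp add: sum_product)
    finally show ?thesis .
  qed
  also have "(\<Sum>i\<in>UNIV. w i * w i) = g (x 0) u u"
    unfolding w_def by (rule parseval[OF x0U jf.frame, symmetric])
  also have "(\<Sum>i\<in>UNIV. w i * jf.th $ i) = g (x 0) u \<theta>"
    unfolding w_def jf.th_def using parseval[OF x0U jf.frame, of u \<theta>] by simp
  finally show "g (coord c P) (Rm (coord c P) u \<theta> \<theta>) u = \<kappa> * (g (coord c P) u u - (g (coord c P) u \<theta>)\<^sup>2)"
    by (simp add: x0 power2_eq_square)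
qed

text \<open>The radial formula concerns unit vectors, so \<open>v\<close> is normalized, and both
  sides scale quadratically in \<open>v\<close>. The denominator is nonzero by the equality case of
  the Cauchy-Schwarz inequality.\<close>

lemma sectional_curvature_of_radial:
  assumes x: "x \<in> U" and uv: "u \<noteq> v" "independent {u, v}"
    and R: "\<And>\<theta>. g x \<theta> \<theta> = 1 \<Longrightarrow> g x (Rm x u \<theta> \<theta>) u = \<kappa> * (g x u u - (g x u \<theta>)\<^sup>2)"
  shows "sectional_curvature M c x u v = \<kappa>"
proof -
  have "v \<noteq> 0" using uv(2) dependent_zero[of "{u, v}"] by auto
  then have vpos: "g x v v > 0" by (rule g_pos[OF x])
  define r where "r = sqrt (g x v v)"
  have r: "r > 0" "r\<^sup>2 = g x v v" using vpos by (auto simp: r_def)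
  define \<theta> where "\<theta> = v /\<^sub>R r"
  have v: "v = r *\<^sub>R \<theta>" using r by (simp add: \<theta>_def)
  have "r\<^sup>2 * g x \<theta> \<theta> = r\<^sup>2" using r(2) by (simp add: v g_simps[OF x] power2_eq_square)
  then have unit: "g x \<theta> \<theta> = 1" using r(1) by simp
  have "g x (Rm x u v v) u = r\<^sup>2 * g x (Rm x u \<theta> \<theta>) u"
    by (simp add: v linear_scale[OF curvature_linear(2)[OF x]] linear_scale[OF curvature_linear(3)[OF x]]
        g_simps[OF x] power2_eq_square)
  also have "\<dots> = \<kappa> * (g x u u * r\<^sup>2 - (r * g x u \<theta>)\<^sup>2)"
    unfolding R[OF unit] by (simp add: algebra_simps power2_eq_square)
  also have "\<dots> = \<kappa> * (g x u u * g x v v - (g x u v)\<^sup>2)"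
    using r(2) by (simp add: v g_simps[OF x])
  finally have eq: "g x (Rm x u v v) u = \<kappa> * (g x u u * g x v v - (g x u v)\<^sup>2)" .
  have "g x u u * g x v v - (g x u v)\<^sup>2 \<noteq> 0"
  proof
    assume z: "g x u u * g x v v - (g x u v)\<^sup>2 = 0"
    \<comment> \<open>The component of \<open>u\<close> orthogonal to \<open>v\<close>; if the
      denominator vanished it would be 0, making \<open>u\<close> a multiple of
      \<open>v\<close>.\<close>
    let ?w = "u - (g x u v / g x v v) *\<^sub>R v"
    have "g x v v * g x ?w ?w = g x u u * g x v v - (g x u v)\<^sup>2"
      using vpos g_sym[OF x, of v u] by (simp add: g_simps[OF x] field_simps power2_eq_square)
    then have "g x ?w ?w = 0" using z vpos by simp
    then have "?w = 0" using g_pos[OF x, of ?w] by auto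
    then have "u = (g x u v / g x v v) *\<^sub>R v" by simp
    then have "u \<in> span {v}" by (metis span_base span_scale singletonI)
    then show False using uv by (simp add: independent_insert)
  qed
  then show ?thesis unfolding sectional_curvature_def eq by simp
qed

end

theorem lemma1p7:
  fixes M :: "('a, 'n::finite) rspace" and \<Theta> :: "real \<Rightarrow> real" and \<epsilon> m k :: int
  assumes "\<epsilon> \<in> {1, -1}" and "m \<ge> 1"
    and "harmonic_space M"
    and "density_function M \<Theta>"
    and "\<forall>\<^sub>F r in at_right 0. \<Theta> r = model_density \<epsilon> m k r"
  shows "(m = int CARD('n) \<and> 0 \<le> k \<and> k \<le> m - 1)
       \<and> (k = 0 \<longrightarrow> constant_sectional_curvature M (of_int \<epsilon>))
       \<and> (k = m - 1 \<longrightarrow> constant_sectional_curvature M (4 * of_int \<epsilon>))"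
proof -
  obtain S C :: "real \<Rightarrow> real" where
    model: "\<And>m k r. model_density \<epsilon> m k r = S r powi (m - 1) * C r powi k"
    and dS: "\<And>t. (S has_real_derivative C t) (at t)"
    and dC: "\<And>t. (C has_real_derivative - of_int \<epsilon> * S t) (at t)"
    and SC: "\<And>t. (C t)\<^sup>2 + of_int \<epsilon> * (S t)\<^sup>2 = 1"
    and pos: "\<And>t. t \<in> {0<..<1} \<Longrightarrow> S t > 0" "\<And>t. t \<in> {0<..<1} \<Longrightarrow> C t > 0"
    and S2: "((\<lambda>t. (S t / t - 1) / t\<^sup>2) \<longlongrightarrow> - of_int \<epsilon> / 6) (at_right 0)"
    and C2: "((\<lambda>t. (C t - 1) / t\<^sup>2) \<longlongrightarrow> - of_int \<epsilon> / 2) (at_right 0)"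
    and S4: "((\<lambda>t. ((S t)\<^sup>2 - t\<^sup>2) / t ^ 4) \<longlongrightarrow> - of_int \<epsilon> / 3) (at_right 0)"
    and SC4: "((\<lambda>t. ((S t * C t)\<^sup>2 - t\<^sup>2) / t ^ 4) \<longlongrightarrow> - (4 * of_int \<epsilon>) / 3) (at_right 0)"
    by (rule model_functions[OF assms(1)], rule that)
  have \<epsilon>2: "(of_int \<epsilon>)\<^sup>2 = (1::real)" using assms(1) by auto
  have \<Theta>: "\<forall>\<^sub>F t in at_right 0. \<Theta> t = S t powi (m - 1) * C t powi k"
    using assms(5) unfolding model .
  have M: "riemannian_manifold M" using assms(3) by (simp add: harmonic_space_def)
  have rc: "riem_chart M c" if "c \<in> atlas M" for c using M that by (simp add: riem_chart_def)
  note S2' = S2[folded second_order_def] and C2' = C2[folded second_order_def]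
  note rigid = riem_chart.model_density_rigidity[OF rc _ assms(4) _ \<Theta> assms(2) dS dC SC \<epsilon>2 pos S2' C2']
  have "points M \<noteq> {}" "(\<Union>c\<in>atlas M. dom_of c) = points M"
    using M by (auto simp: riemannian_manifold_def smooth_manifold_def)
  then obtain c P where cP: "c \<in> atlas M" "P \<in> dom_of c" by blast
  interpret c: riem_chart M c by (rule rc[OF cP(1)])
  have x0: "coord c P \<in> c.U" using cP by (auto simp: c.U_def)
  obtain e :: "'n \<Rightarrow> real ^ 'n" where e: "\<And>i j. c.g (coord c P) (e i) (e j) = (if i = j then 1 else 0)"
    using c.orthonormal_basis_exists[OF x0] by blast
  have e1: "c.g (coord c P) (e i) (e i) = 1" for i using e by simp
  have m: "m = int CARD('n)"
    by (rule c.ricci_of_density(1)[OF cP(2) assms(4) e1 \<Theta> S2' C2' assms(2) e])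
  have k0: "0 \<le> k" using rigid(1)[OF cP e1, of 0] by simp
  have "0 \<le> of_int k + (of_int m - 1) * 1\<^sup>2 - 2 * 1 * (of_int k :: real)" by (rule rigid(1)[OF cP e1])
  then have "of_int k \<le> (of_int (m - 1) :: real)" by simp
  then have k1: "k \<le> m - 1" by (simp only: of_int_le_iff)
  have "constant_sectional_curvature M (of_int \<epsilon>)" if k: "k = 0"
    unfolding constant_sectional_curvature_def
  proof (intro ballI allI impI, elim conjE)
    fix c :: "('a, 'n) chart" and P and u v :: "real ^ 'n" assume c: "c \<in> atlas M" "P \<in> dom_of c" and uv: "u \<noteq> v" "independent {u, v}"
    interpret d: riem_chart M c by (rule rc[OF c(1)])
    have x0: "coord c P \<in> d.U" using c by (auto simp: d.U_def)
    show "sectional_curvature M c (coord c P) u v = of_int \<epsilon>"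
    proof (rule d.sectional_curvature_of_radial[OF x0 uv])
      fix \<theta> assume \<theta>: "d.g (coord c P) \<theta> \<theta> = 1"
      show "d.g (coord c P) (d.Rm (coord c P) u \<theta> \<theta>) u =
          of_int \<epsilon> * (d.g (coord c P) u u - (d.g (coord c P) u \<theta>)\<^sup>2)"
      proof (rule rigid(2)[OF c \<theta>, where \<xi>=0 and F=S, OF _ _ _ _ _ S4])
        fix t :: real assume t: "t \<in> {0<..<1}"
        show "S t \<noteq> 0" using pos(1)[OF t] by simp
        show "(S has_real_derivative (C t / S t - of_int \<epsilon> * 0 * (S t / C t)) * S t) (at t)"
          using dS[of t] pos(1)[OF t] by simp
      qed (simp_all add: k)
    qed
  qed
  moreover have "constant_sectional_curvature M (4 * of_int \<epsilon>)" if k: "k = m - 1"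
    unfolding constant_sectional_curvature_def
  proof (intro ballI allI impI, elim conjE)
    fix c :: "('a, 'n) chart" and P and u v :: "real ^ 'n" assume c: "c \<in> atlas M" "P \<in> dom_of c" and uv: "u \<noteq> v" "independent {u, v}"
    interpret d: riem_chart M c by (rule rc[OF c(1)])
    have x0: "coord c P \<in> d.U" using c by (auto simp: d.U_def)
    show "sectional_curvature M c (coord c P) u v = 4 * of_int \<epsilon>"
    proof (rule d.sectional_curvature_of_radial[OF x0 uv])
      fix \<theta> assume \<theta>: "d.g (coord c P) \<theta> \<theta> = 1"
      show "d.g (coord c P) (d.Rm (coord c P) u \<theta> \<theta>) u =
          4 * of_int \<epsilon> * (d.g (coord c P) u u - (d.g (coord c P) u \<theta>)\<^sup>2)"
      \<comment> \<open>For \<xi> = 1 and k = m - 1 the quadratic k + (m - 1) \<xi>^2 - 2 \<xi> k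
        vanishes, and S C has the required logarithmic derivative because C'/C = -\<epsilon>
        S/C.\<close>
      proof (rule rigid(2)[OF c \<theta>, where \<xi>=1 and F="\<lambda>t. S t * C t", OF _ _ _ _ _ SC4])
        fix t :: real assume t: "t \<in> {0<..<1}"
        show "S t * C t \<noteq> 0" using pos[OF t] by simp
        have "((\<lambda>t. S t * C t) has_real_derivative C t * C t + (- of_int \<epsilon> * S t) * S t) (at t)"
          by (rule DERIV_mult[OF dS dC])
        moreover have "C t * C t + (- of_int \<epsilon> * S t) * S t =
            (C t / S t - of_int \<epsilon> * 1 * (S t / C t)) * (S t * C t)"
          using pos[OF t] by (simp add: field_simps)
        ultimately show "((\<lambda>t. S t * C t) has_real_derivative
            (C t / S t - of_int \<epsilon> * 1 * (S t / C t)) * (S t * C t)) (at t)"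
          by (simp only:)
      qed (simp_all add: k)
    qed
  qed
  ultimately show ?thesis using m k0 k1 by blast
qed

end
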